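(* Let $0<a<1$. For each $n$, let $x,y$ be sampled independently from the hitting distribution $\nu$ on the sphere $\partial B(an)\subset\mathcal S_n$, and let $p=I$ be the identity permutation. 1. If $a<1/4$, then there is some $\delta<\infty$, depending only on $a$, such that $E\,(x|y)_p\le\delta$ for all $n$. Moreover, with probability asymptotically $1$ there is a geodesic between $x$ and $y$ that comes within bounded expected distance of $p$; that is, there are $\delta'<\infty$ (not depending on $n$) and events $\mathcal E_n$ with $P(\mathcal E_n)\to1$ as $n\to\infty$ such that, on $\mathcal E_n$, one can choose a geodesic $\gamma$ between $x$ and $y$ with $E[d(p,\gamma)\mid\mathcal E_n]\le\delta'$. 2. If $a>1/4$, then there is $0<\delta<\infty$ such that $E\,(x|y)_p\sim\delta n$ as $n\to\infty$. Moreover, there is $0<\delta'<\infty$ such that, with probability tending to $1$ as $n\to\infty$, every geodesic $\gamma$ between $x$ and $y$ satisfies $d(p,\gamma)\ge\delta' n$.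
   Context: $\mathcal S_n$ is the set of permutations of $\{1,\dots,n\}$, made into a graph $G_n$ by joining two permutations that differ by (multiplication by) one transposition, i.e. $G_n$ is the Cayley graph of $\mathcal S_n$ with respect to the set of all transpositions; $d(x,y)=|x-y|$ is the graph distance, $I$ the identity, $d(\sigma)=d(I,\sigma)$ (which equals $n$ minus the number of cycles of $\sigma$). The sphere $\partial B(an)$ is the set of $\sigma\in\mathcal S_n$ with $d(\sigma)=\lfloor an\rfloor$. $(\sigma_t)_{t\ge0}$ is the continuous-time simple random walk on $G_n$ started at $I$: at rate $1$ the current permutation is multiplied by a uniformly chosen transposition. The hitting distribution $\nu$ is the law of $\sigma_T$, $T=\inf\{t>0:d(\sigma_t)=\lfloor an\rfloor\}$. The Gromov inner product is defined by $2(x|y)_p=|x-p|+|y-p|-|x-y|$. A geodesic between $x$ and $y$ is a shortest path in $G_n$ from $x$ to $y$, and $d(p,\gamma)$ is the minimum distance from $p$ to a vertex of $\gamma$. $a_n\sim b_n$ means $a_n/b_n\to1$. *)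

theory Defs
  imports
    "HOL-Probability.Probability"
    "HOL-Combinatorics.Permutations"
    "HOL-Library.Landau_Symbols"
begin

definition perms :: "nat \<Rightarrow> (nat \<Rightarrow> nat) set" where
  "perms n = {\<pi>. \<pi> permutes {1..n}}"

definition transpositions :: "nat \<Rightarrow> (nat \<Rightarrow> nat) set" where
  "transpositions n = {Transposition.transpose i j | i j. i \<in> {1..n} \<and> j \<in> {1..n} \<and> i \<noteq> j}"

(* Transpositions are closed under conjugation, so multiplying on the left instead
   would give the same graph. *)
definition adjacent :: "nat \<Rightarrow> (nat \<Rightarrow> nat) \<Rightarrow> (nat \<Rightarrow> nat) \<Rightarrow> bool" where
  "adjacent n x y \<longleftrightarrow> x \<in> perms n \<and> y \<in> perms n \<and> (\<exists>\<tau>\<in>transpositions n. y = x \<circ> \<tau>)"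

(* A path is given by the list of its vertices, so it has length \<gamma> - 1 edges. *)
definition is_path :: "nat \<Rightarrow> (nat \<Rightarrow> nat) \<Rightarrow> (nat \<Rightarrow> nat) \<Rightarrow> (nat \<Rightarrow> nat) list \<Rightarrow> bool" where
  "is_path n x y \<gamma> \<longleftrightarrow>
     \<gamma> \<noteq> [] \<and> hd \<gamma> = x \<and> last \<gamma> = y \<and> set \<gamma> \<subseteq> perms n \<and> successively (adjacent n) \<gamma>"

definition gdist :: "nat \<Rightarrow> (nat \<Rightarrow> nat) \<Rightarrow> (nat \<Rightarrow> nat) \<Rightarrow> nat" where
  "gdist n x y = Inf {length \<gamma> - 1 | \<gamma>. is_path n x y \<gamma>}"

definition geodesic :: "nat \<Rightarrow> (nat \<Rightarrow> nat) \<Rightarrow> (nat \<Rightarrow> nat) \<Rightarrow> (nat \<Rightarrow> nat) list \<Rightarrow> bool" where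
  "geodesic n x y \<gamma> \<longleftrightarrow> is_path n x y \<gamma> \<and> length \<gamma> - 1 = gdist n x y"

definition dist_to_path :: "nat \<Rightarrow> (nat \<Rightarrow> nat) \<Rightarrow> (nat \<Rightarrow> nat) list \<Rightarrow> nat" where
  "dist_to_path n p \<gamma> = Min (gdist n p ` set \<gamma>)"

definition gromov_product :: "nat \<Rightarrow> (nat \<Rightarrow> nat) \<Rightarrow> (nat \<Rightarrow> nat) \<Rightarrow> (nat \<Rightarrow> nat) \<Rightarrow> real" where
  "gromov_product n p x y =
     (real (gdist n x p) + real (gdist n y p) - real (gdist n x y)) / 2"

(* For n < 2 there are no transpositions and the walk stays put. *)
definition steps :: "nat \<Rightarrow> (nat \<Rightarrow> nat) set" where
  "steps n = (if n < 2 then {id} else transpositions n)"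

(* The randomness driving the walk: a sequence of independent rate 1 exponential holding
   times and, independently, a sequence of independent uniform transpositions. *)
definition walk_space :: "nat \<Rightarrow> ((nat \<Rightarrow> real) \<times> (nat \<Rightarrow> nat \<Rightarrow> nat)) measure" where
  "walk_space n =
     (\<Pi>\<^sub>M i\<in>UNIV. density lborel (exponential_density 1)) \<Otimes>\<^sub>M
     (\<Pi>\<^sub>M i\<in>UNIV. uniform_count_measure (steps n))"

primrec jump_chain :: "(nat \<Rightarrow> nat \<Rightarrow> nat) \<Rightarrow> nat \<Rightarrow> nat \<Rightarrow> nat" where
  "jump_chain \<tau> 0 = id"
| "jump_chain \<tau> (Suc k) = jump_chain \<tau> k \<circ> \<tau> k"

(* The (k+1)-st jump happens at time (\<Sum>i\<le>k. \<xi> i). *)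
definition num_jumps :: "(nat \<Rightarrow> real) \<Rightarrow> real \<Rightarrow> nat" where
  "num_jumps \<xi> t = (LEAST k. t < (\<Sum>i\<le>k. \<xi> i))"

definition walk :: "(nat \<Rightarrow> real) \<times> (nat \<Rightarrow> nat \<Rightarrow> nat) \<Rightarrow> real \<Rightarrow> nat \<Rightarrow> nat" where
  "walk \<omega> t = jump_chain (snd \<omega>) (num_jumps (fst \<omega>) t)"

definition hitting_time :: "nat \<Rightarrow> real \<Rightarrow> (nat \<Rightarrow> real) \<times> (nat \<Rightarrow> nat \<Rightarrow> nat) \<Rightarrow> real" where
  "hitting_time n a \<omega> = Inf {t. 0 < t \<and> gdist n id (walk \<omega> t) = nat \<lfloor>a * real n\<rfloor>}"

definition hitting_distribution :: "nat \<Rightarrow> real \<Rightarrow> (nat \<Rightarrow> nat) measure" where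
  "hitting_distribution n a =
     distr (walk_space n) (count_space (perms n)) (\<lambda>\<omega>. walk \<omega> (hitting_time n a \<omega>))"

definition pair_law :: "nat \<Rightarrow> real \<Rightarrow> ((nat \<Rightarrow> nat) \<times> (nat \<Rightarrow> nat)) measure" where
  "pair_law n a = hitting_distribution n a \<Otimes>\<^sub>M hitting_distribution n a"

definition expected_gromov :: "nat \<Rightarrow> real \<Rightarrow> real" where
  "expected_gromov n a = (\<integral>(x, y). gromov_product n id x y \<partial>pair_law n a)"

(* Equal to 0 if A is a null set. *)
definition cond_expect :: "'a measure \<Rightarrow> 'a set \<Rightarrow> ('a \<Rightarrow> real) \<Rightarrow> real" where
  "cond_expect M A f = (LINT z:A|M. f z) / measure M A"

end

theory Submission
  imports Defs
    "HOL-Combinatorics.Orbits"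
    "HOL-Library.Transitive_Closure_Table"
    "HOL-Real_Asymp.Real_Asymp"
begin

text \<open>
  The walk is a product of independent uniform transpositions, and its distance from the identity is
  \<open>n\<close> minus the number of cycles (\<open>gdist_eq_plen\<close>). A transposition merges two cycles, which moves the
  walk away from the identity, or splits a cycle, which moves it back. The hitting distribution only
  depends on the jumps: almost surely the stopped walk is the product of the jumps up to the first
  one at which the length equals \<open>\<lfloor>a n\<rfloor>\<close> (\<open>hit_perm_stopped\<close>). Everything is therefore reduced to
  uniform words in the transpositions (\<open>pair_law_integral_le\<close>). For two independent words with
  products \<open>x\<close> and \<open>y\<close>, the permutation \<open>x^-1 y\<close> is spelled by the reversed word of \<open>x\<close> followed by the
  word of \<open>y\<close>, which for deterministic lengths is a uniform word again (\<open>wavg_two_sided\<close>). So if the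
  walk needs about \<open>c n\<close> jumps to reach distance \<open>a n\<close>, then \<open>|x - y|\<close> is the distance covered after
  about \<open>2 c n\<close> jumps, and the question is whether this equals \<open>2 a n\<close> or falls short of it.

  Splits are related to the multigraph whose edges are the letters of the word. A split closes a
  cycle of this graph, and a vertex whose component has a split is attached to a closed walk by a
  path; this configuration is called a lasso. If \<open>N / n\<close> stays below \<open>1/2\<close>, then the expected
  number of lassos in a word of length \<open>N\<close> is bounded (\<open>wavg_lassos\<close>): a lasso with \<open>L\<close> letters has
  about \<open>n^L N^L\<close> choices of vertices and positions, each of probability \<open>(2 / n^2)^L\<close>, up to
  constants. Consequently the length of the word is its number of letters up to a bounded
  expected error (\<open>plen_ge_lassos\<close>).

  For \<open>a < 1/4\<close> the word of \<open>x^-1 y\<close> has about \<open>2 a n < n/2\<close> letters. A cycle of \<open>x^-1 y\<close> is tidy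
  if its letters form a tree on it. On the tidy cycles the word is reduced, so a geodesic from \<open>x\<close> to
  \<open>y\<close> may undo all of \<open>x\<close> there before it builds \<open>y\<close>; it then comes as close to the identity as the
  number of points outside the tidy cycles (\<open>geodesic_near_id\<close>). Each such point is the origin of a
  lasso (\<open>untidy_vertices_subset_lasso_origin\<close>), so this distance has bounded expectation. It also
  bounds the Gromov product (\<open>gromov_product_le_dist_to_path\<close>).

  For \<open>a > 1/4\<close> the limit \<open>profile s\<close> of the expected length of a word with \<open>s n\<close> letters, divided
  by \<open>n\<close>, is needed beyond \<open>s = 1/2\<close>. Up to an error of order \<open>n / K\<close> only the tidy cycles of size at
  most \<open>K\<close> count: there are at most \<open>n / K\<close> larger cycles, and small untidy cycles
  come from splits with a small piece, of which boundedly many are expected (\<open>wavg_untidy\<close>). The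
  expected number of tidy cycles of a given size is explicit up to a factor that does not involve
  the number of letters. Hence it can be compared with the one at the dual parameter \<open>s' < 1/2\<close>, where
  \<open>s' exp (- 2 s') = s exp (- 2 s)\<close>: the ratio tends to \<open>s' / s\<close> for every size
  (\<open>tidy_ratio_lim\<close>). At \<open>s'\<close> the number of cycles is known, being \<open>(1 - s') n\<close> to first order, so
  \<open>profile s = 1 - (s' / s) (1 - s')\<close>. This is smaller than \<open>s\<close> (\<open>profile_less\<close>) since duality is
  not symmetric about \<open>1/2\<close>. The length of a word concentrates around its mean
  (\<open>plen_variance\<close>), thus the hitting position divided by \<open>n\<close> concentrates at the solution \<open>c\<close> of
  \<open>profile c = a\<close>, and the Gromov product divided by \<open>n\<close> converges in mean to
  \<open>\<delta> = a - profile (2 c) / 2 > 0\<close> (\<open>supercritical_L1\<close>).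
\<close>

abbreviation tr :: "nat \<Rightarrow> nat \<Rightarrow> nat \<Rightarrow> nat" where
  "tr i j \<equiv> Transposition.transpose i j"

section \<open>Cycles of permutations under multiplication by a transposition\<close>

lemma orbit_eq_of_mem:
  assumes "permutation w" "y \<in> orbit w x"
  shows "orbit w y = orbit w x"
  using cyclic_on_orbit'[OF assms(1)] assms(2) by (rule orbit_cyclic_eq3)

lemma orbit_disjoint_or_eq:
  assumes "permutation w"
  shows "orbit w x = orbit w y \<or> orbit w x \<inter> orbit w y = {}"
  using orbit_eq_of_mem[OF assms] by blast

lemma orbit_subset_closed:
  assumes "w x \<in> P" "\<And>y. y \<in> P \<Longrightarrow> w y \<in> P"
  shows "orbit w x \<subseteq> P"
proof
  fix y assume "y \<in> orbit w x"
  then show "y \<in> P" by induction (use assms in auto)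
qed

lemma permutation_comp_tr: "permutation w \<Longrightarrow> permutation (w \<circ> tr i j)"
  by (simp add: permutation_compose permutation_swap_id)

lemma orbit_comp_tr_other:
  assumes "permutation w" "i \<notin> orbit w x" "j \<notin> orbit w x"
  shows "orbit (w \<circ> tr i j) x = orbit w x"
proof (rule orbit_cong)
  show "x \<in> orbit w x" by (rule permutation_self_in_orbit[OF assms(1)])
  show "(w \<circ> tr i j) s = w s" if "s \<in> orbit w x" for s
    using that assms by (metis comp_apply transpose_apply_other)
qed

text \<open>If \<open>j = w^q i\<close> with \<open>q\<close> least positive, then after multiplication by the transposition
  the piece \<open>w i, \<dots>, w^q i\<close> closes up on itself. Counting the possible \<open>j\<close> with small \<open>q\<close> is
  what makes splits with a small piece rare.\<close>

lemma orbit_split: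
  assumes w: "permutation w" and ij: "i \<noteq> j" and j: "j \<in> orbit w i"
  defines "w' \<equiv> w \<circ> tr i j"
  shows "orbit w' i \<inter> orbit w' j = {}" "orbit w' i \<union> orbit w' j = orbit w i"
    "j = (w ^^ card (orbit w' j)) i"
proof -
  define q where "q = funpow_dist1 w i j"
  have q: "(w ^^ q) i = j" "q > 0"
    using funpow_dist1_prop[OF j] by (auto simp: q_def)
  have qmin: "(w ^^ p) i \<noteq> j" if "0 < p" "p < q" for p
    using that unfolding q_def by (rule funpow_dist1_least)
  have inj: "inj_on (\<lambda>p. (w ^^ p) i) {0..<q}"
    using inj_on_funpow_dist1[OF j] unfolding q_def .
  have noti: "(w ^^ p) i \<noteq> i" if "0 < p" "p \<le> q" for p
    using that inj_onD[OF inj, of p 0] q ij by (cases "p = q") auto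
  have bij: "bij w" by (rule permutation_bijective[OF w])
  have inj': "inj_on (\<lambda>p. (w ^^ p) i) {1..q}"
  proof (rule inj_onI)
    fix a b assume ab: "a \<in> {1..q}" "b \<in> {1..q}" "(w ^^ a) i = (w ^^ b) i"
    obtain a' b' where ab': "a = Suc a'" "b = Suc b'"
      using ab(1,2) by (cases a; cases b) auto
    have "w ((w ^^ a') i) = w ((w ^^ b') i)" using ab(3) unfolding ab' by simp
    then have "(w ^^ a') i = (w ^^ b') i"
      using bij_is_inj[OF bij] by (simp add: inj_eq)
    then have "a' = b'"
      by (rule inj_onD[OF inj]) (use ab(1,2) ab' in auto)
    then show "a = b" using ab' by simp
  qed
  have w': "permutation w'" unfolding w'_def by (rule permutation_comp_tr[OF w])
  have step: "(w ^^ p) i \<in> orbit w' j" if "0 < p" "p \<le> q" for p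
    using that
  proof (induction p)
    case (Suc p)
    show ?case
    proof (cases "p = 0")
      case True
      have "w' j = w i" by (simp add: w'_def)
      then show ?thesis using True orbit.base[of w' j] by simp
    next
      case False
      have "w' ((w ^^ p) i) = w ((w ^^ p) i)"
        using qmin[of p] noti[of p] False Suc.prems by (simp add: w'_def)
      moreover have "(w ^^ p) i \<in> orbit w' j" using Suc False by simp
      ultimately show ?thesis by (metis funpow.simps(2) comp_apply orbit.step)
    qed
  qed simp
  have sub: "orbit w' j \<subseteq> (\<lambda>p. (w ^^ p) i) ` {1..q}"
  proof (rule orbit_subset_closed)
    show "w' j \<in> (\<lambda>p. (w ^^ p) i) ` {1..q}"
      using q by (auto simp: w'_def intro!: image_eqI[of _ _ 1])
    fix y assume "y \<in> (\<lambda>p. (w ^^ p) i) ` {1..q}"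
    then obtain p where p: "p \<in> {1..q}" "y = (w ^^ p) i" by auto
    show "w' y \<in> (\<lambda>p. (w ^^ p) i) ` {1..q}"
    proof (cases "p = q")
      case True
      then show ?thesis using p q by (auto simp: w'_def intro!: image_eqI[of _ _ 1])
    next
      case False
      then have "w' y = (w ^^ Suc p) i"
        using p noti[of p] qmin[of p] by (simp add: w'_def)
      then show ?thesis using p False by (intro image_eqI[of _ _ "Suc p"]) auto
    qed
  qed
  have Oj: "orbit w' j = (\<lambda>p. (w ^^ p) i) ` {1..q}"
    using sub step by auto
  have card: "card (orbit w' j) = q"
    unfolding Oj using card_image[OF inj'] by simp
  show "j = (w ^^ card (orbit w' j)) i" using q card by simp
  have "i \<notin> orbit w' j"
  proof
    assume "i \<in> orbit w' j"
    then obtain p where "p \<in> {1..q}" "(w ^^ p) i = i" unfolding Oj by force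
    then show False using noti[of p] by simp
  qed
  then show disj: "orbit w' i \<inter> orbit w' j = {}"
    using orbit_disjoint_or_eq[OF w', of i j] permutation_self_in_orbit[OF w', of i] by blast
  have Oi: "orbit w j = orbit w i" by (rule orbit_eq_of_mem[OF w j])
  have cl: "w' y \<in> orbit w i" if "y \<in> orbit w i" for y
  proof -
    have "tr i j y \<in> orbit w i"
      using that permutation_self_in_orbit[OF w, of i] j by (simp add: Transposition.transpose_def)
    then show ?thesis by (simp add: w'_def orbit.step)
  qed
  have "orbit w' i \<subseteq> orbit w i" "orbit w' j \<subseteq> orbit w i"
    using cl permutation_self_in_orbit[OF w, of i] j by (intro orbit_subset_closed; simp)+
  moreover have "orbit w i \<subseteq> orbit w' i \<union> orbit w' j"
  proof (rule orbit_subset_closed)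
    have i: "i \<in> orbit w' i" and jj: "j \<in> orbit w' j"
      by (rule permutation_self_in_orbit[OF w'])+
    have wi: "w i \<in> orbit w' j" using orbit.base[of w' j] by (simp add: w'_def)
    then show "w i \<in> orbit w' i \<union> orbit w' j" by simp
    have wj: "w j \<in> orbit w' i" using orbit.base[of w' i] by (simp add: w'_def)
    fix y assume "y \<in> orbit w' i \<union> orbit w' j"
    then have "w' y \<in> orbit w' i \<union> orbit w' j" by (auto intro: orbit.step)
    then show "w y \<in> orbit w' i \<union> orbit w' j"
      using wi wj by (cases "y = i"; cases "y = j") (auto simp: w'_def)
  qed
  ultimately show "orbit w' i \<union> orbit w' j = orbit w i" by blast
qed

text \<open>If the two cycles were not joined, then the orbit of \<open>i\<close> would contain \<open>w j\<close> but never reach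
  \<open>j\<close>, although \<open>w\<close> and the new permutation agree on the way. Once \<open>j\<close> is in the orbit, the union
  formula is \<open>orbit_split\<close> for the new permutation, because the transposition is an involution.\<close>

lemma orbit_merge:
  assumes w: "permutation w" and ij: "j \<notin> orbit w i"
  defines "w' \<equiv> w \<circ> tr i j"
  shows "j \<in> orbit w' i" "orbit w' i = orbit w i \<union> orbit w j"
proof -
  have w': "permutation w'" unfolding w'_def by (rule permutation_comp_tr[OF w])
  have ne: "i \<noteq> j" using ij permutation_self_in_orbit[OF w, of i] by auto
  have disj: "orbit w i \<inter> orbit w j = {}"
    using orbit_disjoint_or_eq[OF w, of i j] ij permutation_self_in_orbit[OF w] by blast
  show mem: "j \<in> orbit w' i"
  proof (rule ccontr)
    assume nj: "j \<notin> orbit w' i"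
    have "orbit w j \<subseteq> orbit w' i \<inter> orbit w j"
    proof (rule orbit_subset_closed)
      show "w j \<in> orbit w' i \<inter> orbit w j"
        using orbit.base[of w' i] by (auto simp: w'_def intro: orbit.base)
      fix y assume y: "y \<in> orbit w' i \<inter> orbit w j"
      then have "y \<noteq> j" "y \<noteq> i" using nj disj permutation_self_in_orbit[OF w, of i] by auto
      then have "w' y = w y" by (simp add: w'_def)
      then show "w y \<in> orbit w' i \<inter> orbit w j" using y by (metis IntD1 IntD2 IntI orbit.step)
    qed
    then show False using nj permutation_self_in_orbit[OF w, of j] by blast
  qed
  have "w' \<circ> tr i j = w" by (simp add: w'_def comp_assoc)
  then show "orbit w' i = orbit w i \<union> orbit w j"
    using orbit_split(2)[OF w' ne mem] by simp
qed

definition cycles :: "'a set \<Rightarrow> ('a \<Rightarrow> 'a) \<Rightarrow> 'a set set" where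
  "cycles S w = orbit w ` S"

lemma permutes_permutation: "finite S \<Longrightarrow> w permutes S \<Longrightarrow> permutation w"
  by (auto simp: permutation_permutes)

lemma finite_cycles: "finite S \<Longrightarrow> finite (cycles S w)"
  by (simp add: cycles_def)

lemma cycles_subset: "w permutes S \<Longrightarrow> A \<in> cycles S w \<Longrightarrow> A \<subseteq> S"
  by (auto simp: cycles_def dest: permutes_orbit_subset)

lemma cycles_nonempty: "A \<in> cycles S w \<Longrightarrow> A \<noteq> {}"
  by (auto simp: cycles_def orbit_nonempty)

lemma cycles_disjoint:
  assumes "permutation w" "A \<in> cycles S w" "B \<in> cycles S w" "A \<noteq> B"
  shows "A \<inter> B = {}"
  using assms orbit_disjoint_or_eq[OF assms(1)] by (auto simp: cycles_def)

lemma Union_cycles: "finite S \<Longrightarrow> w permutes S \<Longrightarrow> \<Union>(cycles S w) = S"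
  using permutes_orbit_subset[of w S] permutation_self_in_orbit[OF permutes_permutation]
  by (fastforce simp: cycles_def)

lemma orbit_in_cycles: "x \<in> S \<Longrightarrow> orbit w x \<in> cycles S w"
  by (simp add: cycles_def)

lemma cycles_eq_orbit: "permutation w \<Longrightarrow> A \<in> cycles S w \<Longrightarrow> x \<in> A \<Longrightarrow> A = orbit w x"
  by (auto simp: cycles_def dest: orbit_eq_of_mem)

lemma cycles_merge:
  assumes S: "finite S" and w: "w permutes S" and i: "i \<in> S" and j: "j \<in> S"
    and ij: "j \<notin> orbit w i"
  shows "cycles S (w \<circ> tr i j)
    = insert (orbit w i \<union> orbit w j) (cycles S w - {orbit w i, orbit w j})"
proof -
  let ?w = "w \<circ> tr i j"
  have p: "permutation w" by (rule permutes_permutation[OF S w])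
  have p': "permutation ?w" by (rule permutation_comp_tr[OF p])
  note self = permutation_self_in_orbit[OF p]
  have o: "orbit ?w i = orbit w i \<union> orbit w j" "orbit ?w j = orbit w i \<union> orbit w j"
    using orbit_merge[OF p ij] orbit_eq_of_mem[OF p'] by auto
  have O: "orbit ?w x = (if x \<in> orbit w i \<union> orbit w j then orbit w i \<union> orbit w j else orbit w x)" for x
  proof (cases "x \<in> orbit w i \<union> orbit w j")
    case True
    then show ?thesis using o(1) orbit_eq_of_mem[OF p', of x i] by auto
  next
    case False
    then have "i \<notin> orbit w x" "j \<notin> orbit w x"
      using orbit_eq_of_mem[OF p] self by blast+
    then show ?thesis using False orbit_comp_tr_other[OF p] by simp
  qed
  show ?thesis
  proof (intro equalityI subsetI)
    fix A assume "A \<in> cycles S ?w"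
    then obtain x where x: "x \<in> S" "A = orbit ?w x" by (auto simp: cycles_def)
    show "A \<in> insert (orbit w i \<union> orbit w j) (cycles S w - {orbit w i, orbit w j})"
    proof (cases "x \<in> orbit w i \<union> orbit w j")
      case True
      then show ?thesis using O[of x] x by simp
    next
      case False
      then have "A = orbit w x" "orbit w x \<noteq> orbit w i" "orbit w x \<noteq> orbit w j"
        using O[of x] x self[of x] by auto
      then show ?thesis using x by (simp add: cycles_def)
    qed
  next
    fix A assume "A \<in> insert (orbit w i \<union> orbit w j) (cycles S w - {orbit w i, orbit w j})"
    then consider "A = orbit ?w i" | x where "x \<in> S" "A = orbit w x" "A \<noteq> orbit w i" "A \<noteq> orbit w j"
      using o(1) by (auto simp: cycles_def)
    then show "A \<in> cycles S ?w"
    proof cases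
      case 1
      then show ?thesis using i by (auto simp: cycles_def)
    next
      case 2
      then have "x \<notin> orbit w i \<union> orbit w j" using orbit_eq_of_mem[OF p] by blast
      then have "A = orbit ?w x" using O 2 by auto
      then show ?thesis using 2 by (simp add: cycles_def)
    qed
  qed
qed

lemma permutes_comp_tr:
  assumes "w permutes S" "i \<in> S" "j \<in> S"
  shows "w \<circ> tr i j permutes S"
  using permutes_compose[OF permutes_swap_id[OF assms(2,3)] assms(1)] .

text \<open>A transposition that splits a cycle of \<open>w\<close> merges the two pieces back when it is applied
  again, so the effect of a split can be read off from \<open>cycles_merge\<close>.\<close>

lemma split_imp_merge:
  assumes "permutation w" "i \<noteq> j" "j \<in> orbit w i"
  shows "j \<notin> orbit (w \<circ> tr i j) i"
  using orbit_split(1)[OF assms] permutation_self_in_orbit[OF permutation_comp_tr[OF assms(1)]]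
  by blast

definition plen :: "nat \<Rightarrow> (nat \<Rightarrow> nat) \<Rightarrow> nat" where
  "plen n w = n - card (cycles {1..n} w)"

lemma card_cycles_merge:
  assumes S: "finite S" and w: "w permutes S" and i: "i \<in> S" and j: "j \<in> S"
    and ij: "j \<notin> orbit w i"
  shows "card (cycles S w) = Suc (card (cycles S (w \<circ> tr i j)))"
proof -
  have p: "permutation w" by (rule permutes_permutation[OF S w])
  note self = permutation_self_in_orbit[OF p]
  have ne: "orbit w i \<noteq> orbit w j" using ij self[of j] by auto
  have "orbit w i \<union> orbit w j \<notin> cycles S w - {orbit w i, orbit w j}"
  proof
    assume "orbit w i \<union> orbit w j \<in> cycles S w - {orbit w i, orbit w j}"
    then have "orbit w i \<union> orbit w j = orbit w i"
      using cycles_eq_orbit[OF p, of "orbit w i \<union> orbit w j" S i] self[of i] by blast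
    then show False using ij self[of j] by blast
  qed
  moreover have "card (cycles S w - {orbit w i, orbit w j}) = card (cycles S w) - 2"
    using ne i j S by (subst card_Diff_subset) (auto simp: orbit_in_cycles finite_cycles)
  moreover have "card {orbit w i, orbit w j} \<le> card (cycles S w)"
    using i j S by (intro card_mono) (auto simp: orbit_in_cycles finite_cycles)
  ultimately show ?thesis
    unfolding cycles_merge[OF assms] using S ne by (simp add: finite_cycles)
qed

lemma card_cycles_le: "finite S \<Longrightarrow> card (cycles S w) \<le> card S"
  unfolding cycles_def by (rule card_image_le)

lemma plen_merge:
  assumes "w permutes {1..n}" "i \<in> {1..n}" "j \<in> {1..n}" "j \<notin> orbit w i"
  shows "plen n (w \<circ> tr i j) = Suc (plen n w)"
  using card_cycles_merge[OF _ assms] card_cycles_le[of "{1..n}" w] by (simp add: plen_def)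

lemma plen_split:
  assumes "w permutes {1..n}" "i \<in> {1..n}" "j \<in> {1..n}" "i \<noteq> j" "j \<in> orbit w i"
  shows "plen n w = Suc (plen n (w \<circ> tr i j))"
proof -
  have "j \<notin> orbit (w \<circ> tr i j) i"
    using split_imp_merge assms permutes_permutation[of "{1..n}" w] by simp
  then show ?thesis
    using plen_merge[OF permutes_comp_tr[OF assms(1-3)] assms(2,3)] by (simp add: comp_assoc)
qed

lemma cycles_id: "cycles S id = (\<lambda>x. {x}) ` S"
proof -
  have "orbit id x = {x}" for x :: 'a by (simp add: orbit_eq_singleton_iff)
  then show ?thesis by (simp add: cycles_def)
qed

lemma plen_id [simp]: "plen n id = 0"
  by (simp add: plen_def cycles_id card_image)

lemma plen_eq_0_iff:
  assumes w: "w permutes {1..n}"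
  shows "plen n w = 0 \<longleftrightarrow> w = id"
proof
  assume "plen n w = 0"
  then have "card (cycles {1..n} w) = card {1..n}"
    using card_cycles_le[of "{1..n}" w] by (simp add: plen_def)
  then have inj: "inj_on (orbit w) {1..n}"
    unfolding cycles_def by (intro eq_card_imp_inj_on) auto
  have "w x = x" if x: "x \<in> {1..n}" for x
  proof (rule inj_onD[OF inj])
    show "orbit w (w x) = orbit w x"
      using permutation_orbit_step[OF permutes_permutation[OF _ w]] by simp
    show "w x \<in> {1..n}" using permutes_in_image[OF w] x by simp
  qed (use x in simp)
  then show "w = id" using permutes_not_in[OF w] by (metis eq_id_iff)
qed simp

lemma sum_card_cycles:
  assumes "finite S" "w permutes S"
  shows "(\<Sum>A\<in>cycles S w. card A) = card S"
proof -
  have "card (\<Union>(cycles S w)) = (\<Sum>A\<in>cycles S w. card A)"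
  proof (rule card_Union_disjoint)
    show "pairwise disjnt (cycles S w)"
      using cycles_disjoint[OF permutes_permutation[OF assms]]
      by (simp add: pairwise_def disjnt_def)
    show "finite A" if "A \<in> cycles S w" for A
      using that cycles_subset[OF assms(2)] assms(1) by (blast intro: finite_subset)
  qed
  then show ?thesis using Union_cycles[OF assms] by simp
qed

section \<open>Words in the transpositions and the distance of the Cayley graph\<close>

definition words :: "nat \<Rightarrow> nat \<Rightarrow> (nat \<Rightarrow> nat) list set" where
  "words n N = {ts. length ts = N \<and> set ts \<subseteq> transpositions n}"

definition wprod :: "('a \<Rightarrow> 'a) list \<Rightarrow> 'a \<Rightarrow> 'a" where
  "wprod ts = foldr (\<circ>) ts id"

lemma wprod_simps [simp]: "wprod [] = id" "wprod (t # ts) = t \<circ> wprod ts"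
  by (simp_all add: wprod_def)

lemma wprod_append: "wprod (ts @ us) = wprod ts \<circ> wprod us"
  by (induction ts) (auto simp: comp_assoc)

lemma wprod_snoc [simp]: "wprod (ts @ [t]) = wprod ts \<circ> t"
  by (simp add: wprod_append)

lemma transpositionsE:
  assumes "t \<in> transpositions n"
  obtains i j where "t = tr i j" "i \<in> {1..n}" "j \<in> {1..n}" "i \<noteq> j"
  using assms by (auto simp: transpositions_def)

lemma tr_in_transpositions: "i \<in> {1..n} \<Longrightarrow> j \<in> {1..n} \<Longrightarrow> i \<noteq> j \<Longrightarrow> tr i j \<in> transpositions n"
  unfolding transpositions_def by (intro CollectI exI conjI) (rule refl)

lemma transpositions_permutes: "t \<in> transpositions n \<Longrightarrow> t permutes {1..n}"
  by (auto simp: transpositions_def intro!: permutes_swap_id)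

lemma transpositions_self_inverse: "t \<in> transpositions n \<Longrightarrow> t \<circ> t = id"
  by (auto simp: transpositions_def)

lemma wprod_permutes: "set ts \<subseteq> transpositions n \<Longrightarrow> wprod ts permutes {1..n}"
proof (induction ts)
  case Nil
  show ?case using permutes_id by (simp del: id_apply)
next
  case (Cons t ts)
  then have "t \<in> transpositions n" "wprod ts permutes {1..n}" by auto
  then have "t \<circ> wprod ts permutes {1..n}" using permutes_compose transpositions_permutes by blast
  then show ?case by (simp del: comp_apply)
qed

lemma wprod_rev:
  assumes "set ts \<subseteq> transpositions n"
  shows "wprod (rev ts) \<circ> wprod ts = id"
  using assms
proof (induction ts)
  case (Cons t ts)
  then have "t \<circ> t = id" using transpositions_self_inverse by auto
  have "wprod (rev (t # ts)) \<circ> wprod (t # ts) = wprod (rev ts) \<circ> (t \<circ> t) \<circ> wprod ts"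
    by (simp add: comp_assoc)
  then show ?case using Cons \<open>t \<circ> t = id\<close> by (simp del: comp_apply id_apply)
qed simp

lemma wprod_rev_inv:
  assumes "set ts \<subseteq> transpositions n"
  shows "wprod (rev ts) = inv (wprod ts)"
proof -
  have "bij (wprod ts)" using wprod_permutes[OF assms] permutes_bij by blast
  then have "wprod ts \<circ> inv (wprod ts) = id" by (simp add: bij_is_surj surj_iff[symmetric])
  then have "wprod (rev ts) = wprod (rev ts) \<circ> wprod ts \<circ> inv (wprod ts)"
    by (simp add: comp_assoc)
  then show ?thesis using wprod_rev[OF assms] by simp
qed

lemma plen_comp_transposition:
  assumes "w permutes {1..n}" "t \<in> transpositions n"
  shows "plen n (w \<circ> t) = Suc (plen n w) \<or> plen n w = Suc (plen n (w \<circ> t))"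
proof -
  obtain i j where t: "t = tr i j" "i \<in> {1..n}" "j \<in> {1..n}" "i \<noteq> j"
    using transpositionsE[OF assms(2)] by blast
  show ?thesis
  proof (cases "j \<in> orbit w i")
    case True
    then show ?thesis using plen_split[OF assms(1) t(2-4)] t(1) by simp
  next
    case False
    then show ?thesis using plen_merge[OF assms(1) t(2,3)] t(1) by simp
  qed
qed

lemma plen_comp_wprod_le:
  assumes "u permutes {1..n}" "set ts \<subseteq> transpositions n"
  shows "plen n (u \<circ> wprod ts) \<le> plen n u + length ts"
  using assms
proof (induction ts arbitrary: u)
  case (Cons t ts)
  have "u \<circ> t permutes {1..n}"
    using Cons.prems by (intro permutes_compose[OF transpositions_permutes]) auto
  from Cons.IH[OF this] Cons.prems
  have "plen n (u \<circ> t \<circ> wprod ts) \<le> plen n (u \<circ> t) + length ts" by (simp del: comp_apply)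
  moreover have "plen n (u \<circ> t) \<le> Suc (plen n u)"
    using plen_comp_transposition[of u n t] Cons.prems by auto
  ultimately show ?case by (simp add: comp_assoc del: comp_apply)
qed (simp del: comp_apply)

lemma plen_wprod_le: "set ts \<subseteq> transpositions n \<Longrightarrow> plen n (wprod ts) \<le> length ts"
  using plen_comp_wprod_le[of id n ts] permutes_id by simp

text \<open>Splitting \<open>i\<close> from \<open>w i\<close> shortens \<open>w\<close>, so a reduced word exists.\<close>

lemma reduced_word_exists:
  assumes "w permutes {1..n}"
  shows "\<exists>ts\<in>words n (plen n w). wprod ts = w"
  using assms
proof (induction "plen n w" arbitrary: w)
  case 0
  then have "w = id" using plen_eq_0_iff by auto
  then show ?case by (auto simp: words_def simp del: id_apply)
next
  case (Suc l)
  then have "w \<noteq> id" by auto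
  then obtain i where i: "w i \<noteq> i" by fastforce
  then have ii: "i \<in> {1..n}" using Suc.prems permutes_not_in by metis
  then have ji: "w i \<in> {1..n}" using permutes_in_image[OF Suc.prems] by simp
  let ?t = "tr i (w i)"
  have "plen n w = Suc (plen n (w \<circ> ?t))"
    using plen_split[OF Suc.prems ii ji] i by (auto intro: orbit.base)
  with Suc(2) have l: "l = plen n (w \<circ> ?t)" by simp
  obtain ts where ts: "ts \<in> words n l" "wprod ts = w \<circ> ?t"
    using Suc(1)[OF l permutes_comp_tr[OF Suc.prems ii ji]] l by auto
  have "?t \<in> transpositions n" using ii ji i by (intro tr_in_transpositions) auto
  moreover have "wprod (ts @ [?t]) = w" using ts by (simp add: comp_assoc)
  ultimately show ?case
    using ts \<open>Suc l = plen n w\<close> by (intro bexI[of _ "ts @ [?t]"]) (auto simp: words_def)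
qed

lemma plen_comp_le:
  assumes "u permutes {1..n}" "v permutes {1..n}"
  shows "plen n (u \<circ> v) \<le> plen n u + plen n v"
proof -
  obtain ts where "ts \<in> words n (plen n v)" "wprod ts = v"
    using reduced_word_exists[OF assms(2)] by blast
  then show ?thesis using plen_comp_wprod_le[OF assms(1), of ts] by (simp add: words_def)
qed

lemma plen_inv:
  assumes "w permutes {1..n}"
  shows "plen n (inv w) = plen n w"
proof -
  have "permutation w" using permutes_permutation[OF _ assms] by simp
  then show ?thesis by (simp add: plen_def cycles_def orbit_inv_eq)
qed

lemma plen_le: "plen n w \<le> n"
  by (simp add: plen_def)

lemma plen_wprod_sandwich:
  assumes "set (ps @ ts @ qs) \<subseteq> transpositions n"
  shows "\<bar>real (plen n (wprod (ps @ ts @ qs))) - real (plen n (wprod ts))\<bar> \<le> real (length ps + length qs)"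
proof -
  have s: "set ps \<subseteq> transpositions n" "set ts \<subseteq> transpositions n" "set qs \<subseteq> transpositions n"
    using assms by auto
  have rs: "set (rev ps) \<subseteq> transpositions n" "set (rev qs) \<subseteq> transpositions n" using s by auto
  have p: "wprod ps permutes {1..n}" "wprod ts permutes {1..n}" "wprod qs permutes {1..n}"
    "wprod (rev ps) permutes {1..n}" "wprod (rev qs) permutes {1..n}"
    "wprod (ts @ qs) permutes {1..n}" "wprod (ps @ ts @ qs) permutes {1..n}"
    using s rs by (intro wprod_permutes; simp)+
  have "plen n (wprod (ps @ ts @ qs)) \<le> plen n (wprod ps) + plen n (wprod (ts @ qs))"
    using plen_comp_le[OF p(1,6)] by (simp add: wprod_append)
  also have "plen n (wprod (ts @ qs)) \<le> plen n (wprod ts) + plen n (wprod qs)"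
    using plen_comp_le[OF p(2,3)] by (simp add: wprod_append)
  finally have up: "plen n (wprod (ps @ ts @ qs)) \<le> length ps + plen n (wprod ts) + length qs"
    using plen_wprod_le[OF s(1)] plen_wprod_le[OF s(3)] by linarith
  have "wprod qs \<circ> wprod (rev qs) = id" using wprod_rev[OF rs(2)] by simp
  then have e1: "wprod (ts @ qs) \<circ> wprod (rev qs) = wprod ts" by (simp add: wprod_append comp_assoc)
  have e2: "wprod (rev ps) \<circ> wprod (ps @ ts @ qs) = wprod (ts @ qs)"
    using wprod_rev[OF s(1)] by (simp add: wprod_append comp_assoc[symmetric])
  have "plen n (wprod ts) \<le> plen n (wprod (ts @ qs)) + plen n (wprod (rev qs))"
    using plen_comp_le[OF p(6,5)] e1 by simp
  moreover have "plen n (wprod (ts @ qs)) \<le> plen n (wprod (rev ps)) + plen n (wprod (ps @ ts @ qs))"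
    using plen_comp_le[OF p(4,7)] e2 by simp
  ultimately have "plen n (wprod ts) \<le> length qs + length ps + plen n (wprod (ps @ ts @ qs))"
    using plen_wprod_le[OF rs(1)] plen_wprod_le[OF rs(2)] by simp
  with up show ?thesis by linarith
qed

primrec wpath :: "('a \<Rightarrow> 'a) \<Rightarrow> ('a \<Rightarrow> 'a) list \<Rightarrow> ('a \<Rightarrow> 'a) list" where
  "wpath x [] = [x]"
| "wpath x (t # ts) = x # wpath (x \<circ> t) ts"

lemma wpath_basic: "wpath x ts \<noteq> []" "hd (wpath x ts) = x" "length (wpath x ts) = Suc (length ts)"
  by (induction ts arbitrary: x) auto

lemma is_path_wpath:
  assumes "x \<in> perms n" "set ts \<subseteq> transpositions n"
  shows "is_path n x (x \<circ> wprod ts) (wpath x ts)"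
  using assms
proof (induction ts arbitrary: x)
  case Nil
  then show ?case by (simp add: is_path_def)
next
  case (Cons t ts)
  have "x \<circ> t \<in> perms n"
    using Cons.prems permutes_compose[OF transpositions_permutes[of t n]] by (simp add: perms_def)
  from Cons.IH[OF this] Cons.prems
  have IH: "is_path n (x \<circ> t) (x \<circ> t \<circ> wprod ts) (wpath (x \<circ> t) ts)"
    by (simp del: comp_apply)
  have "adjacent n x (hd (wpath (x \<circ> t) ts))"
    using Cons.prems \<open>x \<circ> t \<in> perms n\<close> by (auto simp: adjacent_def wpath_basic)
  with IH Cons.prems show ?case
    by (auto simp: is_path_def wpath_basic successively_Cons comp_assoc)
qed

lemma wpath_append_mem: "x \<circ> wprod ts \<in> set (wpath x (ts @ us))"
proof (induction ts arbitrary: x)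
  case Nil
  then show ?case using hd_in_set[OF wpath_basic(1)[of x us]] by (simp add: wpath_basic)
next
  case (Cons t ts)
  then show ?case using Cons[of "x \<circ> t"] by (simp add: comp_assoc del: comp_apply)
qed

lemma is_path_imp_word:
  assumes "is_path n x y \<gamma>"
  shows "\<exists>ts\<in>words n (length \<gamma> - 1). y = x \<circ> wprod ts"
  using assms
proof (induction \<gamma> arbitrary: x)
  case Nil
  then show ?case by (simp add: is_path_def)
next
  case (Cons z \<gamma>)
  show ?case
  proof (cases \<gamma>)
    case Nil
    then show ?thesis using Cons.prems by (auto simp: is_path_def words_def)
  next
    case (Cons z' \<gamma>')
    have p: "is_path n z' y \<gamma>" and adj: "adjacent n x z'"
      using Cons.prems unfolding Cons is_path_def by auto
    obtain t where t: "t \<in> transpositions n" "z' = x \<circ> t" using adj by (auto simp: adjacent_def)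
    obtain ts where ts: "ts \<in> words n (length \<gamma> - 1)" "y = z' \<circ> wprod ts"
      using Cons.IH[OF p] by blast
    show ?thesis using t ts Cons by (intro bexI[of _ "t # ts"]) (auto simp: words_def comp_assoc)
  qed
qed

lemma gdist_le: "is_path n x y \<gamma> \<Longrightarrow> gdist n x y \<le> length \<gamma> - 1"
  unfolding gdist_def by (rule cInf_lower) auto

lemma perms_inv_comp:
  assumes "x \<in> perms n" "y \<in> perms n"
  shows "inv x \<circ> y permutes {1..n}"
  using assms by (auto simp: perms_def intro!: permutes_compose permutes_inv)

lemma perms_comp_inv_comp: "x \<in> perms n \<Longrightarrow> x \<circ> (inv x \<circ> y) = y"
  by (auto simp: perms_def comp_assoc[symmetric] permutes_inv_o)

lemma perms_inv_comp_comp: "x \<in> perms n \<Longrightarrow> inv x \<circ> (x \<circ> y) = y"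
  by (auto simp: perms_def comp_assoc[symmetric] permutes_inv_o)

lemma path_of_word:
  assumes "x \<in> perms n" "y \<in> perms n" "ts \<in> words n N" "wprod ts = inv x \<circ> y"
  shows "is_path n x y (wpath x ts)" "length (wpath x ts) = Suc N"
  using is_path_wpath[OF assms(1), of ts] assms perms_comp_inv_comp[OF assms(1), of y]
  by (auto simp: words_def wpath_basic)

text \<open>A path in the graph is a word, and each letter changes the number of cycles by one; conversely
  a reduced word gives a path of this length.\<close>

lemma gdist_eq_plen:
  assumes "x \<in> perms n" "y \<in> perms n"
  shows "gdist n x y = plen n (inv x \<circ> y)"
proof (rule antisym)
  obtain ts where ts: "ts \<in> words n (plen n (inv x \<circ> y))" "wprod ts = inv x \<circ> y"
    using reduced_word_exists[OF perms_inv_comp[OF assms]] by blast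
  note p = path_of_word[OF assms ts]
  show "gdist n x y \<le> plen n (inv x \<circ> y)"
    using gdist_le[OF p(1)] p(2) by simp
  have ne: "{length \<gamma> - 1 |\<gamma>. is_path n x y \<gamma>} \<noteq> {}" using p(1) by auto
  have "plen n (inv x \<circ> y) \<le> length \<gamma> - 1" if g: "is_path n x y \<gamma>" for \<gamma>
  proof -
    obtain us where us: "us \<in> words n (length \<gamma> - 1)" "y = x \<circ> wprod us"
      using is_path_imp_word[OF g] by blast
    then have "inv x \<circ> y = wprod us" using perms_inv_comp_comp[OF assms(1)] by simp
    then show ?thesis using plen_wprod_le[of us n] us by (auto simp: words_def)
  qed
  then show "plen n (inv x \<circ> y) \<le> gdist n x y"
    unfolding gdist_def by (intro cInf_greatest[OF ne]) auto
qed

lemma id_perms [simp]: "id \<in> perms n"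
  by (simp add: perms_def permutes_id)

lemma gdist_id: "x \<in> perms n \<Longrightarrow> gdist n id x = plen n x"
  by (simp add: gdist_eq_plen)

lemma gdist_sym:
  assumes "x \<in> perms n" "y \<in> perms n"
  shows "gdist n x y = gdist n y x"
proof -
  have b: "bij x" "bij y" using assms permutes_bij by (auto simp: perms_def)
  then have "inv (inv x \<circ> y) = inv y \<circ> x"
    by (simp add: o_inv_distrib bij_imp_bij_inv inv_inv_eq)
  then show ?thesis
    using plen_inv[OF perms_inv_comp[OF assms]] gdist_eq_plen assms by simp
qed

lemma gdist_triangle:
  assumes "x \<in> perms n" "y \<in> perms n" "z \<in> perms n"
  shows "gdist n x z \<le> gdist n x y + gdist n y z"
proof -
  have "inv x \<circ> z = (inv x \<circ> y) \<circ> (inv y \<circ> z)"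
    using perms_comp_inv_comp[OF assms(2), of z] by (simp add: comp_assoc)
  then show ?thesis
    using plen_comp_le[OF perms_inv_comp[OF assms(1,2)] perms_inv_comp[OF assms(2,3)]]
    by (simp add: gdist_eq_plen assms)
qed

lemma gdist_geodesic_split:
  assumes "is_path n x y \<gamma>" "v \<in> set \<gamma>"
  shows "v \<in> perms n" "gdist n x v + gdist n v y \<le> length \<gamma> - 1"
proof -
  show "v \<in> perms n" using assms by (auto simp: is_path_def)
  obtain \<alpha> \<beta> where g: "\<gamma> = \<alpha> @ v # \<beta>" using split_list[OF assms(2)] by blast
  have "is_path n x v (\<alpha> @ [v])" "is_path n v y (v # \<beta>)"
    using assms(1) unfolding g is_path_def
    by (auto simp: successively_append_iff successively_Cons hd_append split: if_splits)
  then have "gdist n x v \<le> length \<alpha>" "gdist n v y \<le> length \<beta>"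
    using gdist_le by fastforce+
  then show "gdist n x v + gdist n v y \<le> length \<gamma> - 1" by (simp add: g)
qed

text \<open>The lower bound holds for every geodesic because each of its vertices \<open>v\<close> satisfies
  \<open>|x - y| = |x - v| + |v - y|\<close>.\<close>

lemma gromov_product_le_dist_to_path:
  assumes x: "x \<in> perms n" and y: "y \<in> perms n" and g: "geodesic n x y \<gamma>"
  shows "gromov_product n id x y \<le> real (dist_to_path n id \<gamma>)"
proof -
  have p: "is_path n x y \<gamma>" and len: "length \<gamma> - 1 = gdist n x y"
    using g by (auto simp: geodesic_def)
  have "set \<gamma> \<noteq> {}" using p by (auto simp: is_path_def)
  then have "dist_to_path n id \<gamma> \<in> gdist n id ` set \<gamma>"
    unfolding dist_to_path_def by (intro Min_in) auto
  then obtain v where v: "v \<in> set \<gamma>" "dist_to_path n id \<gamma> = gdist n id v" by auto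
  note vs = gdist_geodesic_split[OF p v(1)]
  have "gdist n x id \<le> gdist n x v + gdist n v id" "gdist n y id \<le> gdist n v y + gdist n v id"
    using gdist_triangle[of x n v id] gdist_triangle[of y n v id] gdist_sym x y vs(1) by auto
  moreover have "gdist n v id = gdist n id v" using gdist_sym vs(1) by simp
  ultimately show ?thesis
    using vs(2) len v(2) unfolding gromov_product_def by simp
qed

text \<open>Concatenate reduced words for \<open>x^-1 z\<close> and \<open>z^-1 y\<close>.\<close>

lemma geodesic_through:
  assumes x: "x \<in> perms n" and y: "y \<in> perms n" and z: "z \<in> perms n"
    and d: "gdist n x z + gdist n z y \<le> gdist n x y"
  shows "\<exists>\<gamma>. geodesic n x y \<gamma> \<and> dist_to_path n id \<gamma> \<le> gdist n id z"
proof -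
  obtain ts where ts: "ts \<in> words n (plen n (inv x \<circ> z))" "wprod ts = inv x \<circ> z"
    using reduced_word_exists[OF perms_inv_comp[OF x z]] by blast
  obtain us where us: "us \<in> words n (plen n (inv z \<circ> y))" "wprod us = inv z \<circ> y"
    using reduced_word_exists[OF perms_inv_comp[OF z y]] by blast
  have "wprod (ts @ us) = inv x \<circ> y"
    using ts us perms_comp_inv_comp[OF z, of y] by (simp add: wprod_append comp_assoc)
  moreover have "ts @ us \<in> words n (gdist n x z + gdist n z y)"
    using ts us by (simp add: words_def gdist_eq_plen x y z)
  ultimately have p: "is_path n x y (wpath x (ts @ us))"
    "length (wpath x (ts @ us)) = Suc (gdist n x z + gdist n z y)"
    using path_of_word[OF x y] by blast+
  then have "geodesic n x y (wpath x (ts @ us))"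
    using gdist_le[OF p(1)] d by (simp add: geodesic_def)
  moreover have "z \<in> set (wpath x (ts @ us))"
    using wpath_append_mem[of x ts us] ts perms_comp_inv_comp[OF x, of z] by simp
  then have "dist_to_path n id (wpath x (ts @ us)) \<le> gdist n id z"
    unfolding dist_to_path_def by (intro Min_le) auto
  ultimately show ?thesis by blast
qed

section \<open>Lassos in the multigraph of a word\<close>

lemma tr_eq_tr_iff:
  assumes "a \<noteq> b"
  shows "tr a b = tr c d \<longleftrightarrow> {a, b} = {c, d}"
proof
  assume e: "tr a b = tr c d"
  have "tr c d a = b" "tr c d b = a" using e[symmetric] by simp_all
  then show "{a, b} = {c, d}" using assms by (auto simp: transpose_eq_iff)
next
  assume "{a, b} = {c, d}"
  then show "tr a b = tr c d" by (auto simp: doubleton_eq_iff transpose_commute)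
qed

lemma tr_in_transpositions_iff: "tr i j \<in> transpositions n \<longleftrightarrow> i \<in> {1..n} \<and> j \<in> {1..n} \<and> i \<noteq> j"
proof
  assume "tr i j \<in> transpositions n"
  then obtain a b where ab: "tr i j = tr a b" "a \<in> {1..n}" "b \<in> {1..n}" "a \<noteq> b"
    using transpositionsE by blast
  then have "{a, b} = {i, j}" using tr_eq_tr_iff[of a b i j] by simp
  then show "i \<in> {1..n} \<and> j \<in> {1..n} \<and> i \<noteq> j" using ab(2-4) by (auto simp: doubleton_eq_iff)
qed (use tr_in_transpositions in blast)

definition adj :: "(nat \<Rightarrow> nat) list \<Rightarrow> nat \<Rightarrow> nat \<Rightarrow> bool" where
  "adj ts u v \<longleftrightarrow> u \<noteq> v \<and> tr u v \<in> set ts"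

definition simple_path :: "(nat \<Rightarrow> nat) list \<Rightarrow> nat \<Rightarrow> nat \<Rightarrow> nat list \<Rightarrow> nat list \<Rightarrow> bool" where
  "simple_path ts u v vs is \<longleftrightarrow> vs \<noteq> [] \<and> hd vs = u \<and> last vs = v \<and> distinct vs
     \<and> length vs = Suc (length is) \<and> distinct is \<and> set is \<subseteq> {..<length ts}
     \<and> (\<forall>e<length is. ts ! (is ! e) = tr (vs ! e) (vs ! Suc e))"

text \<open>The positions are automatically distinct, since the edges of a path with distinct vertices are
  distinct as two-element sets.\<close>

lemma simple_path_exists:
  assumes "(adj ts)\<^sup>*\<^sup>* u v"
  shows "\<exists>vs is. simple_path ts u v vs is"
proof -
  obtain xs0 where "rtrancl_path (adj ts) u xs0 v"
    using assms rtranclp_eq_rtrancl_path[of "adj ts"] by blast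
  then obtain xs where xs: "rtrancl_path (adj ts) u xs v" "distinct (u # xs)"
    by (rule rtrancl_path_distinct)
  have "\<forall>e<length xs. \<exists>k<length ts. ts ! k = tr ((u # xs) ! e) (xs ! e)"
    using rtrancl_path_nth[OF xs(1)] by (auto simp: adj_def in_set_conv_nth)
  then obtain f where f: "\<And>e. e < length xs \<Longrightarrow> f e < length ts"
    "\<And>e. e < length xs \<Longrightarrow> ts ! f e = tr ((u # xs) ! e) (xs ! e)" by metis
  have "inj_on f {..<length xs}"
  proof (rule inj_onI)
    fix e e' assume e: "e \<in> {..<length xs}" "e' \<in> {..<length xs}" "f e = f e'"
    have ne: "(u # xs) ! e \<noteq> (u # xs) ! Suc e"
      using xs(2) e(1) by (subst nth_eq_iff_index_eq) auto
    have "tr ((u # xs) ! e) ((u # xs) ! Suc e) = tr ((u # xs) ! e') ((u # xs) ! Suc e')"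
      using f(2)[of e] f(2)[of e'] e by simp
    then have "{(u # xs) ! e, (u # xs) ! Suc e} = {(u # xs) ! e', (u # xs) ! Suc e'}"
      using tr_eq_tr_iff[OF ne] by blast
    then have "(e = e' \<and> Suc e = Suc e') \<or> (e = Suc e' \<and> Suc e = e')"
      using nth_eq_iff_index_eq[OF xs(2)] e(1,2) unfolding doubleton_eq_iff
      by (metis (no_types, lifting) Suc_mono lessThan_iff length_Cons less_SucI)
    then show "e = e'" by auto
  qed
  moreover have "last (u # xs) = v"
    using rtrancl_path_last[OF xs(1)] xs(1) by (auto elim: rtrancl_path.cases)
  ultimately have "simple_path ts u v (u # xs) (map f [0..<length xs])"
    unfolding simple_path_def using xs(2) f
    by (auto simp: distinct_map atLeast0LessThan)
  then show ?thesis by blast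
qed

lemma adj_mono: "set ts \<subseteq> set us \<Longrightarrow> adj ts u v \<Longrightarrow> adj us u v"
  by (auto simp: adj_def)

lemma conn_mono: "set ts \<subseteq> set us \<Longrightarrow> (adj ts)\<^sup>*\<^sup>* u v \<Longrightarrow> (adj us)\<^sup>*\<^sup>* u v"
  using rtranclp_mono[of "adj ts" "adj us"] adj_mono by blast

lemma adj_sym: "adj ts u v \<Longrightarrow> adj ts v u"
  by (simp add: adj_def transpose_commute)

lemma conn_sym: "(adj ts)\<^sup>*\<^sup>* u v \<Longrightarrow> (adj ts)\<^sup>*\<^sup>* v u"
  by (induction rule: rtranclp_induct)
    (auto intro: converse_rtranclp_into_rtranclp dest: adj_sym)

lemma conn_wprod:
  assumes "set ts \<subseteq> transpositions n"
  shows "(adj ts)\<^sup>*\<^sup>* x (wprod ts x)"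
  using assms
proof (induction ts)
  case (Cons t ts)
  then have 1: "(adj (t # ts))\<^sup>*\<^sup>* x (wprod ts x)" by (auto intro: conn_mono)
  let ?y = "wprod ts x"
  obtain i j where t: "t = tr i j" "i \<noteq> j"
    using Cons.prems by (auto elim: transpositionsE)
  have "t ?y = ?y \<or> adj (t # ts) ?y (t ?y)"
    using t by (auto simp: adj_def Transposition.transpose_def fun_eq_iff)
  then show ?case using 1 by (auto intro: rtranclp.rtrancl_into_rtrancl)
qed simp

lemma orbit_imp_conn:
  assumes "set ts \<subseteq> transpositions n" "y \<in> orbit (wprod ts) x"
  shows "(adj ts)\<^sup>*\<^sup>* x y"
  using assms(2)
proof induction
  case base
  show ?case by (rule conn_wprod[OF assms(1)])
next
  case (step y)
  then show ?case using conn_wprod[OF assms(1), of y] by simp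
qed

text \<open>Edge \<open>e\<close> of a lasso leads from its vertex \<open>e\<close> to the vertex with this index: the tail ends at
  vertex \<open>p\<close> of the closed walk, and the closed walk returns to its first vertex \<open>l\<close>. For
  \<open>l = 0\<close> there is no tail.\<close>

definition lasso_next :: "nat \<Rightarrow> nat \<Rightarrow> nat \<Rightarrow> nat \<Rightarrow> nat" where
  "lasso_next l p L e = (if Suc e = l then p else if Suc e = L then l else Suc e)"

text \<open>A lasso consists of a tail \<open>ws ! 0, \<dots>, ws ! (l - 1)\<close> that leads to the vertex \<open>ws ! p\<close> of
  the closed walk \<open>ws ! l, \<dots>, ws ! (L - 1), ws ! l\<close>, realised by letters at pairwise distinct
  positions. Two equal letters already form a closed walk of length two. With \<open>L\<close> letters but
  only \<open>L\<close> free vertices, a lasso has one vertex less than a path with as many letters, and this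
  is why only boundedly many are expected.\<close>

definition lassos :: "nat \<Rightarrow> (nat \<Rightarrow> nat) list \<Rightarrow> (nat \<times> nat \<times> nat list \<times> nat list) set" where
  "lassos n ts = {(l, p, ws, is). length is = length ws \<and> l \<le> p \<and> p < length ws
     \<and> set ws \<subseteq> {1..n} \<and> set is \<subseteq> {..<length ts} \<and> distinct is
     \<and> (\<forall>e<length ws. ts ! (is ! e) = tr (ws ! e) (ws ! lasso_next l p (length ws) e))}"

text \<open>Without a tail, \<open>p\<close> marks an arbitrary vertex of the closed walk.\<close>

definition lasso_origin :: "nat \<times> nat \<times> nat list \<times> nat list \<Rightarrow> nat" where
  "lasso_origin = (\<lambda>(l, p, ws, is). if l = 0 then ws ! p else ws ! 0)"

lemma lasso_length_le:
  assumes "(l, p, ws, is) \<in> lassos n ts"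
  shows "length ws \<le> length ts"
proof -
  have "length is = card (set is)" "set is \<subseteq> {..<length ts}"
    using assms by (auto simp: lassos_def distinct_card)
  then have "length is \<le> card {..<length ts}" by (metis card_mono finite_lessThan)
  then show ?thesis using assms by (auto simp: lassos_def)
qed

lemma finite_lassos: "finite (lassos n ts)"
proof (rule finite_subset)
  let ?N = "length ts"
  show "lassos n ts \<subseteq> {..?N} \<times> {..?N} \<times> {xs. set xs \<subseteq> {1..n} \<and> length xs \<le> ?N}
    \<times> {xs. set xs \<subseteq> {..<?N} \<and> length xs \<le> ?N}"
  proof
    fix z assume z: "z \<in> lassos n ts"
    obtain l p ws "is" where zz: "z = (l, p, ws, is)" by (metis surj_pair)
    then have "length ws \<le> ?N" using z lasso_length_le by blast
    then show "z \<in> {..?N} \<times> {..?N} \<times> {xs. set xs \<subseteq> {1..n} \<and> length xs \<le> ?N}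
        \<times> {xs. set xs \<subseteq> {..<?N} \<and> length xs \<le> ?N}"
      using z unfolding zz by (simp add: lassos_def)
  qed
  show "finite ({..?N} \<times> {..?N} \<times> {xs. set xs \<subseteq> {1..n} \<and> length xs \<le> ?N}
    \<times> {xs. set xs \<subseteq> {..<?N} \<and> length xs \<le> ?N})"
    by (intro finite_cartesian_product finite_lists_length_le) auto
qed

text \<open>The stopped words are factors of words of deterministic length, to which the first moment bound
  applies.\<close>

lemma card_lassos_sublist:
  "card (lassos n ts) \<le> card (lassos n (us @ ts @ vs))"
proof (rule card_inj_on_le)
  let ?f = "\<lambda>(l, p, ws, is). (l, p, ws, map (\<lambda>k. length us + k) is)"
  have inj: "inj (\<lambda>k. length us + k)" by simp
  show "inj_on ?f (lassos n ts)"
    by (auto simp: inj_on_def inj_map_eq_map[OF inj])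
  have *: "(us @ ts @ vs) ! (length us + k) = ts ! k" if "k < length ts" for k
    using that by (simp add: nth_append)
  show "?f ` lassos n ts \<subseteq> lassos n (us @ ts @ vs)"
  proof clarify
    fix l p ws "is" assume L: "(l, p, ws, is) \<in> lassos n ts"
    have "ts ! (is ! e) = (us @ ts @ vs) ! (length us + is ! e)" if "e < length ws" for e
    proof -
      have "is ! e \<in> set is" using L that by (auto simp: lassos_def)
      then have "is ! e < length ts" using L by (auto simp: lassos_def)
      then show ?thesis using * by simp
    qed
    then show "(l, p, ws, map (\<lambda>k. length us + k) is) \<in> lassos n (us @ ts @ vs)"
      using L by (auto simp: lassos_def distinct_map)
  qed
  show "finite (lassos n (us @ ts @ vs))" by (rule finite_lassos)
qed

lemma lassos_append: "lassos n ts \<subseteq> lassos n (ts @ us)"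
proof clarify
  fix l p ws "is" assume L: "(l, p, ws, is) \<in> lassos n ts"
  have "ts ! (is ! e) = (ts @ us) ! (is ! e)" if "e < length ws" for e
  proof -
    have "is ! e \<in> set is" using L that by (auto simp: lassos_def)
    then have "is ! e < length ts" using L by (auto simp: lassos_def)
    then show ?thesis by (simp add: nth_append)
  qed
  then show "(l, p, ws, is) \<in> lassos n (ts @ us)"
    using L by (fastforce simp: lassos_def)
qed

definition splits :: "(nat \<Rightarrow> nat) \<Rightarrow> (nat \<Rightarrow> nat) \<Rightarrow> bool" where
  "splits w t \<longleftrightarrow> (\<exists>i j. i \<noteq> j \<and> t = tr i j \<and> j \<in> orbit w i)"

lemma simple_path_in:
  assumes "set ts \<subseteq> transpositions n" "simple_path ts u v vs is" "v \<in> {1..n}"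
  shows "set vs \<subseteq> {1..n}"
proof
  fix x assume "x \<in> set vs"
  then obtain e where e: "e < length vs" "x = vs ! e" by (auto simp: in_set_conv_nth)
  show "x \<in> {1..n}"
  proof (cases "e < length is")
    case True
    then have "is ! e \<in> set is" "set is \<subseteq> {..<length ts}"
      using assms(2) by (simp_all add: simple_path_def)
    then have "is ! e < length ts" by blast
    then have "ts ! (is ! e) \<in> transpositions n" using assms(1) by auto
    then have "tr (vs ! e) (vs ! Suc e) \<in> transpositions n"
      using assms(2) True by (simp add: simple_path_def)
    then show ?thesis using e by (simp only: tr_in_transpositions_iff)
  next
    case False
    then have "e = length is" using e assms(2) by (simp add: simple_path_def)
    moreover have "vs \<noteq> []" "length vs = Suc (length is)" using assms(2) by (simp_all add: simple_path_def)
    ultimately have "x = last vs" using e by (simp add: last_conv_nth)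
    then show ?thesis using assms by (simp add: simple_path_def)
  qed
qed

text \<open>A split at position \<open>k\<close> closes a cycle of the multigraph: the two points exchanged were
  already connected by earlier letters.\<close>

lemma split_imp_cycle:
  assumes ts: "set ts \<subseteq> transpositions n" and k: "k < length ts"
    and sp: "ts ! k = tr i j" "i \<noteq> j" "j \<in> orbit (wprod (take k ts)) i"
  shows "\<exists>cs js. (0, 0, cs, js) \<in> lassos n ts \<and> distinct cs \<and> i \<in> set cs \<and> k \<in> set js"
proof -
  have tk: "set (take k ts) \<subseteq> transpositions n" using ts set_take_subset by fastforce
  have "ts ! k \<in> transpositions n" using ts k by auto
  then have ij: "i \<in> {1..n}" "j \<in> {1..n}" using sp by (simp_all only: tr_in_transpositions_iff)
  have "(adj (take k ts))\<^sup>*\<^sup>* j i"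
    using orbit_imp_conn[OF tk sp(3)] conn_sym by blast
  then obtain vs "is" where p: "simple_path (take k ts) j i vs is"
    using simple_path_exists by blast
  have sub: "set vs \<subseteq> {1..n}" by (rule simple_path_in[OF tk p ij(1)])
  have lt: "is ! e < k" if "e < length is" for e
  proof -
    have "is ! e \<in> set is" "set is \<subseteq> {..<k}" using that p k by (simp_all add: simple_path_def)
    then show ?thesis by blast
  qed
  have "(0, 0, vs, is @ [k]) \<in> lassos n ts"
  proof -
    have "ts ! ((is @ [k]) ! e) = tr (vs ! e) (vs ! lasso_next 0 0 (length vs) e)"
      if e: "e < length vs" for e
    proof (cases "e < length is")
      case True
      then show ?thesis using p lt[OF True] k e
        by (auto simp: simple_path_def nth_append lasso_next_def)
    next
      case False
      then have "e = length is" "length vs = Suc (length is)"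
        using e p by (auto simp: simple_path_def)
      moreover have "vs ! length is = i" "vs ! 0 = j"
        using p by (auto simp: simple_path_def last_conv_nth hd_conv_nth)
      ultimately show ?thesis using sp(1) by (simp add: nth_append lasso_next_def)
    qed
    moreover have "k \<notin> set is" using lt by (auto simp: in_set_conv_nth)
    moreover have "set is \<subseteq> {..<length ts}" using p k by (auto simp: simple_path_def)
    ultimately show ?thesis using p sub k by (auto simp: lassos_def simple_path_def)
  qed
  moreover have "i \<in> set vs" using p last_in_set by (auto simp: simple_path_def)
  ultimately show ?thesis using p by (intro exI[of _ vs] exI[of _ "is @ [k]"]) (auto simp: simple_path_def)
qed

text \<open>Each split creates a lasso through the last letter, so the word is reduced up to twice the
  number of its lassos.\<close>

lemma plen_ge_lassos:
  assumes "set ts \<subseteq> transpositions n"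
  shows "length ts \<le> plen n (wprod ts) + 2 * card (lassos n ts)"
  using assms
proof (induction ts rule: rev_induct)
  case (snoc t ts)
  have ts: "set ts \<subseteq> transpositions n" and t: "t \<in> transpositions n" using snoc.prems by auto
  then have IH: "length ts \<le> plen n (wprod ts) + 2 * card (lassos n ts)" using snoc.IH by blast
  have w: "wprod ts permutes {1..n}" by (rule wprod_permutes[OF ts])
  have mono: "card (lassos n ts) \<le> card (lassos n (ts @ [t]))"
    by (intro card_mono finite_lassos lassos_append)
  obtain i j where ij: "t = tr i j" "i \<in> {1..n}" "j \<in> {1..n}" "i \<noteq> j"
    using transpositionsE[OF t] by blast
  show ?case
  proof (cases "j \<in> orbit (wprod ts) i")
    case False
    then have "plen n (wprod ts \<circ> t) = Suc (plen n (wprod ts))"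
      using plen_merge[OF w ij(2,3)] ij(1) by simp
    then show ?thesis using IH mono by (simp del: comp_apply)
  next
    case True
    then have p: "plen n (wprod ts) = Suc (plen n (wprod ts \<circ> t))"
      using plen_split[OF w ij(2-4)] ij(1) by simp
    obtain cs js where c: "(0, 0, cs, js) \<in> lassos n (ts @ [t])" "length ts \<in> set js"
      using split_imp_cycle[of "ts @ [t]" n "length ts" i j] snoc.prems ij True by auto
    have "(0, 0, cs, js) \<notin> lassos n ts" using c(2) by (auto simp: lassos_def)
    then have "card (lassos n ts) < card (lassos n (ts @ [t]))"
      using c(1) lassos_append[of n ts "[t]"] by (intro psubset_card_mono finite_lassos) blast
    then show ?thesis using IH p by (simp del: comp_apply)
  qed
qed simp

section \<open>Tidy cycles\<close>

definition touches :: "'a set \<Rightarrow> ('a \<Rightarrow> 'a) \<Rightarrow> bool" where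
  "touches A t \<longleftrightarrow> (\<exists>x\<in>A. t x \<noteq> x)"

text \<open>For a cycle \<open>A\<close> of the product this says that the letters meeting \<open>A\<close> are the edges of a
  tree with vertex set \<open>A\<close>: such a cycle has been built by merges alone.\<close>

definition tidy :: "('a \<Rightarrow> 'a) list \<Rightarrow> 'a set \<Rightarrow> bool" where
  "tidy ts A \<longleftrightarrow> (\<forall>t\<in>set ts. touches A t \<longrightarrow> t permutes A)
     \<and> Suc (length (filter (touches A) ts)) = card A"

lemma touches_tr: "i \<noteq> j \<Longrightarrow> touches A (tr i j) \<longleftrightarrow> i \<in> A \<or> j \<in> A"
  by (auto simp: touches_def Transposition.transpose_def)

lemma tr_permutes_iff: "i \<noteq> j \<Longrightarrow> tr i j permutes A \<longleftrightarrow> i \<in> A \<and> j \<in> A"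
  using permutes_not_in[of "tr i j" A i] permutes_not_in[of "tr i j" A j]
  by (auto intro: permutes_swap_id)

lemma tidy_snoc_other: "tidy ts A \<Longrightarrow> \<not> touches A t \<Longrightarrow> tidy (ts @ [t]) A"
  by (auto simp: tidy_def)

text \<open>The letter \<open>tr i j\<close> joins the two trees by an edge.\<close>

lemma tidy_merge:
  assumes A: "tidy ts A" and B: "tidy ts B" and disj: "A \<inter> B = {}"
    and i: "i \<in> A" and j: "j \<in> B" and fin: "finite A" "finite B"
  shows "tidy (ts @ [tr i j]) (A \<union> B)"
proof -
  have ne: "i \<noteq> j" using disj i j by auto
  have tU: "touches (A \<union> B) t \<longleftrightarrow> touches A t \<or> touches B t" for t
    by (auto simp: touches_def)
  have excl: "\<not> (touches A t \<and> touches B t)" if "t \<in> set ts" for t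
    using that A B disj permutes_not_in[of t A] by (fastforce simp: tidy_def touches_def)
  have len: "length (filter (touches (A \<union> B)) us)
      = length (filter (touches A) us) + length (filter (touches B) us)"
    if "set us \<subseteq> set ts" for us
    using that
  proof (induction us)
    case (Cons u us)
    then show ?case using excl[of u] by (auto simp: tU)
  qed simp
  have "t permutes (A \<union> B)" if "t \<in> set ts" "touches (A \<union> B) t" for t
    using that A B by (auto simp: tU tidy_def intro: permutes_subset)
  moreover have "tr i j permutes (A \<union> B)" using i j by (intro permutes_swap_id) auto
  moreover have "touches (A \<union> B) (tr i j)" using touches_tr[OF ne, of "A \<union> B"] i by simp
  ultimately show ?thesis
    using A B len[of ts] fin disj by (auto simp: tidy_def card_Un_disjoint)
qed

text \<open>Along the word, cycles inside \<open>C\<close> start as single points and are only merged.\<close>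

lemma tidy_of_no_split:
  assumes "set ts \<subseteq> transpositions n"
    and "\<And>t. t \<in> set ts \<Longrightarrow> touches C t \<Longrightarrow> t permutes C"
    and "\<And>k. k < length ts \<Longrightarrow> touches C (ts ! k) \<Longrightarrow> \<not> splits (wprod (take k ts)) (ts ! k)"
    and "v \<in> C"
  shows "orbit (wprod ts) v \<subseteq> C \<and> tidy ts (orbit (wprod ts) v)"
  using assms
proof (induction ts arbitrary: v rule: rev_induct)
  case Nil
  have "orbit id v = {v}" by (simp add: orbit_eq_singleton_iff)
  then show ?case using Nil by (simp add: tidy_def del: id_apply)
next
  case (snoc t ts)
  let ?w = "wprod ts"
  have ts: "set ts \<subseteq> transpositions n" and t: "t \<in> transpositions n" using snoc.prems by auto
  have IH: "orbit ?w u \<subseteq> C \<and> tidy ts (orbit ?w u)" if "u \<in> C" for u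
  proof (rule snoc.IH[OF ts _ _ that])
    fix k assume k: "k < length ts" "touches C (ts ! k)"
    then show "\<not> splits (wprod (take k ts)) (ts ! k)"
      using snoc.prems(3)[of k] by (simp add: nth_append)
  qed (use snoc.prems in auto)
  have p: "permutation ?w" using permutes_permutation[OF _ wprod_permutes[OF ts]] by simp
  note self = permutation_self_in_orbit[OF p]
  obtain i j where ij: "t = tr i j" "i \<noteq> j" using transpositionsE[OF t] by blast
  show ?case
  proof (cases "i \<in> orbit ?w v \<or> j \<in> orbit ?w v")
    case False
    then have "orbit (?w \<circ> t) v = orbit ?w v" using orbit_comp_tr_other[OF p] ij by simp
    moreover have "\<not> touches (orbit ?w v) t" using False ij touches_tr[OF ij(2)] by simp
    ultimately show ?thesis
      using IH[OF snoc.prems(4)] tidy_snoc_other[of ts "orbit ?w v" t] by (simp del: comp_apply)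
  next
    case True
    then have "touches C t" using IH[OF snoc.prems(4)] ij touches_tr[OF ij(2)] by auto
    then have "t permutes C" "\<not> splits ?w t"
      using snoc.prems(2)[of t] snoc.prems(3)[of "length ts"] by auto
    then have iC: "i \<in> C" and jC: "j \<in> C" and nj: "j \<notin> orbit ?w i"
      using tr_permutes_iff[OF ij(2)] ij by (auto simp: splits_def)
    have disj: "orbit ?w i \<inter> orbit ?w j = {}"
      using orbit_disjoint_or_eq[OF p, of i j] nj self[of j] by blast
    have O: "orbit (?w \<circ> t) i = orbit ?w i \<union> orbit ?w j"
      using orbit_merge(2)[OF p nj] ij by simp
    have v: "v \<in> orbit (?w \<circ> t) i"
      using True O orbit_eq_of_mem[OF p] self[of v] by blast
    have "permutation (?w \<circ> t)" using permutation_comp_tr[OF p] ij by simp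
    then have O': "orbit (?w \<circ> t) v = orbit ?w i \<union> orbit ?w j"
      using orbit_eq_of_mem v O by metis
    have "tidy (ts @ [tr i j]) (orbit ?w i \<union> orbit ?w j)"
      using IH[OF iC] IH[OF jC] disj self finite_orbit[OF self] by (intro tidy_merge) auto
    then show ?thesis using O' IH[OF iC] IH[OF jC] ij by (simp del: comp_apply)
  qed
qed

definition untidy_vertices :: "nat \<Rightarrow> (nat \<Rightarrow> nat) list \<Rightarrow> nat set" where
  "untidy_vertices n ts = {v \<in> {1..n}. \<not> tidy ts (orbit (wprod ts) v)}"

text \<open>If no split happens in the component of \<open>v\<close>, then the cycle of \<open>v\<close> is tidy. Otherwise follow
  a simple path from \<open>v\<close> towards the closed walk created by the split, up to the first vertex that
  lies on this closed walk.\<close>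

lemma untidy_vertices_subset_lasso_origin:
  assumes ts: "set ts \<subseteq> transpositions n"
  shows "untidy_vertices n ts \<subseteq> lasso_origin ` lassos n ts"
proof
  fix v assume "v \<in> untidy_vertices n ts"
  then have v: "v \<in> {1..n}" and nt: "\<not> tidy ts (orbit (wprod ts) v)" by (auto simp: untidy_vertices_def)
  define C where "C = {u. (adj ts)\<^sup>*\<^sup>* v u}"
  have cl: "t permutes C" if t: "t \<in> set ts" "touches C t" for t
  proof -
    obtain i j where ij: "t = tr i j" "i \<noteq> j" using ts t(1) transpositionsE[of t n] by blast
    then have "adj ts i j" "adj ts j i" using t(1) by (auto simp: adj_def transpose_commute)
    moreover have "i \<in> C \<or> j \<in> C" using t(2) ij touches_tr by simp
    ultimately have "i \<in> C \<and> j \<in> C"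
      unfolding C_def by (auto intro: rtranclp.rtrancl_into_rtrancl)
    then show ?thesis using tr_permutes_iff[OF ij(2)] ij(1) by simp
  qed
  have "v \<in> C" by (simp add: C_def)
  then obtain k where k: "k < length ts" "touches C (ts ! k)" "splits (wprod (take k ts)) (ts ! k)"
    using tidy_of_no_split[of ts n C v, OF ts cl] nt by blast
  then obtain i j where ij: "i \<noteq> j" "ts ! k = tr i j" "j \<in> orbit (wprod (take k ts)) i"
    by (auto simp: splits_def)
  have "ts ! k permutes C" using cl[OF _ k(2)] k(1) by simp
  then have "i \<in> C" using ij tr_permutes_iff by simp
  obtain cs js where c: "(0, 0, cs, js) \<in> lassos n ts" "distinct cs" "i \<in> set cs"
    using split_imp_cycle[OF ts k(1) ij(2,1,3)] by blast
  have "ts ! k \<in> transpositions n" using ts k(1) by auto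
  then have iin: "i \<in> {1..n}" using ij by (simp only: tr_in_transpositions_iff)
  obtain us "is" where p: "simple_path ts v i us is"
    using simple_path_exists \<open>i \<in> C\<close> unfolding C_def by blast
  have sub: "set us \<subseteq> {1..n}" by (rule simple_path_in[OF ts p iin])
  have lenus: "length us = Suc (length is)" using p by (simp add: simple_path_def)
  have "us ! length is = i" using p lenus by (auto simp: simple_path_def last_conv_nth)
  \<comment> \<open>before the first vertex on the closed walk, no edge of the path can belong to the closed walk\<close>
  define l where "l = (LEAST l. us ! l \<in> set cs)"
  have l: "us ! l \<in> set cs" "l \<le> length is"
    unfolding l_def using LeastI[of "\<lambda>l. us ! l \<in> set cs" "length is"]
      Least_le[of "\<lambda>l. us ! l \<in> set cs" "length is"] \<open>us ! length is = i\<close> c(3) by auto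
  have lmin: "us ! e \<notin> set cs" if "e < l" for e
    using that not_less_Least unfolding l_def by blast
  obtain b where b: "b < length cs" "cs ! b = us ! l" using l(1) by (auto simp: in_set_conv_nth)
  define ws where "ws = take l us @ cs"
  define ks where "ks = take l is @ js"
  have lenc: "length js = length cs" using c(1) by (auto simp: lassos_def)
  have lenw: "length ws = l + length cs" "length ks = l + length cs"
    using l lenus lenc by (auto simp: ws_def ks_def)
  have cyc: "ts ! (js ! e) = tr (cs ! e) (cs ! (if Suc e = length cs then 0 else Suc e))"
    if "e < length cs" for e
    using c(1) that by (auto simp: lassos_def lasso_next_def)
  have step: "ts ! (ks ! e) = tr (ws ! e) (ws ! lasso_next l (l + b) (length ws) e)"
    if e: "e < length ws" for e
  proof (cases "e < l")
    case True
    have 1: "ts ! (is ! e) = tr (us ! e) (us ! Suc e)"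
      using p True l(2) by (simp add: simple_path_def)
    show ?thesis
    proof (cases "Suc e = l")
      case True
      then show ?thesis using 1 b l lenus by (auto simp: ks_def ws_def lasso_next_def nth_append)
    next
      case False
      then have "Suc e < l" using True by simp
      then show ?thesis using 1 l lenus b(1) lenw
        by (auto simp: ks_def ws_def lasso_next_def nth_append)
    qed
  next
    case False
    then obtain e' where e': "e = l + e'" using le_Suc_ex not_less by blast
    then have "e' < length cs" using e lenw by simp
    moreover have "l \<le> length is" "length (take l us) = l" "length (take l is) = l"
      using l lenus by auto
    ultimately show ?thesis using cyc[of e'] e' lenw
      by (auto simp: ks_def ws_def lasso_next_def nth_append)
  qed
  have "distinct ks"
  proof -
    have "set (take l is) \<inter> set js = {}"
    proof (rule ccontr)
      assume "set (take l is) \<inter> set js \<noteq> {}"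
      then obtain e e' where e: "e < l" "e < length is" "e' < length cs" "is ! e = js ! e'"
        using lenc by (auto simp: in_set_conv_nth)
      have path_step: "ts ! (is ! e) = tr (us ! e) (us ! Suc e)" if "e < length is" for e
        using p that by (simp add: simple_path_def)
      have "tr (us ! e) (us ! Suc e) = tr (cs ! e') (cs ! (if Suc e' = length cs then 0 else Suc e'))"
        using cyc[OF e(3)] e(4) path_step[OF e(2)] by metis
      moreover have "us ! e \<noteq> us ! Suc e"
        using p e(2) lenus by (subst nth_eq_iff_index_eq) (auto simp: simple_path_def)
      ultimately have "{us ! e, us ! Suc e}
          = {cs ! e', cs ! (if Suc e' = length cs then 0 else Suc e')}"
        using tr_eq_tr_iff by blast
      moreover have "cs ! 0 \<in> set cs" using e(3) by (intro nth_mem) linarith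
      ultimately have "us ! e \<in> set cs"
        using e(3) nth_mem[of e' cs] nth_mem[of "Suc e'" cs]
        by (auto simp: doubleton_eq_iff split: if_splits)
      then show False using lmin[OF e(1)] by simp
    qed
    then show ?thesis
      using p c(1) by (auto simp: ks_def simple_path_def lassos_def)
  qed
  moreover have "set ws \<subseteq> {1..n}" using sub c(1) set_take_subset[of l us] by (auto simp: ws_def lassos_def)
  moreover have "set ks \<subseteq> {..<length ts}"
    using p c(1) set_take_subset[of l "is"] by (auto simp: ks_def simple_path_def lassos_def)
  ultimately have L: "(l, l + b, ws, ks) \<in> lassos n ts"
    using step lenw b(1) by (simp add: lassos_def)
  have "us ! 0 = v" using p by (auto simp: simple_path_def hd_conv_nth)
  then have "lasso_origin (l, l + b, ws, ks) = v"
    using b l lenus by (auto simp: lasso_origin_def ws_def nth_append)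
  then show "v \<in> lasso_origin ` lassos n ts" using L by force
qed

lemma card_untidy_vertices_le:
  assumes "set ts \<subseteq> transpositions n"
  shows "card (untidy_vertices n ts) \<le> card (lassos n ts)"
  using card_mono[OF _ untidy_vertices_subset_lasso_origin[OF assms]] card_image_le[OF finite_lassos]
    finite_lassos by (meson finite_imageI le_trans)

section \<open>A geodesic that passes near the identity\<close>

lemma wprod_permutes_of_letters: "(\<And>t. t \<in> set ts \<Longrightarrow> t permutes S) \<Longrightarrow> wprod ts permutes S"
proof (induction ts)
  case Nil
  show ?case using permutes_id by (simp del: id_apply)
next
  case (Cons t ts)
  then have "t permutes S" "wprod ts permutes S" by auto
  then have "t \<circ> wprod ts permutes S" using permutes_compose by blast
  then show ?case by (simp del: comp_apply)
qed

lemma permutes_disjoint_commute: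
  assumes "f permutes A" "g permutes B" "A \<inter> B = {}"
  shows "f \<circ> g = g \<circ> f"
proof
  fix x
  consider "x \<in> A" | "x \<in> B" | "x \<notin> A" "x \<notin> B" by blast
  then show "(f \<circ> g) x = (g \<circ> f) x"
  proof cases
    case 1
    then have "x \<notin> B" "f x \<notin> B" using assms permutes_in_image[OF assms(1)] by blast+
    then show ?thesis using permutes_not_in[OF assms(2)] by simp
  next
    case 2
    then have "x \<notin> A" "g x \<notin> A" using assms permutes_in_image[OF assms(2)] by blast+
    then show ?thesis using permutes_not_in[OF assms(1)] by simp
  qed (use permutes_not_in[OF assms(1)] permutes_not_in[OF assms(2)] in simp)
qed

text \<open>The letters on \<open>A\<close> commute with those on \<open>B\<close>.\<close>

lemma wprod_filter_split:
  assumes "\<And>t. t \<in> set ts \<Longrightarrow> P t \<Longrightarrow> t permutes A"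
    and "\<And>t. t \<in> set ts \<Longrightarrow> \<not> P t \<Longrightarrow> t permutes B" and "A \<inter> B = {}"
  shows "wprod ts = wprod (filter P ts) \<circ> wprod (filter (\<lambda>t. \<not> P t) ts)"
  using assms(1,2)
proof (induction ts)
  case (Cons t ts)
  let ?a = "wprod (filter P ts)" and ?b = "wprod (filter (\<lambda>t. \<not> P t) ts)"
  have IH: "wprod ts = ?a \<circ> ?b" using Cons by auto
  have "wprod (t # ts) = t \<circ> (?a \<circ> ?b)" using IH by simp
  also have "\<dots> = wprod (filter P (t # ts)) \<circ> wprod (filter (\<lambda>t. \<not> P t) (t # ts))"
  proof (cases "P t")
    case True
    then show ?thesis by (simp add: comp_assoc)
  next
    case False
    have "?a permutes A" using Cons.prems(1) by (intro wprod_permutes_of_letters) auto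
    moreover have "t permutes B" using Cons.prems(2)[of t] False by simp
    ultimately have "t \<circ> ?a = ?a \<circ> t"
      using permutes_disjoint_commute[of t B ?a A] assms(3) by (simp add: Int_commute)
    then have "t \<circ> (?a \<circ> ?b) = ?a \<circ> (t \<circ> ?b)" by (metis comp_assoc)
    then show ?thesis using False by simp
  qed
  finally show ?case .
qed simp

lemma cycles_Un: "cycles (A \<union> B) w = cycles A w \<union> cycles B w"
  by (simp add: cycles_def image_Un)

lemma card_cycles_Un:
  assumes "w permutes A \<union> B" "w ` A \<subseteq> A" "w ` B \<subseteq> B" "A \<inter> B = {}" "finite A" "finite B"
  shows "card (cycles (A \<union> B) w) = card (cycles A w) + card (cycles B w)"
proof -
  have oA: "orbit w x \<subseteq> A" if "x \<in> A" for x
    using that assms(2) by (intro orbit_subset_closed) auto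
  have oB: "orbit w x \<subseteq> B" if "x \<in> B" for x
    using that assms(3) by (intro orbit_subset_closed) auto
  have "C \<subseteq> A" if "C \<in> cycles A w" for C
    using that oA by (auto simp: cycles_def)
  moreover have "C \<subseteq> B" if "C \<in> cycles B w" for C
    using that oB by (auto simp: cycles_def)
  ultimately have "cycles A w \<inter> cycles B w = {}"
    using assms(4) cycles_nonempty by (metis Int_emptyI le_inf_iff subset_empty)
  then show ?thesis
    using assms(5,6) by (simp add: cycles_Un card_Un_disjoint finite_cycles)
qed

lemma plen_permutes_subset:
  assumes f: "f permutes B" and B: "B \<subseteq> {1..n}"
  shows "plen n f = card B - card (cycles B f)"
proof -
  let ?T = "{1..n} - B"
  have fin: "finite B" using B finite_subset by blast
  have T: "cycles ?T f = (\<lambda>x. {x}) ` ?T"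
    unfolding cycles_def using permutes_not_in[OF f]
    by (intro image_cong refl) (auto simp: orbit_eq_singleton_iff)
  have eq: "?T \<union> B = {1..n}" using B by blast
  have "f permutes ?T \<union> B" using f by (rule permutes_subset) blast
  then have "card (cycles {1..n} f) = card (cycles ?T f) + card (cycles B f)"
    using card_cycles_Un[of f ?T B] permutes_not_in[OF f] permutes_in_image[OF f] fin eq by fastforce
  moreover have "card (cycles ?T f) = n - card B"
    unfolding T using B fin by (simp add: card_image card_Diff_subset)
  moreover have "card B \<le> n" using card_mono[OF _ B] by simp
  ultimately show ?thesis by (simp add: plen_def)
qed

lemma sum_length_filter_touches:
  assumes "finite \<C>" "\<And>t. t \<in> set ts \<Longrightarrow> touches T t \<Longrightarrow> \<exists>!A. A \<in> \<C> \<and> touches A t"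
    and "\<And>A. A \<in> \<C> \<Longrightarrow> A \<subseteq> T"
  shows "(\<Sum>A\<in>\<C>. length (filter (touches A) ts)) = length (filter (touches T) ts)"
  using assms(2)
proof (induction ts)
  case (Cons t ts)
  have "(\<Sum>A\<in>\<C>. length (filter (touches A) (t # ts)))
      = (\<Sum>A\<in>\<C>. (if touches A t then 1 else 0) + length (filter (touches A) ts))"
    by (intro sum.cong) auto
  also have "\<dots> = (\<Sum>A\<in>\<C>. if touches A t then 1 else 0) + length (filter (touches T) ts)"
    using Cons by (simp add: sum.distrib)
  also have "(\<Sum>A\<in>\<C>. if touches A t then 1 else 0) = (if touches T t then 1 else (0::nat))"
  proof (cases "touches T t")
    case True
    have "\<exists>!A. A \<in> \<C> \<and> touches A t" using Cons.prems[of t] True by simp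
    then obtain A where A: "A \<in> \<C>" "touches A t" "\<And>A'. A' \<in> \<C> \<Longrightarrow> touches A' t \<Longrightarrow> A' = A"
      by (elim ex1E) blast
    have "touches A' t \<longleftrightarrow> A' = A" if "A' \<in> \<C>" for A' using A(2) A(3)[OF that] by blast
    then have "(\<Sum>A\<in>\<C>. if touches A t then 1 else (0::nat)) = (\<Sum>A'\<in>\<C>. if A' = A then 1 else 0)"
      by (intro sum.cong refl) (simp only:)
    then show ?thesis using A(1) assms(1) True by simp
  next
    case False
    then have "\<not> touches A t" if "A \<in> \<C>" for A
      using that assms(3) unfolding touches_def by blast
    then show ?thesis using False by simp
  qed
  finally show ?case by simp
qed simp

text \<open>On the union \<open>T\<close> of the tidy cycles of \<open>x^-1 y\<close> the word for \<open>x^-1 y\<close> is already reduced,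
  so cancelling the \<open>T\<close>-part of \<open>x\<close> and then building the \<open>T\<close>-part of \<open>y\<close> loses nothing. The
  geodesic thus passes through the part of \<open>x\<close> that lives on the complement of \<open>T\<close>, and this
  part has length at most the size of the complement.\<close>

lemma geodesic_near_id:
  assumes X: "set X \<subseteq> transpositions n" and Y: "set Y \<subseteq> transpositions n"
  shows "\<exists>\<gamma>. geodesic n (wprod X) (wprod Y) \<gamma> \<and> dist_to_path n id \<gamma> \<le> card (untidy_vertices n (rev X @ Y))"
proof -
  define W where "W = rev X @ Y"
  define w where "w = wprod W"
  define B where "B = untidy_vertices n W"
  define T where "T = {1..n} - B"
  have W: "set W \<subseteq> transpositions n" using X Y by (simp add: W_def)
  have wp: "w permutes {1..n}" unfolding w_def by (rule wprod_permutes[OF W])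
  have pw: "permutation w" using permutes_permutation[OF _ wp] by simp
  note self = permutation_self_in_orbit[OF pw]
  have fin: "finite T" "finite B" by (auto simp: T_def B_def untidy_vertices_def)
  have TB: "T \<union> B = {1..n}" "T \<inter> B = {}" by (auto simp: T_def B_def untidy_vertices_def)
  have tidyT: "tidy W (orbit w x)" "orbit w x \<subseteq> T" if "x \<in> T" for x
  proof -
    show 1: "tidy W (orbit w x)" using that by (auto simp: T_def B_def untidy_vertices_def w_def)
    have "orbit w x \<subseteq> {1..n}" using permutes_orbit_subset[OF wp] that by (auto simp: T_def)
    moreover have "orbit w y = orbit w x" if "y \<in> orbit w x" for y
      using orbit_eq_of_mem[OF pw that] .
    ultimately show "orbit w x \<subseteq> T" using 1 by (auto simp: T_def B_def untidy_vertices_def w_def)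
  qed
  have same: "j \<in> orbit w i" if t: "tr i j \<in> set W" and i: "i \<in> T" for i j
  proof -
    have ne: "i \<noteq> j" using t W tr_in_transpositions_iff[of i j n] by blast
    then have "touches (orbit w i) (tr i j)" using touches_tr self by simp
    then have "tr i j permutes orbit w i" using tidyT(1)[OF i] t by (auto simp: tidy_def)
    then show ?thesis using tr_permutes_iff[OF ne] by simp
  qed
  have letterT: "t permutes T" if t: "t \<in> set W" "touches T t" for t
  proof -
    obtain i j where ij: "t = tr i j" "i \<noteq> j" using W t(1) transpositionsE[of t n] by blast
    then have "i \<in> T \<or> j \<in> T" using t(2) touches_tr by simp
    then have "i \<in> T \<and> j \<in> T"
      using same[of i j] same[of j i] t(1) ij tidyT(2) by (auto simp: transpose_commute)
    then show ?thesis using tr_permutes_iff[OF ij(2)] ij(1) by simp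
  qed
  have letterB: "t permutes B" if t: "t \<in> set W" "\<not> touches T t" for t
  proof -
    obtain i j where ij: "t = tr i j" "i \<noteq> j" "i \<in> {1..n}" "j \<in> {1..n}"
      using W t(1) transpositionsE[of t n] by blast
    then have "i \<notin> T" "j \<notin> T" using t(2) touches_tr by auto
    then have "i \<in> B" "j \<in> B" using TB ij by auto
    then show ?thesis using tr_permutes_iff[OF ij(2)] ij(1) by simp
  qed
  let ?P = "touches T"
  define fT where "fT = (\<lambda>ts. wprod (filter ?P ts))"
  define fB where "fB = (\<lambda>ts. wprod (filter (\<lambda>t. \<not> ?P t) ts))"
  have fTp: "fT ts permutes T" and fBp: "fB ts permutes B" and split: "wprod ts = fT ts \<circ> fB ts"
    and comm: "fT ts \<circ> fB us = fB us \<circ> fT ts"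
    if ts: "set ts \<subseteq> set W" and us: "set us \<subseteq> set W" for ts us
  proof -
    show 1: "fT ts permutes T"
      unfolding fT_def using ts letterT by (intro wprod_permutes_of_letters) auto
    have 2: "fB us permutes B" if "set us \<subseteq> set W" for us
      unfolding fB_def using that letterB by (intro wprod_permutes_of_letters) auto
    show "fB ts permutes B" using 2[OF ts] .
    show "wprod ts = fT ts \<circ> fB ts"
      unfolding fT_def fB_def using ts letterT letterB TB(2)
      by (intro wprod_filter_split[where A = T and B = B]) auto
    show "fT ts \<circ> fB us = fB us \<circ> fT ts"
      using permutes_disjoint_commute[OF 1 2[OF us] TB(2)] .
  qed
  have sub: "set X \<subseteq> set W" "set Y \<subseteq> set W" by (auto simp: W_def)
  let ?x = "wprod X" and ?y = "wprod Y"
  define z where "z = fB X"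
  have xy: "?x \<in> perms n" "?y \<in> perms n"
    using wprod_permutes X Y by (auto simp: perms_def)
  have subB: "B \<subseteq> {1..n}" and subT: "T \<subseteq> {1..n}" using TB by auto
  have zp: "z permutes B" unfolding z_def by (rule fBp[OF sub(1) sub(1)])
  have z: "z \<in> perms n" using permutes_subset[OF zp subB] by (simp add: perms_def)
  have invx: "inv ?x \<circ> ?y = w"
    using wprod_rev_inv[OF X] by (simp add: w_def W_def wprod_append)
  have fT_le: "plen n (fT ts) \<le> length (filter ?P ts)" if "set ts \<subseteq> set W" for ts
    unfolding fT_def using that W by (intro plen_wprod_le) auto
  have bT: "bij (fT X)" and bB: "bij z"
    using fTp[OF sub(1) sub(1)] zp permutes_bij by blast+
  \<comment> \<open>\<open>x\<close> and \<open>z\<close> differ only by letters inside \<open>T\<close>\<close>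
  have "?x = z \<circ> fT X" using split[OF sub(1) sub(1)] comm[OF sub(1) sub(1)] by (simp add: z_def)
  then have "inv ?x \<circ> z = inv (fT X) \<circ> (inv z \<circ> z)"
    using bT bB by (simp add: o_inv_distrib comp_assoc)
  also have "\<dots> = inv (fT X)" using bB by (simp add: bij_is_inj)
  finally have "gdist n ?x z = plen n (fT X)"
    using gdist_eq_plen[OF xy(1) z] plen_inv permutes_subset[OF fTp[OF sub(1) sub(1)] subT] by simp
  then have d1: "gdist n ?x z \<le> length (filter ?P X)" using fT_le[OF sub(1)] by simp
  \<comment> \<open>the letters of \<open>x\<close> and \<open>y\<close> outside \<open>T\<close> combine to the part of \<open>x^-1 y\<close> outside \<open>T\<close>\<close>
  have BX: "set (filter (\<lambda>t. \<not> ?P t) X) \<subseteq> transpositions n" using X by auto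
  have "inv z = wprod (rev (filter (\<lambda>t. \<not> ?P t) X))"
    using wprod_rev_inv[OF BX] by (simp add: z_def fB_def)
  then have wB: "inv z \<circ> fB Y = fB W"
    by (simp add: fB_def W_def wprod_append rev_filter)
  have "?y = fB Y \<circ> fT Y" using split[OF sub(2) sub(2)] comm[OF sub(2) sub(2)] by simp
  then have "inv z \<circ> ?y = fB W \<circ> fT Y" using wB by (simp add: comp_assoc[symmetric])
  then have "gdist n z ?y \<le> plen n (fB W) + plen n (fT Y)"
    using gdist_eq_plen[OF z xy(2)] plen_comp_le
      permutes_subset[OF fBp[of W W] subB] permutes_subset[OF fTp[OF sub(2) sub(2)] subT] by simp
  then have d2: "gdist n z ?y \<le> plen n (fB W) + length (filter ?P Y)"
    using fT_le[OF sub(2)] by simp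
  \<comment> \<open>a tidy cycle of size \<open>k\<close> has length \<open>k - 1\<close>, the number of its letters, so that the length of
    \<open>x^-1 y\<close> inside \<open>T\<close> is the number of letters inside \<open>T\<close>\<close>
  have cl: "w ` T \<subseteq> T" "w ` B \<subseteq> B"
  proof -
    show "w ` T \<subseteq> T" using tidyT(2) orbit.base[of w] by blast
    have "w x \<in> B" if x: "x \<in> B" for x
    proof (rule ccontr)
      assume n: "w x \<notin> B"
      have "w x \<in> {1..n}" using x subB permutes_in_image[OF wp] by blast
      then have "w x \<in> T" using n TB by blast
      moreover have "orbit w (w x) = orbit w x" by (rule permutation_orbit_step[OF pw])
      ultimately have "x \<in> T" using tidyT(2)[of "w x"] self[of x] by auto
      then show False using x TB by blast
    qed
    then show "w ` B \<subseteq> B" by blast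
  qed
  have onB: "w x = fB W x" if "x \<in> B" for x
  proof -
    have "fB W x \<notin> T" using permutes_in_image[OF fBp[of W W]] that TB(2) by blast
    then show ?thesis
      using split[of W W] permutes_not_in[OF fTp[of W W]] by (simp add: w_def)
  qed
  have "orbit w x = orbit (fB W) x" if "x \<in> B" for x
    using that cl(2) onB by (intro orbit_cong0[where A = B]) auto
  then have "cycles B w = cycles B (fB W)" by (simp add: cycles_def)
  then have pB: "plen n (fB W) = card B - card (cycles B w)"
    using plen_permutes_subset[OF fBp[of W W] subB] by simp
  have "card T = card (cycles T w) + length (filter ?P W)"
  proof -
    have uni: "\<Union>(cycles T w) = T" using tidyT(2) self by (auto simp: cycles_def)
    have disj: "A = A'" if "A \<in> cycles T w" "A' \<in> cycles T w" "A \<inter> A' \<noteq> {}" for A A'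
      using cycles_disjoint[OF pw that(1,2)] that(3) by blast
    have "card (\<Union>(cycles T w)) = (\<Sum>A\<in>cycles T w. card A)"
    proof (rule card_Union_disjoint)
      show "pairwise disjnt (cycles T w)" using disj by (auto simp: pairwise_def disjnt_def)
      show "finite A" if "A \<in> cycles T w" for A
        using that uni by (intro finite_subset[OF _ fin(1)]) blast
    qed
    then have "card T = (\<Sum>A\<in>cycles T w. card A)" using uni by simp
    also have "\<dots> = (\<Sum>A\<in>cycles T w. 1 + length (filter (touches A) W))"
      using tidyT(1) by (intro sum.cong) (auto simp: cycles_def tidy_def)
    also have "\<dots> = card (cycles T w) + (\<Sum>A\<in>cycles T w. length (filter (touches A) W))"
      by (simp only: sum.distrib) simp
    also have "(\<Sum>A\<in>cycles T w. length (filter (touches A) W)) = length (filter ?P W)"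
    proof (rule sum_length_filter_touches)
      show "finite (cycles T w)" by (rule finite_cycles[OF fin(1)])
      show "A \<subseteq> T" if "A \<in> cycles T w" for A using that uni by blast
      fix t assume t: "t \<in> set W" "touches T t"
      then obtain x where x: "x \<in> T" "t x \<noteq> x" by (auto simp: touches_def)
      show "\<exists>!A. A \<in> cycles T w \<and> touches A t"
      proof (rule ex1I[of _ "orbit w x"])
        show "orbit w x \<in> cycles T w \<and> touches (orbit w x) t"
          using x self by (auto simp: cycles_def touches_def)
        fix A assume A: "A \<in> cycles T w \<and> touches A t"
        then obtain u where u: "u \<in> T" "A = orbit w u" by (auto simp: cycles_def)
        then have "t permutes A" using tidyT(1)[of u] A t(1) by (auto simp: tidy_def)
        then have "x \<in> A" using x(2) permutes_not_in by metis
        then show "A = orbit w x" using u orbit_eq_of_mem[OF pw] by auto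
      qed
    qed
    finally show ?thesis .
  qed
  moreover have "card (cycles {1..n} w) = card (cycles T w) + card (cycles B w)"
    using card_cycles_Un[of w T B] wp cl TB fin by simp
  moreover have "card T + card B = n" using card_Un_disjoint[OF fin TB(2)] TB(1) by simp
  moreover have "card (cycles B w) \<le> card B" by (rule card_cycles_le[OF fin(2)])
  ultimately have "plen n w = length (filter ?P W) + plen n (fB W)"
    unfolding pB plen_def[of n w] by simp
  moreover have "gdist n ?x ?y = plen n w" using gdist_eq_plen[OF xy] invx by simp
  moreover have "length (filter ?P W) = length (filter ?P X) + length (filter ?P Y)"
    by (simp add: W_def rev_filter[symmetric])
  ultimately have "gdist n ?x z + gdist n z ?y \<le> gdist n ?x ?y" using d1 d2 by simp
  moreover have "gdist n id z \<le> card B"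
    using gdist_id[OF z] plen_permutes_subset[OF zp subB] by simp
  ultimately show ?thesis
    using geodesic_through[OF xy z] unfolding B_def W_def by fastforce
qed

section \<open>Averages over words\<close>

definition trs :: "nat set \<Rightarrow> (nat \<Rightarrow> nat) set" where
  "trs S = {tr i j | i j. i \<in> S \<and> j \<in> S \<and> i \<noteq> j}"

lemma transpositions_eq_trs: "transpositions n = trs {1..n}"
  by (simp add: transpositions_def trs_def)

lemma card_trs:
  assumes "finite S"
  shows "card (trs S) = card S choose 2" "finite (trs S)"
proof -
  have supp: "{x. tr i j x \<noteq> x} = {i, j}" if "i \<noteq> j" for i j :: nat
    using that by (auto simp: Transposition.transpose_def)
  have bij: "bij_betw (\<lambda>t. {x. t x \<noteq> x}) (trs S) {A. A \<subseteq> S \<and> card A = 2}"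
    unfolding bij_betw_def
  proof
    show "inj_on (\<lambda>t. {x. t x \<noteq> x}) (trs S)"
      by (rule inj_onI) (auto simp: trs_def supp tr_eq_tr_iff)
    show "(\<lambda>t. {x. t x \<noteq> x}) ` trs S = {A. A \<subseteq> S \<and> card A = 2}"
    proof (intro equalityI subsetI)
      fix A assume "A \<in> (\<lambda>t. {x. t x \<noteq> x}) ` trs S"
      then obtain i j where "A = {x. tr i j x \<noteq> x}" "i \<in> S" "j \<in> S" "i \<noteq> j"
        unfolding trs_def by blast
      then show "A \<in> {A. A \<subseteq> S \<and> card A = 2}" using supp[of i j] by simp
    next
      fix A assume "A \<in> {A. A \<subseteq> S \<and> card A = 2}"
      then obtain i j where "A = {i, j}" "i \<noteq> j" "i \<in> S" "j \<in> S" by (auto simp: card_2_iff)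
      then show "A \<in> (\<lambda>t. {x. t x \<noteq> x}) ` trs S"
        by (intro image_eqI[of _ _ "tr i j"]) (auto simp: trs_def supp)
    qed
  qed
  show "card (trs S) = card S choose 2"
    using bij_betw_same_card[OF bij] n_subsets[OF assms, of 2] by simp
  have "finite {A. A \<subseteq> S \<and> card A = 2}" using assms by simp
  then show "finite (trs S)" using bij_betw_finite[OF bij] by blast
qed

lemma finite_transpositions: "finite (transpositions n)"
  by (simp add: transpositions_eq_trs card_trs)

lemma card_transpositions: "real (card (transpositions n)) = real n * (real n - 1) / 2"
proof -
  have "real (n choose 2) = real n * (real n - 1) / 2"
    by (cases n) (auto simp: choose_two real_of_nat_div algebra_simps)
  then show ?thesis by (simp add: transpositions_eq_trs card_trs)
qed

lemma card_transpositions_pos: "n \<ge> 2 \<Longrightarrow> card (transpositions n) > 0"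
  by (simp add: transpositions_eq_trs card_trs)

lemma finite_words: "finite (words n N)"
  unfolding words_def using finite_lists_length_eq[OF finite_transpositions, of n N]
  by (simp add: conj_commute)

lemma card_words: "card (words n N) = card (transpositions n) ^ N"
  unfolding words_def using card_lists_length_eq[OF finite_transpositions, of n N]
  by (simp add: conj_commute)

lemma card_words_pos: "n \<ge> 2 \<Longrightarrow> card (words n N) > 0"
  using card_transpositions_pos by (simp add: card_words)

definition wavg :: "nat \<Rightarrow> nat \<Rightarrow> ((nat \<Rightarrow> nat) list \<Rightarrow> real) \<Rightarrow> real" where
  "wavg n N f = (\<Sum>ts\<in>words n N. f ts) / real (card (words n N))"

lemma wavg_mono: "(\<And>ts. ts \<in> words n N \<Longrightarrow> f ts \<le> g ts) \<Longrightarrow> wavg n N f \<le> wavg n N g"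
  unfolding wavg_def by (intro divide_right_mono sum_mono) auto

lemma wavg_cong: "(\<And>ts. ts \<in> words n N \<Longrightarrow> f ts = g ts) \<Longrightarrow> wavg n N f = wavg n N g"
  unfolding wavg_def by (simp cong: sum.cong)

lemma wavg_add: "wavg n N (\<lambda>ts. f ts + g ts) = wavg n N f + wavg n N g"
  unfolding wavg_def by (simp add: sum.distrib add_divide_distrib)

lemma wavg_diff: "wavg n N (\<lambda>ts. f ts - g ts) = wavg n N f - wavg n N g"
  unfolding wavg_def by (simp add: sum_subtractf diff_divide_distrib)

lemma wavg_cmult: "wavg n N (\<lambda>ts. c * f ts) = c * wavg n N f"
  unfolding wavg_def by (simp add: sum_distrib_left)

lemma wavg_const: "n \<ge> 2 \<Longrightarrow> wavg n N (\<lambda>ts. c) = c"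
  unfolding wavg_def using card_words_pos[of n N] by simp

lemma wavg_nonneg: "(\<And>ts. ts \<in> words n N \<Longrightarrow> 0 \<le> f ts) \<Longrightarrow> 0 \<le> wavg n N f"
  unfolding wavg_def by (intro divide_nonneg_nonneg sum_nonneg) auto

lemma wavg_le_const:
  "n \<ge> 2 \<Longrightarrow> (\<And>ts. ts \<in> words n N \<Longrightarrow> f ts \<le> c) \<Longrightarrow> wavg n N f \<le> c"
  using wavg_mono[of n N f "\<lambda>_. c"] by (simp add: wavg_const)

lemma wavg_sum: "wavg n N (\<lambda>ts. \<Sum>i\<in>I. f i ts) = (\<Sum>i\<in>I. wavg n N (f i))"
  unfolding wavg_def by (simp add: sum.swap[of _ I] sum_divide_distrib)

lemma wavg_abs: "\<bar>wavg n N f\<bar> \<le> wavg n N (\<lambda>ts. \<bar>f ts\<bar>)"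
  unfolding wavg_def by (simp add: divide_right_mono)

lemma wavg_append: "wavg n (M + N) f = wavg n M (\<lambda>ts. wavg n N (\<lambda>us. f (ts @ us)))"
proof -
  have "bij_betw (\<lambda>(ts, us). ts @ us) (words n M \<times> words n N) (words n (M + N))"
  proof (rule bij_betwI[where g = "\<lambda>ts. (take M ts, drop M ts)"])
    show "(\<lambda>ts. (take M ts, drop M ts)) \<in> words n (M + N) \<rightarrow> words n M \<times> words n N"
      by (auto simp: words_def dest: in_set_takeD in_set_dropD)
  qed (auto simp: words_def)
  then have "(\<Sum>ts\<in>words n (M + N). f ts) = (\<Sum>(ts, us)\<in>words n M \<times> words n N. f (ts @ us))"
    using sum.reindex_bij_betw[of "\<lambda>(ts, us). ts @ us" _ _ f] by (simp add: case_prod_unfold)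
  then show ?thesis
    unfolding wavg_def
    by (simp add: sum.cartesian_product[symmetric] card_words power_add sum_divide_distrib mult.commute)
qed

lemma words_1: "words n 1 = (\<lambda>t. [t]) ` transpositions n"
  by (auto simp: words_def length_Suc_conv)

lemma wavg_1:
  "wavg n 1 g = (\<Sum>t\<in>transpositions n. g [t]) / real (card (transpositions n))"
proof -
  have inj: "inj_on (\<lambda>t. [t]) (transpositions n)" by (simp add: inj_on_def)
  show ?thesis unfolding wavg_def words_1 by (simp add: sum.reindex[OF inj] card_image[OF inj])
qed

lemma wavg_snoc:
  "wavg n (Suc N) f = wavg n N (\<lambda>ts. (\<Sum>t\<in>transpositions n. f (ts @ [t])) / real (card (transpositions n)))"
  using wavg_append[of n N 1 f] unfolding wavg_1 by simp

lemma wavg_Cons: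
  "wavg n (Suc N) f = (\<Sum>t\<in>transpositions n. wavg n N (\<lambda>ts. f (t # ts))) / real (card (transpositions n))"
  using wavg_append[of n 1 N f] unfolding wavg_1 by simp

lemma wavg_rev: "wavg n N (\<lambda>ts. f (rev ts)) = wavg n N f"
proof -
  have "bij_betw rev (words n N) (words n N)"
    by (rule bij_betwI[where g = rev]) (auto simp: words_def)
  then show ?thesis unfolding wavg_def using sum.reindex_bij_betw[of rev _ _ f] by simp
qed

lemma wavg_markov:
  assumes "c > 0" "\<And>ts. ts \<in> words n N \<Longrightarrow> 0 \<le> f ts"
  shows "wavg n N (\<lambda>ts. of_bool (c \<le> f ts)) \<le> wavg n N f / c"
proof -
  have "wavg n N (\<lambda>ts. of_bool (c \<le> f ts)) \<le> wavg n N (\<lambda>ts. (1 / c) * f ts)"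
    using assms by (intro wavg_mono) (auto simp: of_bool_def)
  then show ?thesis unfolding wavg_cmult by simp
qed

text \<open>Such a word is determined by its letters at the remaining positions.\<close>

lemma card_words_prescribed:
  assumes d: "distinct is" and s: "set is \<subseteq> {..<N}"
  shows "card {ts \<in> words n N. \<forall>e<length is. ts ! (is ! e) = c e}
    \<le> card (transpositions n) ^ (N - length is)"
proof -
  let ?J = "{..<N} - set is" and ?E = "transpositions n"
  let ?A = "{ts \<in> words n N. \<forall>e<length is. ts ! (is ! e) = c e}"
  have "card ?A \<le> card (Pi\<^sub>E ?J (\<lambda>_. ?E))"
  proof (rule card_inj_on_le[where f = "\<lambda>ts. restrict (\<lambda>i. ts ! i) ?J"])
    show "inj_on (\<lambda>ts. restrict (\<lambda>i. ts ! i) ?J) ?A"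
    proof (rule inj_onI)
      fix ts us assume t: "ts \<in> ?A" and u: "us \<in> ?A"
        and eq: "restrict (\<lambda>i. ts ! i) ?J = restrict (\<lambda>i. us ! i) ?J"
      show "ts = us"
      proof (rule nth_equalityI)
        show "length ts = length us" using t u by (simp add: words_def)
        fix i assume i: "i < length ts"
        show "ts ! i = us ! i"
        proof (cases "i \<in> set is")
          case True
          then show ?thesis using t u by (auto simp: in_set_conv_nth)
        next
          case False
          then have "i \<in> ?J" using i t by (simp add: words_def)
          then show ?thesis using fun_cong[OF eq, of i] by simp
        qed
      qed
    qed
    show "(\<lambda>ts. restrict (\<lambda>i. ts ! i) ?J) ` ?A \<subseteq> Pi\<^sub>E ?J (\<lambda>_. ?E)"
      by (auto simp: words_def subset_iff)
    show "finite (Pi\<^sub>E ?J (\<lambda>_. ?E))" by (intro finite_PiE finite_transpositions) auto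
  qed
  also have "\<dots> = card ?E ^ card ?J" by (subst card_PiE) auto
  also have "card ?J = N - length is" using s d by (simp add: card_Diff_subset distinct_card)
  finally show ?thesis .
qed

text \<open>First moment bound: a lasso with \<open>L\<close> letters has at most \<open>L^2\<close> shapes, \<open>n^L\<close> choices of the
  vertices and \<open>N^L\<close> choices of the positions, and the letters are prescribed at \<open>L\<close> distinct
  positions.\<close>

lemma wavg_lassos:
  assumes n: "n \<ge> 2"
  shows "wavg n N (\<lambda>ts. real (card (lassos n ts)))
    \<le> (\<Sum>L\<in>{1..N}. real L ^ 2 * (2 * real N / (real n - 1)) ^ L)"
proof -
  let ?E = "card (transpositions n)"
  define W where "W = (\<lambda>L. {ws. set ws \<subseteq> {1..n} \<and> length ws = L})"
  define I where "I = (\<lambda>L. {xs. set xs \<subseteq> {..<N} \<and> length xs = L})"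
  define K where "K = (\<lambda>L. {..<L} \<times> {..<L} \<times> W L \<times> I L)"
  have finK: "finite (K L)" for L
    unfolding K_def W_def I_def
    by (intro finite_cartesian_product finite_lists_length_eq) auto
  have cardK: "card (K L) = L * (L * (n ^ L * N ^ L))" for L
    by (simp add: K_def W_def I_def card_cartesian_product card_lists_length_eq)
  have E: "?E > 0" using card_transpositions_pos[OF n] .
  have "(\<Sum>ts\<in>words n N. card (lassos n ts))
      \<le> (\<Sum>ts\<in>words n N. \<Sum>L\<in>{1..N}. \<Sum>z\<in>K L. of_bool (z \<in> lassos n ts))"
  proof (rule sum_mono)
    fix ts assume ts: "ts \<in> words n N"
    have sub: "lassos n ts \<subseteq> (\<Union>L\<in>{1..N}. K L \<inter> lassos n ts)"
    proof
      fix z assume z: "z \<in> lassos n ts"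
      obtain l p ws "is" where zz: "z = (l, p, ws, is)" by (metis surj_pair)
      have "length ws \<le> N" using lasso_length_le[of l p ws "is" n ts] z zz ts by (simp add: words_def)
      moreover have "z \<in> K (length ws)" "length ws \<ge> 1"
        using z ts unfolding zz by (auto simp: K_def W_def I_def lassos_def words_def)
      ultimately show "z \<in> (\<Union>L\<in>{1..N}. K L \<inter> lassos n ts)" using z by auto
    qed
    have "card (lassos n ts) \<le> card (\<Union>L\<in>{1..N}. K L \<inter> lassos n ts)"
      by (rule card_mono[OF _ sub]) (use finK in auto)
    also have "\<dots> \<le> (\<Sum>L\<in>{1..N}. card (K L \<inter> lassos n ts))"
      by (rule card_UN_le) simp
    also have "\<dots> = (\<Sum>L\<in>{1..N}. \<Sum>z\<in>K L. of_bool (z \<in> lassos n ts))"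
      using finK by (intro sum.cong refl) (simp add: of_bool_def sum.If_cases Int_def)
    finally show "card (lassos n ts) \<le> (\<Sum>L\<in>{1..N}. \<Sum>z\<in>K L. of_bool (z \<in> lassos n ts))" .
  qed
  also have "\<dots> = (\<Sum>L\<in>{1..N}. \<Sum>z\<in>K L. \<Sum>ts\<in>words n N. of_bool (z \<in> lassos n ts))"
    by (subst sum.swap) (intro sum.cong refl sum.swap)
  also have "\<dots> \<le> (\<Sum>L\<in>{1..N}. \<Sum>z\<in>K L. ?E ^ (N - L))"
  proof (intro sum_mono)
    fix L z assume z: "z \<in> K L"
    obtain l p ws "is" where zz: "z = (l, p, ws, is)" by (metis surj_pair)
    let ?A = "{ts \<in> words n N. \<forall>e<length is. ts ! (is ! e) = tr (ws ! e) (ws ! lasso_next l p (length ws) e)}"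
    have L: "length is = L" using z by (simp add: zz K_def I_def)
    have "(\<Sum>ts\<in>words n N. of_bool (z \<in> lassos n ts)) = card {ts \<in> words n N. z \<in> lassos n ts}"
      using finite_words by (simp add: of_bool_def sum.If_cases Int_def)
    also have "\<dots> \<le> ?E ^ (N - L)"
    proof (cases "distinct is \<and> set is \<subseteq> {..<N}")
      case True
      have "card {ts \<in> words n N. z \<in> lassos n ts} \<le> card ?A"
        using finite_words by (intro card_mono) (auto simp: zz lassos_def)
      also have "\<dots> \<le> ?E ^ (N - L)" using card_words_prescribed[of "is" N n] True L by simp
      finally show ?thesis .
    next
      case False
      then have none: "{ts \<in> words n N. z \<in> lassos n ts} = {}" by (auto simp: zz lassos_def words_def)
      show ?thesis unfolding none by simp
    qed
    finally show "(\<Sum>ts\<in>words n N. of_bool (z \<in> lassos n ts)) \<le> ?E ^ (N - L)" .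
  qed
  also have "\<dots> = (\<Sum>L\<in>{1..N}. L * (L * (n ^ L * N ^ L)) * ?E ^ (N - L))"
    by (simp add: cardK)
  finally have "real (\<Sum>ts\<in>words n N. card (lassos n ts))
      \<le> real (\<Sum>L\<in>{1..N}. L * (L * (n ^ L * N ^ L)) * ?E ^ (N - L))"
    by (rule of_nat_mono)
  then have "wavg n N (\<lambda>ts. real (card (lassos n ts)))
      \<le> (\<Sum>L\<in>{1..N}. real L * (real L * (real n ^ L * real N ^ L)) * real ?E ^ (N - L)) / real ?E ^ N"
    unfolding wavg_def card_words by (simp add: divide_right_mono)
  also have "\<dots> = (\<Sum>L\<in>{1..N}. real L ^ 2 * (2 * real N / (real n - 1)) ^ L)"
    unfolding sum_divide_distrib
  proof (intro sum.cong refl)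
    fix L assume L: "L \<in> {1..N}"
    have "real n * real N / real ?E = 2 * real N / (real n - 1)"
      using n by (simp add: card_transpositions field_simps)
    then have "(2 * real N / (real n - 1)) ^ L = real n ^ L * real N ^ L / real ?E ^ L"
      by (metis power_divide power_mult_distrib)
    moreover have "real ?E ^ N = real ?E ^ (N - L) * real ?E ^ L"
      using L by (simp flip: power_add)
    ultimately show "real L * (real L * (real n ^ L * real N ^ L)) * real ?E ^ (N - L) / real ?E ^ N
        = real L ^ 2 * (2 * real N / (real n - 1)) ^ L"
      using E by (simp add: power2_eq_square)
  qed
  finally show ?thesis .
qed

lemma summable_square_geometric:
  fixes \<rho> :: real
  assumes "0 \<le> \<rho>" "\<rho> < 1"
  shows "summable (\<lambda>L. real L ^ 2 * \<rho> ^ L)"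
proof (cases "\<rho> = 0")
  case True
  then have "(\<lambda>L. real L ^ 2 * \<rho> ^ L) = (\<lambda>L. 0)" by (auto simp: fun_eq_iff power_0_left)
  then show ?thesis by simp
next
  case False
  then have "(\<lambda>L. real L ^ 2 * \<rho> ^ L) \<in> O(\<lambda>L. ((1 + \<rho>) / 2) ^ L)"
    using assms by real_asymp
  moreover have "summable (\<lambda>L. norm (((1 + \<rho>) / 2) ^ L))"
    using assms by (simp add: norm_power summable_geometric)
  ultimately show ?thesis using summable_comparison_test_bigo by blast
qed

definition lasso_const :: "real \<Rightarrow> real" where
  "lasso_const \<rho> = (\<Sum>L. real L ^ 2 * \<rho> ^ L)"

lemma wavg_lassos_le_const:
  assumes n: "n \<ge> 2" and \<rho>: "2 * real N / (real n - 1) \<le> \<rho>" "\<rho> < 1"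
  shows "wavg n N (\<lambda>ts. real (card (lassos n ts))) \<le> lasso_const \<rho>"
proof -
  have pos: "0 \<le> 2 * real N / (real n - 1)" using n by simp
  have "(\<Sum>L\<in>{1..N}. real L ^ 2 * (2 * real N / (real n - 1)) ^ L) \<le> (\<Sum>L\<in>{1..N}. real L ^ 2 * \<rho> ^ L)"
    using \<rho> pos by (intro sum_mono mult_left_mono power_mono) auto
  also have "\<dots> \<le> lasso_const \<rho>"
    unfolding lasso_const_def using \<rho> pos
    by (intro sum_le_suminf summable_square_geometric) auto
  finally show ?thesis using wavg_lassos[OF n, of N] by simp
qed

lemma lasso_const_nonneg: "0 \<le> \<rho> \<Longrightarrow> \<rho> < 1 \<Longrightarrow> 0 \<le> lasso_const \<rho>"
  unfolding lasso_const_def by (intro suminf_nonneg summable_square_geometric) auto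

section \<open>Concentration of the length\<close>

lemma words_permutes: "ts \<in> words n N \<Longrightarrow> wprod ts permutes {1..n}"
  unfolding words_def by (intro wprod_permutes) simp

lemma plen_diff_transposition:
  assumes "w permutes {1..n}" "t \<in> transpositions n"
  shows "\<bar>real (plen n (w \<circ> t)) - real (plen n w)\<bar> \<le> 1"
  using plen_comp_transposition[OF assms] by auto

text \<open>A letter in the middle of a product can be moved to the end by conjugation, so exchanging
  it changes the length by at most two.\<close>

lemma plen_exchange_letter:
  assumes u: "u permutes {1..n}" and v: "v permutes {1..n}"
    and t: "t \<in> transpositions n" "t' \<in> transpositions n"
  shows "\<bar>real (plen n (u \<circ> t \<circ> v)) - real (plen n (u \<circ> t' \<circ> v))\<bar> \<le> 2"
proof -
  have "\<bar>real (plen n (u \<circ> t \<circ> v)) - real (plen n (u \<circ> v))\<bar> \<le> 1" if t: "t \<in> transpositions n" for t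
  proof -
    obtain i j where ij: "t = tr i j" "i \<in> {1..n}" "j \<in> {1..n}" "i \<noteq> j"
      using transpositionsE[OF t] by blast
    have b: "bij v" using v permutes_bij by blast
    have "inv v permutes {1..n}" using v by (rule permutes_inv)
    then have "inv v i \<in> {1..n}" "inv v j \<in> {1..n}" "inv v i \<noteq> inv v j"
      using ij permutes_in_image[of "inv v" "{1..n}"] permutes_inj[of "inv v"] by (auto simp: inj_eq)
    then have "tr (inv v i) (inv v j) \<in> transpositions n" by (rule tr_in_transpositions)
    moreover have "u \<circ> t \<circ> v = u \<circ> v \<circ> tr (inv v i) (inv v j)"
      using transpose_comp_eq[OF b, of i j] ij(1) by (simp add: comp_assoc)
    ultimately show ?thesis
      using plen_diff_transposition[OF permutes_compose[OF v u]] by simp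
  qed
  from this[OF t(1)] this[OF t(2)] show ?thesis by linarith
qed

lemma wavg_square_shift:
  assumes "n \<ge> 2"
  shows "wavg n N (\<lambda>ts. (f ts - c) ^ 2)
    = wavg n N (\<lambda>ts. (f ts - wavg n N f) ^ 2) + (wavg n N f - c) ^ 2"
proof -
  let ?m = "wavg n N f"
  have sq: "wavg n N (\<lambda>ts. (f ts - b) ^ 2) = wavg n N (\<lambda>ts. (f ts) ^ 2) - 2 * b * ?m + b ^ 2" for b
  proof -
    have "wavg n N (\<lambda>ts. (f ts - b) ^ 2) = wavg n N (\<lambda>ts. ((f ts) ^ 2 - 2 * b * f ts) + b ^ 2)"
      by (intro wavg_cong) (simp add: power2_diff algebra_simps)
    also have "\<dots> = wavg n N (\<lambda>ts. (f ts) ^ 2 - 2 * b * f ts) + b ^ 2"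
      unfolding wavg_add wavg_const[OF assms] ..
    also have "\<dots> = wavg n N (\<lambda>ts. (f ts) ^ 2) - 2 * b * ?m + b ^ 2"
      unfolding wavg_diff wavg_cmult ..
    finally show ?thesis .
  qed
  show ?thesis unfolding sq by (simp add: power2_eq_square algebra_simps)
qed

text \<open>The bounded differences of \<open>plen_exchange_letter\<close> bound the variance, by conditioning on the
  first letter.\<close>

lemma plen_variance:
  assumes n: "n \<ge> 2" and u: "u permutes {1..n}"
  defines "f \<equiv> \<lambda>u N. wavg n N (\<lambda>ts. real (plen n (u \<circ> wprod ts)))"
  shows "wavg n N (\<lambda>ts. (real (plen n (u \<circ> wprod ts)) - f u N) ^ 2) \<le> 4 * real N"
  using u
proof (induction N arbitrary: u)
  case 0
  have "words n 0 = {[]}" by (auto simp: words_def)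
  then show ?case by (simp add: f_def wavg_def)
next
  case (Suc N)
  let ?E = "transpositions n"
  have E: "card ?E > 0" using card_transpositions_pos[OF n] .
  have fSuc: "f u (Suc N) = (\<Sum>t\<in>?E. f (u \<circ> t) N) / real (card ?E)"
    unfolding f_def wavg_Cons by (simp add: comp_assoc del: comp_apply)
  have ut: "u \<circ> t permutes {1..n}" if "t \<in> ?E" for t
    using permutes_compose[OF transpositions_permutes[OF that] Suc.prems] .
  have close: "\<bar>f (u \<circ> t) N - f (u \<circ> t') N\<bar> \<le> 2" if t: "t \<in> ?E" "t' \<in> ?E" for t t'
  proof -
    have "f (u \<circ> t) N - f (u \<circ> t') N = wavg n N (\<lambda>ts. real (plen n (u \<circ> t \<circ> wprod ts)) - real (plen n (u \<circ> t' \<circ> wprod ts)))"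
      unfolding f_def wavg_diff ..
    then have "\<bar>f (u \<circ> t) N - f (u \<circ> t') N\<bar> \<le> wavg n N (\<lambda>ts. \<bar>real (plen n (u \<circ> t \<circ> wprod ts)) - real (plen n (u \<circ> t' \<circ> wprod ts))\<bar>)"
      by (simp only: wavg_abs)
    also have "\<dots> \<le> 2"
    proof (rule wavg_le_const[OF n])
      fix ts assume "ts \<in> words n N"
      then have "wprod ts permutes {1..n}" by (rule words_permutes)
      then show "\<bar>real (plen n (u \<circ> t \<circ> wprod ts)) - real (plen n (u \<circ> t' \<circ> wprod ts))\<bar> \<le> 2"
        using plen_exchange_letter[OF Suc.prems _ t] by blast
    qed
    finally show ?thesis .
  qed
  have mean: "(f (u \<circ> t) N - f u (Suc N)) ^ 2 \<le> 4" if t: "t \<in> ?E" for t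
  proof -
    have "f (u \<circ> t) N - f u (Suc N) = (\<Sum>t'\<in>?E. f (u \<circ> t) N - f (u \<circ> t') N) / real (card ?E)"
      using E by (simp add: fSuc sum_subtractf field_simps)
    then have "\<bar>f (u \<circ> t) N - f u (Suc N)\<bar> \<le> (\<Sum>t'\<in>?E. \<bar>f (u \<circ> t) N - f (u \<circ> t') N\<bar>) / real (card ?E)"
      by (simp add: divide_right_mono del: sum_subtractf)
    also have "\<dots> \<le> (\<Sum>t'\<in>?E. 2) / real (card ?E)"
      using close[OF t] by (intro divide_right_mono sum_mono) auto
    also have "\<dots> = 2" using E by simp
    finally have "\<bar>f (u \<circ> t) N - f u (Suc N)\<bar> \<le> 2" .
    then have "\<bar>f (u \<circ> t) N - f u (Suc N)\<bar> ^ 2 \<le> 2 ^ 2" by (intro power_mono) auto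
    then show ?thesis by simp
  qed
  have "wavg n (Suc N) (\<lambda>ts. (real (plen n (u \<circ> wprod ts)) - f u (Suc N)) ^ 2)
      = (\<Sum>t\<in>?E. wavg n N (\<lambda>ts. (real (plen n (u \<circ> t \<circ> wprod ts)) - f u (Suc N)) ^ 2)) / real (card ?E)"
    unfolding wavg_Cons by (simp add: comp_assoc del: comp_apply)
  also have "\<dots> \<le> (\<Sum>t\<in>?E. 4 * real N + 4) / real (card ?E)"
  proof (intro divide_right_mono sum_mono)
    fix t assume t: "t \<in> ?E"
    have "wavg n N (\<lambda>ts. (real (plen n (u \<circ> t \<circ> wprod ts)) - f u (Suc N)) ^ 2)
        = wavg n N (\<lambda>ts. (real (plen n (u \<circ> t \<circ> wprod ts)) - f (u \<circ> t) N) ^ 2)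
          + (f (u \<circ> t) N - f u (Suc N)) ^ 2"
      unfolding f_def by (rule wavg_square_shift[OF n])
    then show "wavg n N (\<lambda>ts. (real (plen n (u \<circ> t \<circ> wprod ts)) - f u (Suc N)) ^ 2) \<le> 4 * real N + 4"
      using Suc.IH[OF ut[OF t]] mean[OF t] by linarith
  qed simp
  also have "\<dots> = 4 * real (Suc N)" using E by simp
  finally show ?case .
qed

definition mean_plen :: "nat \<Rightarrow> nat \<Rightarrow> real" where
  "mean_plen n N = wavg n N (\<lambda>ts. real (plen n (wprod ts)))"

lemma plen_concentration:
  assumes n: "n \<ge> 2"
  shows "wavg n N (\<lambda>ts. \<bar>real (plen n (wprod ts)) - mean_plen n N\<bar>) \<le> 2 * sqrt (real N)"
proof (cases "N = 0")
  case True
  have "words n 0 = {[]}" by (auto simp: words_def)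
  then show ?thesis using True by (simp add: mean_plen_def wavg_def)
next
  case False
  \<comment> \<open>the value that balances the two terms of the bound \<open>y^2 / (2 s) + s / 2\<close> for \<open>|y|\<close>\<close>
  define s where "s = 2 * sqrt (real N)"
  have s: "s > 0" using False by (simp add: s_def)
  let ?Y = "\<lambda>ts. real (plen n (wprod ts)) - mean_plen n N"
  have amgm: "\<bar>y\<bar> \<le> (1 / (2 * s)) * y ^ 2 + s / 2" for y
  proof -
    have "0 \<le> (\<bar>y\<bar> - s) ^ 2" by simp
    then have "2 * s * \<bar>y\<bar> \<le> y ^ 2 + s ^ 2" by (simp add: power2_diff algebra_simps)
    then show ?thesis using s by (simp add: field_simps power2_eq_square)
  qed
  have "wavg n N (\<lambda>ts. \<bar>?Y ts\<bar>) \<le> wavg n N (\<lambda>ts. (1 / (2 * s)) * (?Y ts) ^ 2 + s / 2)"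
    by (intro wavg_mono amgm)
  also have "\<dots> = (1 / (2 * s)) * wavg n N (\<lambda>ts. (?Y ts) ^ 2) + s / 2"
    unfolding wavg_add wavg_cmult wavg_const[OF n] ..
  also have "\<dots> \<le> (1 / (2 * s)) * (4 * real N) + s / 2"
    using plen_variance[OF n permutes_id, of N] s unfolding mean_plen_def
    by (intro add_right_mono mult_left_mono) auto
  also have "\<dots> = s"
  proof -
    have "s * s = 4 * real N" by (simp add: s_def)
    then show ?thesis using s by (simp add: field_simps)
  qed
  finally show ?thesis by (simp add: s_def)
qed

section \<open>Small cycles that are not tidy\<close>

definition untidy :: "nat \<Rightarrow> nat \<Rightarrow> (nat \<Rightarrow> nat) list \<Rightarrow> nat set set" where
  "untidy n K ts = {A \<in> cycles {1..n} (wprod ts). card A \<le> K \<and> \<not> tidy ts A}"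

definition small_split :: "nat \<Rightarrow> (nat \<Rightarrow> nat) \<Rightarrow> (nat \<Rightarrow> nat) \<Rightarrow> bool" where
  "small_split K w t \<longleftrightarrow> (\<exists>i j. i \<noteq> j \<and> t = tr i j \<and> j \<in> orbit w i \<and> card (orbit (w \<circ> t) j) \<le> K)"

lemma finite_untidy: "finite (untidy n K ts)"
  unfolding untidy_def using finite_cycles[of "{1..n}"] by simp

text \<open>A merge creates an untidy cycle only from an untidy one, which is smaller and disappears. A
  split creates at most two new cycles.\<close>

lemma card_untidy_snoc:
  assumes ts: "set ts \<subseteq> transpositions n" and t: "t \<in> transpositions n"
  shows "card (untidy n K (ts @ [t])) \<le> card (untidy n K ts) + 2 * of_bool (small_split K (wprod ts) t)"
proof -
  let ?w = "wprod ts"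
  have wp: "?w permutes {1..n}" by (rule wprod_permutes[OF ts])
  have p: "permutation ?w" using permutes_permutation[OF _ wp] by simp
  note self = permutation_self_in_orbit[OF p]
  obtain i j where ij: "t = tr i j" "i \<in> {1..n}" "j \<in> {1..n}" "i \<noteq> j"
    using transpositionsE[OF t] by blast
  let ?Oi = "orbit ?w i" and ?Oj = "orbit ?w j"
  have old: "A \<in> untidy n K ts" if A: "A \<in> cycles {1..n} ?w" "i \<notin> A" "j \<notin> A"
    "A \<in> untidy n K (ts @ [t])" for A
  proof -
    have "\<not> touches A t" using A(2,3) ij(1) touches_tr[OF ij(4)] by simp
    then show ?thesis using A tidy_snoc_other[of ts A t] by (auto simp: untidy_def)
  qed
  show ?thesis
  proof (cases "j \<in> ?Oi")
    case False
    have cyc: "cycles {1..n} (wprod (ts @ [t])) = insert (?Oi \<union> ?Oj) (cycles {1..n} ?w - {?Oi, ?Oj})"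
      using cycles_merge[OF _ wp ij(2,3) False] ij(1) by simp
    have oldc: "A \<in> untidy n K ts - {?Oi, ?Oj}"
      if "A \<in> cycles {1..n} ?w - {?Oi, ?Oj}" "A \<in> untidy n K (ts @ [t])" for A
    proof -
      have "i \<notin> A" "j \<notin> A" using that(1) cycles_eq_orbit[OF p, of A "{1..n}"] by auto
      then show ?thesis using old that by blast
    qed
    have sub: "untidy n K (ts @ [t]) \<subseteq> insert (?Oi \<union> ?Oj) (untidy n K ts - {?Oi, ?Oj})"
      using oldc cyc by (auto simp: untidy_def simp del: wprod_snoc)
    have "card (untidy n K (ts @ [t])) \<le> card (untidy n K ts)"
    proof (cases "?Oi \<union> ?Oj \<in> untidy n K (ts @ [t])")
      case False
      then have "untidy n K (ts @ [t]) \<subseteq> untidy n K ts" using sub by blast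
      then show ?thesis by (intro card_mono finite_untidy)
    next
      case True
      have fin: "finite ?Oi" "finite ?Oj" using finite_orbit[OF self] by auto
      have disj: "?Oi \<inter> ?Oj = {}"
        using orbit_disjoint_or_eq[OF p, of i j] False self[of j] by blast
      have "\<not> (tidy ts ?Oi \<and> tidy ts ?Oj)"
        using tidy_merge[OF _ _ disj self self fin] True ij(1) by (auto simp: untidy_def)
      moreover have "card ?Oi \<le> K" "card ?Oj \<le> K"
        using True fin card_mono[of "?Oi \<union> ?Oj" ?Oi] card_mono[of "?Oi \<union> ?Oj" ?Oj]
        by (auto simp: untidy_def)
      ultimately obtain B where B: "B \<in> untidy n K ts" "B \<in> {?Oi, ?Oj}"
        using orbit_in_cycles[OF ij(2), of ?w] orbit_in_cycles[OF ij(3), of ?w]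
        unfolding untidy_def by blast
      have "card (untidy n K (ts @ [t])) \<le> card (insert (?Oi \<union> ?Oj) (untidy n K ts - {?Oi, ?Oj}))"
        using sub finite_untidy by (intro card_mono) auto
      also have "\<dots> \<le> Suc (card (untidy n K ts - {?Oi, ?Oj}))" by (rule card_insert_le_m1[THEN order_trans]) auto
      also have "card (untidy n K ts - {?Oi, ?Oj}) < card (untidy n K ts)"
        using B finite_untidy by (intro psubset_card_mono) auto
      finally show ?thesis by simp
    qed
    then show ?thesis by simp
  next
    case True
    let ?w' = "?w \<circ> t"
    have wp': "?w' permutes {1..n}" using permutes_comp_tr[OF wp ij(2,3)] ij(1) by simp
    have p': "permutation ?w'" using permutes_permutation[OF _ wp'] by simp
    have nj: "j \<notin> orbit ?w' i" using split_imp_merge[OF p ij(4) True] ij(1) by simp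
    have undo: "?w' \<circ> tr i j = ?w" using ij(1) by (simp add: comp_assoc)
    have cyc: "cycles {1..n} ?w = insert (orbit ?w' i \<union> orbit ?w' j) (cycles {1..n} ?w' - {orbit ?w' i, orbit ?w' j})"
      using cycles_merge[OF _ wp' ij(2,3) nj] undo by simp
    have sub: "untidy n K (ts @ [t]) \<subseteq> untidy n K ts \<union> {A \<in> {orbit ?w' i, orbit ?w' j}. card A \<le> K}"
    proof
      fix A assume A: "A \<in> untidy n K (ts @ [t])"
      then have Ac: "A \<in> cycles {1..n} ?w'" "card A \<le> K" by (auto simp: untidy_def)
      show "A \<in> untidy n K ts \<union> {A \<in> {orbit ?w' i, orbit ?w' j}. card A \<le> K}"
      proof (cases "A \<in> {orbit ?w' i, orbit ?w' j}")
        case False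
        then have "i \<notin> A" "j \<notin> A" using cycles_eq_orbit[OF p' Ac(1)] by auto
        then show ?thesis using old A Ac False cyc by blast
      qed (use Ac in blast)
    qed
    have "card (untidy n K (ts @ [t])) \<le> card (untidy n K ts) + card {A \<in> {orbit ?w' i, orbit ?w' j}. card A \<le> K}"
      using sub finite_untidy by (intro order_trans[OF card_mono card_Un_le]) auto
    also have "card {A \<in> {orbit ?w' i, orbit ?w' j}. card A \<le> K} \<le> 2 * of_bool (small_split K ?w t)"
    proof (cases "card (orbit ?w' i) \<le> K \<or> card (orbit ?w' j) \<le> K")
      case False
      then have none: "{A \<in> {orbit ?w' i, orbit ?w' j}. card A \<le> K} = {}" by auto
      show ?thesis unfolding none by simp
    next
      case small: True
      have "i \<in> ?Oj" using True orbit_eq_of_mem[OF p True] self[of i] by simp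
      then have "small_split K ?w t"
        using small True ij unfolding small_split_def by (metis transpose_commute)
      moreover have "card {A \<in> {orbit ?w' i, orbit ?w' j}. card A \<le> K} \<le> card {orbit ?w' i, orbit ?w' j}"
        by (intro card_mono) auto
      then have "card {A \<in> {orbit ?w' i, orbit ?w' j}. card A \<le> K} \<le> 2"
        by (rule order_trans) (simp add: card_insert_if)
      ultimately show ?thesis by simp
    qed
    finally show ?thesis by simp
  qed
qed

text \<open>If the piece of \<open>j\<close> has size \<open>q\<close>, then \<open>j = w^q i\<close>: a small split is determined by \<open>i\<close> and
  \<open>q \<le> K\<close>.\<close>

lemma card_small_split:
  assumes "w permutes {1..n}"
  shows "card {t \<in> transpositions n. small_split K w t} \<le> n * K"
proof -
  have p: "permutation w" using permutes_permutation[OF _ assms] by simp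
  have "{t \<in> transpositions n. small_split K w t} \<subseteq> (\<lambda>(i, q). tr i ((w ^^ q) i)) ` ({1..n} \<times> {1..K})"
  proof
    fix t assume t: "t \<in> {t \<in> transpositions n. small_split K w t}"
    then obtain i j where ij: "i \<noteq> j" "t = tr i j" "j \<in> orbit w i" "card (orbit (w \<circ> t) j) \<le> K"
      by (auto simp: small_split_def)
    let ?q = "card (orbit (w \<circ> t) j)"
    have "j = (w ^^ ?q) i" using orbit_split(3)[OF p ij(1,3)] ij(2) by simp
    moreover have "?q \<noteq> 0" using \<open>j = (w ^^ ?q) i\<close> ij(1) by (metis funpow_0)
    moreover have "i \<in> {1..n}" using t ij(2) tr_in_transpositions_iff by simp
    ultimately show "t \<in> (\<lambda>(i, q). tr i ((w ^^ q) i)) ` ({1..n} \<times> {1..K})"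
      using ij by (intro image_eqI[of _ _ "(i, ?q)"]) auto
  qed
  then have "card {t \<in> transpositions n. small_split K w t} \<le> card ({1..n} \<times> {1..K})"
    by (intro surj_card_le) auto
  then show ?thesis by simp
qed

lemma wavg_untidy:
  assumes n: "n \<ge> 2"
  shows "wavg n N (\<lambda>ts. real (card (untidy n K ts))) \<le> 4 * real N * real K / (real n - 1)"
proof (induction N)
  case 0
  have "cycles {1..n} id = (\<lambda>x. {x}) ` {1..n}" by (rule cycles_id)
  then have "untidy n K [] = {}" by (auto simp: untidy_def tidy_def simp del: id_apply)
  moreover have "words n 0 = {[]}" by (auto simp: words_def)
  ultimately show ?case by (simp add: wavg_def)
next
  case (Suc N)
  let ?E = "transpositions n"
  have E: "card ?E > 0" using card_transpositions_pos[OF n] .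
  have "wavg n (Suc N) (\<lambda>ts. real (card (untidy n K ts)))
      \<le> wavg n N (\<lambda>ts. real (card (untidy n K ts)) + 2 * (real n * real K / real (card ?E)))"
    unfolding wavg_snoc
  proof (rule wavg_mono)
    fix ts assume "ts \<in> words n N"
    then have ts: "set ts \<subseteq> ?E" by (simp add: words_def)
    have "(\<Sum>t\<in>?E. real (card (untidy n K (ts @ [t]))))
        \<le> (\<Sum>t\<in>?E. real (card (untidy n K ts)) + 2 * of_bool (small_split K (wprod ts) t))"
    proof (rule sum_mono)
      fix t assume "t \<in> ?E"
      from of_nat_mono[OF card_untidy_snoc[OF ts this, of K], where 'a = real]
      show "real (card (untidy n K (ts @ [t]))) \<le> real (card (untidy n K ts)) + 2 * of_bool (small_split K (wprod ts) t)"
        by simp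
    qed
    also have "\<dots> = real (card ?E) * real (card (untidy n K ts))
        + 2 * real (card {t \<in> ?E. small_split K (wprod ts) t})"
      using finite_transpositions
      by (simp add: sum.distrib sum_distrib_left[symmetric] of_bool_def sum.If_cases Int_def)
    also have "\<dots> \<le> real (card ?E) * real (card (untidy n K ts)) + 2 * (real n * real K)"
      using of_nat_mono[OF card_small_split[OF wprod_permutes[OF ts], of K], where 'a = real] by simp
    finally show "(\<Sum>t\<in>?E. real (card (untidy n K (ts @ [t])))) / real (card ?E)
        \<le> real (card (untidy n K ts)) + 2 * (real n * real K / real (card ?E))"
      using E by (simp add: field_simps)
  qed
  also have "\<dots> = wavg n N (\<lambda>ts. real (card (untidy n K ts))) + 2 * (real n * real K / real (card ?E))"
    unfolding wavg_add wavg_const[OF n] ..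
  also have "2 * (real n * real K / real (card ?E)) = 4 * real K / (real n - 1)"
    using n by (simp add: card_transpositions field_simps)
  finally show ?case using Suc.IH n by (simp add: field_simps)
qed

section \<open>The number of tidy cycles of a given size\<close>

text \<open>Choose the positions of the letters satisfying \<open>P\<close>; the other positions are free.\<close>

lemma card_words_filter:
  assumes "set l \<subseteq> {t \<in> transpositions n. P t}"
  shows "card {ts \<in> words n N. filter P ts = l}
    = (N choose length l) * card {t \<in> transpositions n. \<not> P t} ^ (N - length l)"
  using assms
proof (induction N arbitrary: l)
  case 0
  have w: "words n 0 = {[]}" by (auto simp: words_def)
  show ?case
  proof (cases l)
    case Nil
    then have one: "{ts \<in> words n 0. filter P ts = l} = {[]}" unfolding w by auto
    show ?thesis unfolding one using Nil by simp
  next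
    case (Cons a l')
    then have none: "{ts \<in> words n 0. filter P ts = l} = {}" unfolding w by auto
    show ?thesis unfolding none using Cons by simp
  qed
next
  case (Suc N)
  let ?E = "transpositions n" and ?F = "{t \<in> transpositions n. \<not> P t}"
  define A where "A = (\<lambda>(t, ts). t # ts) ` (?F \<times> {ts \<in> words n N. filter P ts = l})"
  define B where "B = (case l of [] \<Rightarrow> {} | a # l' \<Rightarrow> Cons a ` {ts \<in> words n N. filter P ts = l'})"
  have eq: "{ts \<in> words n (Suc N). filter P ts = l} = A \<union> B"
  proof (intro equalityI subsetI)
    fix us assume "us \<in> {ts \<in> words n (Suc N). filter P ts = l}"
    then have "length us = Suc N" "set us \<subseteq> ?E" "filter P us = l" by (simp_all add: words_def)
    then obtain t ts where us: "us = t # ts" "t \<in> ?E" "ts \<in> words n N" "filter P (t # ts) = l"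
      by (cases us) (simp_all add: words_def)
    show "us \<in> A \<union> B"
    proof (cases "P t")
      case True
      then show ?thesis using us by (auto simp: B_def)
    next
      case False
      then show ?thesis using us by (auto simp: A_def)
    qed
  next
    fix us assume "us \<in> A \<union> B"
    then show "us \<in> {ts \<in> words n (Suc N). filter P ts = l}"
      using Suc.prems by (auto simp: A_def B_def words_def split: list.splits)
  qed
  have disj: "A \<inter> B = {}" using Suc.prems by (auto simp: A_def B_def split: list.splits)
  have fin: "finite A" "finite B"
    using finite_words finite_transpositions by (auto simp: A_def B_def split: list.splits)
  have cA: "card A = card ?F * ((N choose length l) * card ?F ^ (N - length l))"
    unfolding A_def using Suc.IH[OF Suc.prems]
    by (subst card_image) (auto simp: inj_on_def card_cartesian_product)
  show ?case
  proof (cases l)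
    case Nil
    then show ?thesis using cA eq by (simp add: B_def)
  next
    case (Cons a l')
    have "card B = (N choose length l') * card ?F ^ (N - length l')"
      using Suc.IH[of l'] Suc.prems Cons by (simp add: B_def card_image)
    moreover have "card (A \<union> B) = card A + card B" by (rule card_Un_disjoint[OF fin disj])
    moreover have "card ?F * ((N choose length l) * card ?F ^ (N - length l))
        = (N choose length l) * card ?F ^ (N - length l')"
    proof (cases "length l \<le> N")
      case True
      then have "N - length l' = Suc (N - length l)" using Cons by simp
      then show ?thesis by simp
    qed simp
    ultimately show ?thesis using eq cA Cons by (simp add: add_mult_distrib)
  qed
qed

lemma wprod_filter_touches:
  assumes "\<And>t. t \<in> set ts \<Longrightarrow> touches A t \<Longrightarrow> t permutes A"
  shows "x \<in> A \<Longrightarrow> wprod ts x = wprod (filter (touches A) ts) x \<and> wprod ts x \<in> A"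
  using assms
proof (induction ts)
  case (Cons t ts)
  then have IH: "wprod ts x = wprod (filter (touches A) ts) x" "wprod ts x \<in> A" by auto
  show ?case
  proof (cases "touches A t")
    case True
    then have "t permutes A" using Cons.prems by simp
    then show ?thesis using IH True permutes_in_image by fastforce
  next
    case False
    then have "t (wprod ts x) = wprod ts x" using IH(2) by (auto simp: touches_def)
    then show ?thesis using IH False by simp
  qed
qed simp

lemma mem_cycles_iff:
  assumes "permutation w" "A \<subseteq> S"
  shows "A \<in> cycles S w \<longleftrightarrow> (\<exists>x\<in>A. A = orbit w x)"
  using assms permutation_self_in_orbit[OF assms(1)] by (auto simp: cycles_def)

text \<open>The possible subwords of the letters that meet a tidy cycle \<open>A\<close>. Their number does not depend on
  the length of the whole word.\<close>

definition tidy_cores :: "nat \<Rightarrow> nat set \<Rightarrow> (nat \<Rightarrow> nat) list set" where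
  "tidy_cores n A = {l. Suc (length l) = card A \<and> set l \<subseteq> trs A \<and> A \<in> cycles {1..n} (wprod l)}"

lemma trs_iff: "t \<in> trs A \<longleftrightarrow> (\<exists>n. t \<in> transpositions n) \<and> touches A t \<and> t permutes A"
  if "A \<subseteq> {1..m}"
proof
  assume "t \<in> trs A"
  then obtain i j where ij: "t = tr i j" "i \<in> A" "j \<in> A" "i \<noteq> j" by (auto simp: trs_def)
  then show "(\<exists>n. t \<in> transpositions n) \<and> touches A t \<and> t permutes A"
    using touches_tr[OF ij(4), of A] tr_permutes_iff[OF ij(4), of A] tr_in_transpositions[of i m j] that
    by blast
next
  assume a: "(\<exists>n. t \<in> transpositions n) \<and> touches A t \<and> t permutes A"
  then obtain i j where ij: "t = tr i j" "i \<noteq> j" by (metis transpositionsE)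
  then show "t \<in> trs A" using a tr_permutes_iff[OF ij(2), of A] unfolding trs_def by blast
qed

lemma trs_mono: "A \<subseteq> B \<Longrightarrow> trs A \<subseteq> trs B"
  by (auto simp: trs_def)

text \<open>Whether \<open>A\<close> is a tidy cycle depends only on the subword of the letters that meet \<open>A\<close>; the
  other letters range freely over the transpositions of the complement. Hence the number of words
  is a quantity independent of \<open>N\<close> times an explicit factor.\<close>

lemma card_words_tidy_cycle:
  assumes A: "A \<subseteq> {1..n}" and k: "card A = Suc k"
  shows "card {ts \<in> words n N. A \<in> cycles {1..n} (wprod ts) \<and> tidy ts A}
    = card (tidy_cores n A) * ((N choose k) * ((n - Suc k) choose 2) ^ (N - k))"
proof -
  let ?P = "touches A"
  have finA: "finite A" using A finite_subset by blast
  have sub: "trs A \<subseteq> transpositions n" using trs_mono[OF A] by (simp add: transpositions_eq_trs)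
  have iff: "(A \<in> cycles {1..n} (wprod ts) \<and> tidy ts A) \<longleftrightarrow> filter ?P ts \<in> tidy_cores n A"
    if ts: "ts \<in> words n N" for ts
  proof -
    have tw: "set ts \<subseteq> transpositions n" using ts by (simp add: words_def)
    have letters: "(\<forall>t\<in>set ts. ?P t \<longrightarrow> t permutes A) \<longleftrightarrow> set (filter ?P ts) \<subseteq> trs A"
      using trs_iff[OF A] tw by auto
    show ?thesis
    proof (cases "\<forall>t\<in>set ts. ?P t \<longrightarrow> t permutes A")
      case True
      have p1: "permutation (wprod ts)"
        using permutes_permutation[OF _ wprod_permutes[OF tw]] by simp
      have "set (filter ?P ts) \<subseteq> transpositions n" using tw by auto
      then have p2: "permutation (wprod (filter ?P ts))"
        using permutes_permutation[OF _ wprod_permutes] by blast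
      have "orbit (wprod ts) x = orbit (wprod (filter ?P ts)) x" if "x \<in> A" for x
        using that wprod_filter_touches[of ts A] True by (intro orbit_cong0[where A = A]) auto
      then have "A \<in> cycles {1..n} (wprod ts) \<longleftrightarrow> A \<in> cycles {1..n} (wprod (filter ?P ts))"
        unfolding mem_cycles_iff[OF p1 A] mem_cycles_iff[OF p2 A] by auto
      then show ?thesis using True letters unfolding tidy_def tidy_cores_def by blast
    next
      case False
      then show ?thesis using letters by (auto simp: tidy_def tidy_cores_def)
    qed
  qed
  have fin: "finite (tidy_cores n A)"
  proof (rule finite_subset)
    show "tidy_cores n A \<subseteq> {l. set l \<subseteq> transpositions n \<and> length l = k}"
      using sub k by (auto simp: tidy_cores_def)
    show "finite {l. set l \<subseteq> transpositions n \<and> length l = k}"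
      by (intro finite_lists_length_eq finite_transpositions)
  qed
  have avoid: "{t \<in> transpositions n. \<not> ?P t} = trs ({1..n} - A)"
  proof (intro equalityI subsetI)
    fix t assume t: "t \<in> {t \<in> transpositions n. \<not> ?P t}"
    then obtain i j where ij: "t = tr i j" "i \<in> {1..n}" "j \<in> {1..n}" "i \<noteq> j"
      by (auto elim: transpositionsE)
    then show "t \<in> trs ({1..n} - A)" using t touches_tr[OF ij(4), of A] unfolding trs_def by blast
  next
    fix t assume "t \<in> trs ({1..n} - A)"
    then obtain i j where ij: "t = tr i j" "i \<in> {1..n} - A" "j \<in> {1..n} - A" "i \<noteq> j"
      unfolding trs_def by blast
    then show "t \<in> {t \<in> transpositions n. \<not> ?P t}"
      using touches_tr[OF ij(4), of A] tr_in_transpositions[of i n j] by simp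
  qed
  have "card ({1..n} - A) = n - Suc k" using A k finA by (simp add: card_Diff_subset)
  then have cavoid: "card {t \<in> transpositions n. \<not> ?P t} = (n - Suc k) choose 2"
    unfolding avoid by (simp add: card_trs)
  have "{ts \<in> words n N. A \<in> cycles {1..n} (wprod ts) \<and> tidy ts A}
      = (\<Union>l\<in>tidy_cores n A. {ts \<in> words n N. filter ?P ts = l})"
    using iff by auto
  also have "card \<dots> = (\<Sum>l\<in>tidy_cores n A. card {ts \<in> words n N. filter ?P ts = l})"
    using fin finite_words by (intro card_UN_disjoint) auto
  also have "\<dots> = (\<Sum>l\<in>tidy_cores n A. (N choose k) * ((n - Suc k) choose 2) ^ (N - k))"
  proof (rule sum.cong[OF refl])
    fix l assume l: "l \<in> tidy_cores n A"
    then have "set l \<subseteq> {t \<in> transpositions n. ?P t}"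
      using sub trs_iff[OF A] by (auto simp: tidy_cores_def)
    moreover have "length l = k" using l k by (simp add: tidy_cores_def)
    ultimately show "card {ts \<in> words n N. filter ?P ts = l} = (N choose k) * ((n - Suc k) choose 2) ^ (N - k)"
      using card_words_filter[of l n ?P N] cavoid by simp
  qed
  finally show ?thesis by simp
qed

definition tidy_cycles :: "nat \<Rightarrow> nat \<Rightarrow> (nat \<Rightarrow> nat) list \<Rightarrow> nat set set" where
  "tidy_cycles n k ts = {A \<in> cycles {1..n} (wprod ts). card A = k \<and> tidy ts A}"

lemma wavg_tidy_cycles:
  "wavg n N (\<lambda>ts. real (card (tidy_cycles n (Suc k) ts)))
    = real (\<Sum>A | A \<subseteq> {1..n} \<and> card A = Suc k. card (tidy_cores n A))
      * (real (N choose k) * real ((n - Suc k) choose 2) ^ (N - k)) / real (card (transpositions n)) ^ N"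
proof -
  let ?S = "{A. A \<subseteq> {1..n} \<and> card A = Suc k}"
  have finS: "finite ?S" by simp
  have "(\<Sum>ts\<in>words n N. card (tidy_cycles n (Suc k) ts))
      = (\<Sum>ts\<in>words n N. \<Sum>A\<in>?S. of_bool (A \<in> cycles {1..n} (wprod ts) \<and> tidy ts A))"
  proof (rule sum.cong[OF refl])
    fix ts assume "ts \<in> words n N"
    then have "tidy_cycles n (Suc k) ts = {A \<in> ?S. A \<in> cycles {1..n} (wprod ts) \<and> tidy ts A}"
      using cycles_subset[OF words_permutes] unfolding tidy_cycles_def by blast
    then show "card (tidy_cycles n (Suc k) ts) = (\<Sum>A\<in>?S. of_bool (A \<in> cycles {1..n} (wprod ts) \<and> tidy ts A))"
      using finS by (simp add: of_bool_def sum.If_cases Int_def)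
  qed
  also have "\<dots> = (\<Sum>A\<in>?S. \<Sum>ts\<in>words n N. of_bool (A \<in> cycles {1..n} (wprod ts) \<and> tidy ts A))"
    by (rule sum.swap)
  also have "\<dots> = (\<Sum>A\<in>?S. card {ts \<in> words n N. A \<in> cycles {1..n} (wprod ts) \<and> tidy ts A})"
    using finite_words by (intro sum.cong) (auto simp: of_bool_def sum.If_cases Int_def)
  also have "\<dots> = (\<Sum>A\<in>?S. card (tidy_cores n A) * ((N choose k) * ((n - Suc k) choose 2) ^ (N - k)))"
    by (intro sum.cong refl card_words_tidy_cycle) auto
  finally have "(\<Sum>ts\<in>words n N. card (tidy_cycles n (Suc k) ts))
      = (\<Sum>A\<in>?S. card (tidy_cores n A)) * ((N choose k) * ((n - Suc k) choose 2) ^ (N - k))"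
    by (simp add: sum_distrib_right)
  then have "real (\<Sum>ts\<in>words n N. card (tidy_cycles n (Suc k) ts))
      = real (\<Sum>A\<in>?S. card (tidy_cores n A)) * (real (N choose k) * real ((n - Suc k) choose 2) ^ (N - k))"
    by simp
  then show ?thesis unfolding wavg_def card_words by simp
qed

text \<open>The core counts cancel in the comparison of two lengths.\<close>

lemma wavg_tidy_cycles_ratio:
  assumes n: "n \<ge> 2" and M: "k \<le> M" "M \<le> N"
  shows "wavg n N (\<lambda>ts. real (card (tidy_cycles n (Suc k) ts)))
    = wavg n M (\<lambda>ts. real (card (tidy_cycles n (Suc k) ts)))
      * (real (N choose k) / real (M choose k))
      * (real ((n - Suc k) choose 2) / real (card (transpositions n))) ^ (N - M)"
proof -
  let ?E = "real (card (transpositions n))" and ?e = "real ((n - Suc k) choose 2)"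
  have E: "?E > 0" using card_transpositions_pos[OF n] by simp
  have c: "real (M choose k) > 0" using M(1) by simp
  have "N - k = (M - k) + (N - M)" "N = M + (N - M)" using M by auto
  then have pe: "?e ^ (N - k) = ?e ^ (M - k) * ?e ^ (N - M)" "?E ^ N = ?E ^ M * ?E ^ (N - M)"
    by (metis power_add)+
  show ?thesis unfolding wavg_tidy_cycles pe using E c by (simp add: field_simps)
qed

section \<open>The limit of the normalised length\<close>

definition scaled :: "real \<Rightarrow> nat \<Rightarrow> nat" where
  "scaled s n = nat \<lfloor>s * real n\<rfloor>"

lemma scaled_bounds:
  assumes "0 \<le> s"
  shows "real (scaled s n) \<le> s * real n" "s * real n - 1 \<le> real (scaled s n)"
proof -
  have "0 \<le> s * real n" using assms by simp
  then have "real (scaled s n) = of_int \<lfloor>s * real n\<rfloor>" by (simp add: scaled_def)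
  then show "real (scaled s n) \<le> s * real n" "s * real n - 1 \<le> real (scaled s n)" by linarith+
qed

lemma scaled_lim:
  assumes "0 \<le> s"
  shows "(\<lambda>n. real (scaled s n) / real n) \<longlonglongrightarrow> s"
proof (rule real_tendsto_sandwich)
  have "eventually (\<lambda>n::nat. n > 0) sequentially" by (rule eventually_gt_at_top)
  then show "\<forall>\<^sub>F n in sequentially. s - 1 / real n \<le> real (scaled s n) / real n"
  proof eventually_elim
    case (elim n)
    then have "s - 1 / real n = (s * real n - 1) / real n" by (simp add: field_simps)
    also have "\<dots> \<le> real (scaled s n) / real n"
      by (intro divide_right_mono scaled_bounds(2)[OF assms]) simp
    finally show ?case .
  qed
  show "\<forall>\<^sub>F n in sequentially. real (scaled s n) / real n \<le> s"
    using eventually_gt_at_top[of "0::nat"]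
  proof eventually_elim
    case (elim n)
    then show ?case using scaled_bounds(1)[OF assms, of n] by (simp add: field_simps)
  qed
  show "(\<lambda>n. s - 1 / real n) \<longlonglongrightarrow> s" by real_asymp
qed simp

lemma mean_plen_le: "n \<ge> 2 \<Longrightarrow> mean_plen n N \<le> real N"
  unfolding mean_plen_def using plen_wprod_le by (intro wavg_le_const) (auto simp: words_def)

lemma mean_plen_ge:
  assumes n: "n \<ge> 2" and \<rho>: "2 * real N / (real n - 1) \<le> \<rho>" "\<rho> < 1"
  shows "real N - 2 * lasso_const \<rho> \<le> mean_plen n N"
proof -
  have "real N = wavg n N (\<lambda>ts. real N)" using wavg_const[OF n] by simp
  also have "\<dots> \<le> wavg n N (\<lambda>ts. real (plen n (wprod ts)) + 2 * real (card (lassos n ts)))"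
  proof (rule wavg_mono)
    fix ts assume "ts \<in> words n N"
    then have "N \<le> plen n (wprod ts) + 2 * card (lassos n ts)"
      using plen_ge_lassos[of ts n] by (simp add: words_def)
    then show "real N \<le> real (plen n (wprod ts)) + 2 * real (card (lassos n ts))" by linarith
  qed
  also have "\<dots> = mean_plen n N + 2 * wavg n N (\<lambda>ts. real (card (lassos n ts)))"
    unfolding wavg_add wavg_cmult mean_plen_def ..
  also have "\<dots> \<le> mean_plen n N + 2 * lasso_const \<rho>"
    using wavg_lassos_le_const[OF n \<rho>] by simp
  finally show ?thesis by simp
qed

lemma subcritical_eventually:
  assumes s: "0 \<le> s" "s < 1 / 2"
  shows "\<forall>\<^sub>F n in sequentially. n \<ge> 2 \<and> 2 * real (scaled s n) / (real n - 1) \<le> s + 1 / 2"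
proof -
  have "(\<lambda>n. 2 * s * real n / (real n - 1)) \<longlonglongrightarrow> 2 * s" by real_asymp
  moreover have "2 * s < s + 1 / 2" using s by simp
  ultimately have "\<forall>\<^sub>F n in sequentially. 2 * s * real n / (real n - 1) < s + 1 / 2"
    by (rule order_tendstoD(2))
  then show ?thesis using eventually_ge_at_top[of "2::nat"]
  proof eventually_elim
    case (elim n)
    have "2 * real (scaled s n) / (real n - 1) \<le> 2 * s * real n / (real n - 1)"
      using scaled_bounds(1)[OF s(1), of n] elim by (intro divide_right_mono) auto
    then show ?case using elim by simp
  qed
qed

text \<open>Below the critical parameter the word is reduced up to a bounded expected error.\<close>

lemma mean_plen_lim_subcritical:
  assumes s: "0 \<le> s" "s < 1 / 2"
  shows "(\<lambda>n. mean_plen n (scaled s n) / real n) \<longlonglongrightarrow> s"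
proof (rule real_tendsto_sandwich)
  let ?C = "2 * lasso_const (s + 1 / 2)"
  show "\<forall>\<^sub>F n in sequentially. real (scaled s n) / real n - ?C / real n \<le> mean_plen n (scaled s n) / real n"
    using subcritical_eventually[OF s]
  proof eventually_elim
    case (elim n)
    then show ?case using mean_plen_ge[of n "scaled s n" "s + 1 / 2"] s
      by (simp add: diff_divide_distrib[symmetric] divide_right_mono)
  qed
  show "\<forall>\<^sub>F n in sequentially. mean_plen n (scaled s n) / real n \<le> real (scaled s n) / real n"
    using eventually_ge_at_top[of "2::nat"]
  proof eventually_elim
    case (elim n)
    then show ?case using mean_plen_le[of n "scaled s n"] by (simp add: divide_right_mono)
  qed
  have "(\<lambda>n. ?C / real n) \<longlonglongrightarrow> 0" by real_asymp
  from tendsto_diff[OF scaled_lim[OF s(1)] this]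
  show "(\<lambda>n. real (scaled s n) / real n - ?C / real n) \<longlonglongrightarrow> s" by simp
  show "(\<lambda>n. real (scaled s n) / real n) \<longlonglongrightarrow> s" by (rule scaled_lim[OF s(1)])
qed

text \<open>The sizes of the cycles add up to \<open>n\<close>.\<close>

lemma card_large_cycles:
  assumes w: "w permutes {1..n}" and K: "K > 0"
  shows "real (card {A \<in> cycles {1..n} w. K < card A}) \<le> real n / real K"
proof -
  let ?L = "{A \<in> cycles {1..n} w. K < card A}"
  have "K * card ?L = (\<Sum>A\<in>?L. K)" by simp
  also have "\<dots> \<le> (\<Sum>A\<in>?L. card A)" by (intro sum_mono) auto
  also have "\<dots> \<le> (\<Sum>A\<in>cycles {1..n} w. card A)"
    using finite_cycles[of "{1..n}"] by (intro sum_mono2) auto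
  also have "\<dots> = n" using sum_card_cycles[OF _ w] by simp
  finally have "real K * real (card ?L) \<le> real n" by (metis of_nat_le_iff of_nat_mult)
  then show ?thesis using K by (simp add: field_simps)
qed

lemma card_cycles_decompose:
  assumes ts: "set ts \<subseteq> transpositions n" and K: "K > 0"
  defines "T \<equiv> \<Sum>k<K. card (tidy_cycles n (Suc k) ts)"
  shows "T \<le> card (cycles {1..n} (wprod ts))"
    "real (card (cycles {1..n} (wprod ts))) \<le> real T + real (card (untidy n K ts)) + real n / real K"
proof -
  let ?c = "cycles {1..n} (wprod ts)"
  have w: "wprod ts permutes {1..n}" by (rule wprod_permutes[OF ts])
  have fin: "finite ?c" by (rule finite_cycles) simp
  have pos: "card A > 0" "finite A" if "A \<in> ?c" for A
  proof -
    show "finite A" using cycles_subset[OF w that] by (rule finite_subset) simp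
    then show "card A > 0" using cycles_nonempty[OF that] by (simp add: card_gt_0_iff)
  qed
  have finT: "finite (tidy_cycles n k ts)" for k using fin by (simp add: tidy_cycles_def)
  have T: "T = card (\<Union>k<K. tidy_cycles n (Suc k) ts)"
    unfolding T_def using finT by (intro card_UN_disjoint[symmetric]) (auto simp: tidy_cycles_def)
  have "(\<Union>k<K. tidy_cycles n (Suc k) ts) \<subseteq> ?c" by (auto simp: tidy_cycles_def)
  then show "T \<le> card ?c" unfolding T using fin by (intro card_mono)
  have "?c \<subseteq> (\<Union>k<K. tidy_cycles n (Suc k) ts) \<union> (untidy n K ts \<union> {A \<in> ?c. K < card A})"
  proof
    fix A assume A: "A \<in> ?c"
    obtain k where k: "card A = Suc k" using pos(1)[OF A] gr0_conv_Suc by blast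
    show "A \<in> (\<Union>k<K. tidy_cycles n (Suc k) ts) \<union> (untidy n K ts \<union> {A \<in> ?c. K < card A})"
      using A k unfolding tidy_cycles_def untidy_def by (cases "tidy ts A"; cases "k < K") auto
  qed
  then have "card ?c \<le> card ((\<Union>k<K. tidy_cycles n (Suc k) ts) \<union> (untidy n K ts \<union> {A \<in> ?c. K < card A}))"
    using fin finT finite_untidy by (intro card_mono) auto
  also have "\<dots> \<le> T + (card (untidy n K ts) + card {A \<in> ?c. K < card A})"
    unfolding T by (intro order_trans[OF card_Un_le] add_left_mono card_Un_le)
  finally have "real (card ?c) \<le> real T + real (card (untidy n K ts)) + real (card {A \<in> ?c. K < card A})"
    by linarith
  then show "real (card ?c) \<le> real T + real (card (untidy n K ts)) + real n / real K"
    using card_large_cycles[OF w K] by linarith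
qed

definition mean_cycles :: "nat \<Rightarrow> nat \<Rightarrow> real" where
  "mean_cycles n N = wavg n N (\<lambda>ts. real (card (cycles {1..n} (wprod ts))))"

definition mean_tidy :: "nat \<Rightarrow> nat \<Rightarrow> nat \<Rightarrow> real" where
  "mean_tidy n k N = wavg n N (\<lambda>ts. real (card (tidy_cycles n (Suc k) ts)))"

lemma mean_cycles_eq: "n \<ge> 2 \<Longrightarrow> mean_cycles n N = real n - mean_plen n N"
proof -
  assume n: "n \<ge> 2"
  have "mean_plen n N = wavg n N (\<lambda>ts. real n - real (card (cycles {1..n} (wprod ts))))"
    unfolding mean_plen_def plen_def using card_cycles_le[of "{1..n}"]
    by (intro wavg_cong) (simp add: of_nat_diff)
  also have "\<dots> = real n - mean_cycles n N"
    unfolding wavg_diff wavg_const[OF n] mean_cycles_def ..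
  finally show ?thesis by simp
qed

lemma mean_cycles_tidy:
  assumes n: "n \<ge> 2" and K: "K > 0"
  shows "\<bar>mean_cycles n N - (\<Sum>k<K. mean_tidy n k N)\<bar> \<le> 4 * real N * real K / (real n - 1) + real n / real K"
proof -
  have T: "(\<Sum>k<K. mean_tidy n k N) = wavg n N (\<lambda>ts. \<Sum>k<K. real (card (tidy_cycles n (Suc k) ts)))"
    unfolding mean_tidy_def wavg_sum ..
  have "(\<Sum>k<K. mean_tidy n k N) \<le> mean_cycles n N"
    unfolding T mean_cycles_def
  proof (rule wavg_mono)
    fix ts assume "ts \<in> words n N"
    then have "set ts \<subseteq> transpositions n" by (simp add: words_def)
    from of_nat_mono[OF card_cycles_decompose(1)[OF this K], where 'a = real]
    show "(\<Sum>k<K. real (card (tidy_cycles n (Suc k) ts))) \<le> real (card (cycles {1..n} (wprod ts)))" by simp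
  qed
  moreover have "mean_cycles n N \<le> wavg n N (\<lambda>ts. (\<Sum>k<K. real (card (tidy_cycles n (Suc k) ts)))
      + real (card (untidy n K ts)) + real n / real K)"
    unfolding mean_cycles_def
  proof (rule wavg_mono)
    fix ts assume "ts \<in> words n N"
    then have "set ts \<subseteq> transpositions n" by (simp add: words_def)
    from card_cycles_decompose(2)[OF this K]
    show "real (card (cycles {1..n} (wprod ts))) \<le> (\<Sum>k<K. real (card (tidy_cycles n (Suc k) ts)))
      + real (card (untidy n K ts)) + real n / real K" by simp
  qed
  then have "mean_cycles n N \<le> (\<Sum>k<K. mean_tidy n k N) + wavg n N (\<lambda>ts. real (card (untidy n K ts))) + real n / real K"
    unfolding T wavg_add wavg_const[OF n] .
  ultimately show ?thesis using wavg_untidy[OF n, of N K] by linarith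
qed

lemma mean_tidy_bounds:
  assumes n: "n \<ge> 2"
  shows "0 \<le> mean_tidy n k N" "mean_tidy n k N \<le> real n"
proof -
  show "0 \<le> mean_tidy n k N" unfolding mean_tidy_def by (intro wavg_nonneg) simp
  have "card (tidy_cycles n (Suc k) ts) \<le> n" for ts
  proof -
    have "card (tidy_cycles n (Suc k) ts) \<le> card (cycles {1..n} (wprod ts))"
      unfolding tidy_cycles_def using finite_cycles[of "{1..n}"] by (intro card_mono) auto
    also have "\<dots> \<le> n" using card_cycles_le[of "{1..n}"] by simp
    finally show ?thesis .
  qed
  then show "mean_tidy n k N \<le> real n" unfolding mean_tidy_def by (intro wavg_le_const[OF n]) simp
qed

lemma binomial_scaled_lim:
  assumes s: "0 \<le> s"
  shows "(\<lambda>n. real (scaled s n choose k) / real n ^ k) \<longlonglongrightarrow> s ^ k / fact k"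
proof (induction k)
  case 0
  show ?case by simp
next
  case (Suc k)
  have rec: "real (N choose Suc k) = real (N choose k) * (real N - real k) / real (Suc k)" for N
  proof (cases "k \<le> N")
    case True
    have "real (Suc k * (N choose Suc k)) = real ((N - k) * (N choose k))"
      by (metis binomial_absorb_comp binomial_absorption mult.commute times_binomial_minus1_eq)
    then show ?thesis using True by (simp add: of_nat_diff field_simps)
  qed (simp add: binomial_eq_0)
  have "(\<lambda>n. real k / real n) \<longlonglongrightarrow> 0" by real_asymp
  from tendsto_diff[OF scaled_lim[OF s] this]
  have "(\<lambda>n. real (scaled s n) / real n - real k / real n) \<longlonglongrightarrow> s" by simp
  from tendsto_divide[OF tendsto_mult[OF Suc.IH this] tendsto_const[of "real (Suc k)"]]
  have "(\<lambda>n. real (scaled s n choose k) / real n ^ k * (real (scaled s n) / real n - real k / real n) / real (Suc k))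
      \<longlonglongrightarrow> s ^ k / fact k * s / real (Suc k)" by simp
  moreover have "s ^ k / fact k * s / real (Suc k) = s ^ Suc k / fact (Suc k)" by (simp add: field_simps)
  moreover have "\<forall>\<^sub>F n in sequentially. real (scaled s n choose k) / real n ^ k * (real (scaled s n) / real n - real k / real n) / real (Suc k)
      = real (scaled s n choose Suc k) / real n ^ Suc k"
    using eventually_gt_at_top[of "0::nat"]
    by eventually_elim (simp add: rec field_simps)
  ultimately show ?case using Lim_transform_eventually by fastforce
qed

text \<open>A letter avoids a given set of \<open>k + 1\<close> points with probability about \<open>1 - 2 * (k + 1) / n\<close>, and the
  exponent is about \<open>(s - s') * n\<close>.\<close>

lemma choose_2_ratio_power_lim:
  assumes s: "0 < s'" "s' < s"
  shows "(\<lambda>n. (real ((n - Suc k) choose 2) / real (card (transpositions n))) ^ (scaled s n - scaled s' n))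
    \<longlonglongrightarrow> exp (- 2 * real (Suc k) * (s - s'))"
proof -
  define q where "q = (\<lambda>n::nat. (real n - real (Suc k)) * (real n - real (Suc k) - 1) / (real n * (real n - 1)))"
  have q: "(\<lambda>n. real n * ln (q n)) \<longlonglongrightarrow> - 2 * real (Suc k)"
    unfolding q_def by real_asymp
  have "(\<lambda>n. real (scaled s n) / real n - real (scaled s' n) / real n) \<longlonglongrightarrow> s - s'"
    using s by (intro tendsto_diff scaled_lim) auto
  from tendsto_exp[OF tendsto_mult[OF q this]]
  have lim: "(\<lambda>n. exp (real n * ln (q n) * (real (scaled s n) / real n - real (scaled s' n) / real n)))
      \<longlonglongrightarrow> exp (- 2 * real (Suc k) * (s - s'))" .
  have "\<forall>\<^sub>F n in sequentially. exp (real n * ln (q n) * (real (scaled s n) / real n - real (scaled s' n) / real n))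
      = (real ((n - Suc k) choose 2) / real (card (transpositions n))) ^ (scaled s n - scaled s' n)"
    using eventually_gt_at_top[of "k + 3"]
  proof eventually_elim
    case (elim n)
    have le: "scaled s' n \<le> scaled s n"
      unfolding scaled_def using s by (intro nat_mono floor_mono mult_right_mono) auto
    have c: "real (m choose 2) = real m * (real m - 1) / 2" for m
      by (cases m) (auto simp: choose_two real_of_nat_div algebra_simps)
    have qn: "real ((n - Suc k) choose 2) / real (card (transpositions n)) = q n"
      using elim by (simp add: c card_transpositions q_def of_nat_diff)
    have "q n > 0" using elim unfolding q_def by (intro divide_pos_pos mult_pos_pos) auto
    then have "q n ^ (scaled s n - scaled s' n) = exp (real (scaled s n - scaled s' n) * ln (q n))"
      by (simp add: exp_of_nat_mult)
    also have "real (scaled s n - scaled s' n) * ln (q n)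
        = real n * ln (q n) * (real (scaled s n) / real n - real (scaled s' n) / real n)"
      using elim le by (simp add: of_nat_diff field_simps)
    finally show ?case using qn by simp
  qed
  with lim show ?thesis by (rule Lim_transform_eventually)
qed

text \<open>The factor by which the expected number of tidy cycles of size \<open>k + 1\<close> changes between the two
  lengths tends to \<open>(s / s')^k * exp (- 2 * (k + 1) * (s - s'))\<close>. By duality
  \<open>s / s' = exp (2 * (s - s'))\<close>, and the dependence on \<open>k\<close> cancels.\<close>

lemma tidy_ratio_lim:
  assumes s: "0 < s'" "s' < s" and dual: "s * exp (- 2 * s) = s' * exp (- 2 * s')"
  shows "(\<lambda>n. real (scaled s n choose k) / real (scaled s' n choose k)
      * (real ((n - Suc k) choose 2) / real (card (transpositions n))) ^ (scaled s n - scaled s' n))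
    \<longlonglongrightarrow> s' / s"
proof -
  have 1: "(\<lambda>n. real (scaled s n choose k) / real n ^ k / (real (scaled s' n choose k) / real n ^ k))
      \<longlonglongrightarrow> s ^ k / fact k / (s' ^ k / fact k)"
    using s by (intro tendsto_divide binomial_scaled_lim) auto
  have "\<forall>\<^sub>F n in sequentially. real (scaled s n choose k) / real n ^ k / (real (scaled s' n choose k) / real n ^ k)
      = real (scaled s n choose k) / real (scaled s' n choose k)"
    using eventually_gt_at_top[of "0::nat"] by eventually_elim simp
  from Lim_transform_eventually[OF 1 this]
  have "(\<lambda>n. real (scaled s n choose k) / real (scaled s' n choose k)) \<longlonglongrightarrow> (s / s') ^ k"
    by (simp add: power_divide)
  from tendsto_mult[OF this choose_2_ratio_power_lim[OF s, of k]]
  have "(\<lambda>n. real (scaled s n choose k) / real (scaled s' n choose k)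
      * (real ((n - Suc k) choose 2) / real (card (transpositions n))) ^ (scaled s n - scaled s' n))
    \<longlonglongrightarrow> (s / s') ^ k * exp (- 2 * real (Suc k) * (s - s'))" .
  also have "(s / s') ^ k * exp (- 2 * real (Suc k) * (s - s')) = s' / s"
  proof -
    have e: "s / s' = exp (2 * (s - s'))"
    proof -
      have "s / s' = exp (- 2 * s') / exp (- 2 * s)" using dual s by (simp add: field_simps)
      also have "\<dots> = exp (2 * (s - s'))" by (simp flip: exp_diff add: algebra_simps)
      finally show ?thesis .
    qed
    have "(s / s') ^ k * exp (- 2 * real (Suc k) * (s - s')) = exp (real k * (2 * (s - s')) + - 2 * real (Suc k) * (s - s'))"
      unfolding e by (simp only: exp_of_nat_mult[symmetric] exp_add[symmetric])
    also have "\<dots> = exp (- (2 * (s - s')))" by (simp add: algebra_simps)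
    also have "\<dots> = 1 / (s / s')" unfolding e exp_minus by (simp add: divide_inverse)
    finally show ?thesis by simp
  qed
  finally show ?thesis .
qed

text \<open>Up to \<open>O(n / K)\<close>, the mean numbers of cycles at \<open>scaled s n\<close> and \<open>scaled s' n\<close> are sums over
  \<open>k < K\<close> of mean numbers of tidy cycles, and all terms have the same limiting ratio \<open>s' / s\<close>. At
  \<open>scaled s' n\<close> the number of cycles is \<open>(1 - s') n\<close> to first order.\<close>

lemma mean_plen_lim_supercritical:
  assumes s: "0 < s'" "s' < 1 / 2" "1 / 2 < s" and dual: "s * exp (- 2 * s) = s' * exp (- 2 * s')"
  shows "(\<lambda>n. mean_plen n (scaled s n) / real n) \<longlonglongrightarrow> 1 - (s' / s) * (1 - s')"
proof -
  let ?N = "scaled s" and ?M = "scaled s'"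
  define r where "r = s' / s"
  have r: "0 \<le> r" "r \<le> 1" using s by (auto simp: r_def)
  define D where "D = (\<lambda>n. mean_cycles n (?N n) / real n - r * (mean_cycles n (?M n) / real n))"
  define q where "q = (\<lambda>k n. real (?N n choose k) / real (?M n choose k)
      * (real ((n - Suc k) choose 2) / real (card (transpositions n))) ^ (?N n - ?M n))"
  have qlim: "(\<lambda>n. q k n) \<longlonglongrightarrow> r" for k
    unfolding q_def r_def using s dual by (intro tidy_ratio_lim) auto
  have bound: "\<forall>\<^sub>F n in sequentially. \<bar>D n\<bar> \<le> 4 / real K" if K: "K > 0" for K
  proof -
    have M: "\<forall>\<^sub>F n in sequentially. K < ?M n"
    proof -
      have "\<forall>\<^sub>F n in sequentially. real K + 1 < s' * real n"
        using s(1) by real_asymp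
      then show ?thesis
      proof eventually_elim
        case (elim n)
        have "real K < real (?M n)" using scaled_bounds(2)[of s' n] s elim by linarith
        then show ?case by simp
      qed
    qed
    have "(\<lambda>n. \<Sum>k<K. \<bar>q k n - r\<bar>) \<longlonglongrightarrow> (\<Sum>k<K. \<bar>r - r\<bar>)"
      by (intro tendsto_sum tendsto_rabs tendsto_diff qlim tendsto_const)
    then have "(\<lambda>n. \<Sum>k<K. \<bar>q k n - r\<bar>) \<longlonglongrightarrow> 0" by simp
    then have Q: "\<forall>\<^sub>F n in sequentially. (\<Sum>k<K. \<bar>q k n - r\<bar>) < 1 / real K"
      using K by (intro order_tendstoD(2)) auto
    have "(\<lambda>n. (4 * s * real n * real K / (real n - 1) + 4 * s' * real n * real K / (real n - 1)) / real n) \<longlonglongrightarrow> 0"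
      by real_asymp
    then have U: "\<forall>\<^sub>F n in sequentially. (4 * s * real n * real K / (real n - 1) + 4 * s' * real n * real K / (real n - 1)) / real n < 1 / real K"
      using K by (intro order_tendstoD(2)) auto
    show ?thesis using M Q U eventually_ge_at_top[of "2::nat"]
    proof eventually_elim
      case (elim n)
      have n: "n \<ge> 2" "real n > 0" using elim by auto
      have NM: "?M n \<le> ?N n"
        unfolding scaled_def using s by (intro nat_mono floor_mono mult_right_mono) auto
      have tid: "mean_tidy n k (?N n) = mean_tidy n k (?M n) * q k n" if "k < K" for k
        unfolding mean_tidy_def q_def using that elim(1) NM
        by (subst wavg_tidy_cycles_ratio[OF n(1) _ NM]) (auto simp: mult.assoc)
      let ?TN = "\<Sum>k<K. mean_tidy n k (?N n)" and ?TM = "\<Sum>k<K. mean_tidy n k (?M n)"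
      have "\<bar>?TN - r * ?TM\<bar> = \<bar>\<Sum>k<K. mean_tidy n k (?M n) * (q k n - r)\<bar>"
        by (simp add: tid sum_distrib_left sum_subtractf algebra_simps)
      also have "\<dots> \<le> (\<Sum>k<K. \<bar>mean_tidy n k (?M n) * (q k n - r)\<bar>)" by (rule sum_abs)
      also have "\<dots> \<le> (\<Sum>k<K. real n * \<bar>q k n - r\<bar>)"
        using mean_tidy_bounds[OF n(1)] by (intro sum_mono) (simp add: abs_mult mult_right_mono)
      also have "\<dots> \<le> real n / real K"
        using mult_left_mono[OF less_imp_le[OF elim(2)], of "real n"]
        by (simp add: sum_distrib_left[symmetric])
      finally have a: "\<bar>?TN - r * ?TM\<bar> \<le> real n / real K" .
      have b: "\<bar>mean_cycles n (?N n) - ?TN\<bar> \<le> 4 * real (?N n) * real K / (real n - 1) + real n / real K"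
        by (rule mean_cycles_tidy[OF n(1) K])
      have "\<bar>mean_cycles n (?M n) - ?TM\<bar> \<le> 4 * real (?M n) * real K / (real n - 1) + real n / real K"
        by (rule mean_cycles_tidy[OF n(1) K])
      then have c: "\<bar>r * mean_cycles n (?M n) - r * ?TM\<bar> \<le> 4 * real (?M n) * real K / (real n - 1) + real n / real K"
        using r mult_left_le_one_le[of "\<bar>mean_cycles n (?M n) - ?TM\<bar>" r]
        by (simp add: right_diff_distrib[symmetric] abs_mult)
      have e: "4 * real (?N n) * real K / (real n - 1) \<le> 4 * s * real n * real K / (real n - 1)"
        "4 * real (?M n) * real K / (real n - 1) \<le> 4 * s' * real n * real K / (real n - 1)"
        using scaled_bounds(1)[of s n] scaled_bounds(1)[of s' n] s n
        by (intro divide_right_mono mult_right_mono; simp)+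
      have f: "4 * s * real n * real K / (real n - 1) + 4 * s' * real n * real K / (real n - 1) \<le> real n / real K"
      proof -
        have aux: "x \<le> real n / real K" if "x / real n < 1 / real K" for x
          using that n by (simp add: divide_less_eq)
        show ?thesis by (rule aux[OF elim(3)])
      qed
      have "\<bar>mean_cycles n (?N n) - r * mean_cycles n (?M n)\<bar> \<le> 4 * (real n / real K)"
        using a b c e f by linarith
      then have "\<bar>mean_cycles n (?N n) - r * mean_cycles n (?M n)\<bar> / real n \<le> 4 / real K"
        using n by (simp add: field_simps)
      moreover have "\<bar>D n\<bar> = \<bar>mean_cycles n (?N n) - r * mean_cycles n (?M n)\<bar> / real n"
      proof -
        have "D n = (mean_cycles n (?N n) - r * mean_cycles n (?M n)) / real n"
          by (simp add: D_def diff_divide_distrib)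
        then show ?thesis by (simp add: abs_divide)
      qed
      ultimately show ?case by simp
    qed
  qed
  have D0: "D \<longlonglongrightarrow> 0"
  proof (rule LIMSEQ_I)
    fix e :: real assume e: "e > 0"
    obtain K where K: "K > 0" "4 / real K < e"
    proof -
      obtain K where "real K > 4 / e" using reals_Archimedean2 by blast
      moreover have "4 / e > 0" using e by simp
      ultimately have "K > 0" by (metis of_nat_0_less_iff order.strict_trans)
      then show thesis using that[of K] e \<open>real K > 4 / e\<close> by (simp add: field_simps)
    qed
    from bound[OF K(1)] obtain n0 where "\<forall>n\<ge>n0. \<bar>D n\<bar> \<le> 4 / real K"
      by (auto simp: eventually_sequentially)
    then show "\<exists>no. \<forall>n\<ge>no. norm (D n - 0) < e" using K(2) by force
  qed
  have M: "(\<lambda>n. mean_plen n (?M n) / real n) \<longlonglongrightarrow> s'"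
    using s by (intro mean_plen_lim_subcritical) auto
  have "(\<lambda>n. 1 - (D n + r * (1 - mean_plen n (?M n) / real n))) \<longlonglongrightarrow> 1 - (0 + r * (1 - s'))"
    by (intro tendsto_diff tendsto_add tendsto_mult tendsto_const D0 M)
  moreover have "\<forall>\<^sub>F n in sequentially. 1 - (D n + r * (1 - mean_plen n (?M n) / real n)) = mean_plen n (?N n) / real n"
    using eventually_ge_at_top[of "2::nat"]
  proof eventually_elim
    case (elim n)
    then show ?case unfolding D_def mean_cycles_eq[OF elim] by (simp add: field_simps)
  qed
  ultimately show ?thesis unfolding r_def using Lim_transform_eventually by fastforce
qed

section \<open>The limit profile\<close>

abbreviation dual_fun :: "real \<Rightarrow> real" where
  "dual_fun x \<equiv> x * exp (- 2 * x)"

lemma dual_fun_deriv: "(dual_fun has_real_derivative (1 - 2 * x) * exp (- 2 * x)) (at x)"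
  by (auto intro!: derivative_eq_intros simp: algebra_simps)

lemma dual_fun_increasing:
  assumes "0 \<le> x" "x < y" "y \<le> 1 / 2"
  shows "dual_fun x < dual_fun y"
proof (rule DERIV_pos_imp_increasing_open[OF assms(2)])
  fix z assume z: "x < z" "z < y"
  have "(1 - 2 * z) * exp (- 2 * z) > 0" using z assms by (intro mult_pos_pos) auto
  then show "\<exists>d. (dual_fun has_real_derivative d) (at z) \<and> d > 0" using dual_fun_deriv by blast
qed (intro continuous_intros)

lemma dual_fun_decreasing:
  assumes "1 / 2 \<le> x" "x < y"
  shows "dual_fun y < dual_fun x"
proof (rule DERIV_neg_imp_decreasing_open[OF assms(2)])
  fix z assume z: "x < z" "z < y"
  have "(1 - 2 * z) * exp (- 2 * z) < 0" using z assms by (intro mult_neg_pos) auto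
  then show "\<exists>d. (dual_fun has_real_derivative d) (at z) \<and> d < 0" using dual_fun_deriv by blast
qed (intro continuous_intros)

lemma dual_exists:
  assumes "s > 1 / 2"
  shows "\<exists>s'. 0 < s' \<and> s' < 1 / 2 \<and> dual_fun s' = dual_fun s"
proof -
  have "dual_fun s > 0" using assms by (intro mult_pos_pos) auto
  moreover have "dual_fun s < dual_fun (1 / 2)" using dual_fun_decreasing[of "1 / 2" s] assms by simp
  moreover have "continuous_on {0..1 / 2} dual_fun" by (intro continuous_intros)
  ultimately obtain x where x: "0 \<le> x" "x \<le> 1 / 2" "dual_fun x = dual_fun s"
    using IVT'[of dual_fun 0 "dual_fun s" "1 / 2"] by auto
  have "x \<noteq> 0" using x(3) \<open>dual_fun s > 0\<close> by auto
  moreover have "x \<noteq> 1 / 2"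
  proof
    assume "x = 1 / 2"
    then have "dual_fun (1 / 2) = dual_fun s" using x(3) by (simp only:)
    then show False using \<open>dual_fun s < dual_fun (1 / 2)\<close> by (simp only: less_irrefl)
  qed
  ultimately show ?thesis using x by (intro exI[of _ x]) auto
qed

text \<open>For \<open>s > 1/2\<close> this is the other solution of \<open>dual_fun x = dual_fun s\<close>; \<open>dual_fun\<close> increases up to
  its maximum at \<open>1/2\<close> and decreases afterwards.\<close>

definition dual :: "real \<Rightarrow> real" where
  "dual s = (SOME s'. 0 < s' \<and> s' < 1 / 2 \<and> dual_fun s' = dual_fun s)"

lemma dual_props:
  assumes "s > 1 / 2"
  shows "0 < dual s" "dual s < 1 / 2" "dual_fun (dual s) = dual_fun s"
  using someI_ex[OF dual_exists[OF assms]] unfolding dual_def by auto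

definition profile :: "real \<Rightarrow> real" where
  "profile s = (if s \<le> 1 / 2 then s else 1 - (dual s / s) * (1 - dual s))"

lemma mean_plen_lipschitz:
  assumes n: "n \<ge> 2" and MN: "M \<le> N"
  shows "\<bar>mean_plen n N - mean_plen n M\<bar> \<le> real (N - M)"
proof -
  have "mean_plen n N = wavg n M (\<lambda>ts. wavg n (N - M) (\<lambda>us. real (plen n (wprod (ts @ us)))))"
    using wavg_append[of n M "N - M"] MN by (simp add: mean_plen_def)
  then have "mean_plen n N - mean_plen n M
      = wavg n M (\<lambda>ts. wavg n (N - M) (\<lambda>us. real (plen n (wprod (ts @ us)))) - real (plen n (wprod ts)))"
    unfolding mean_plen_def[of n M] wavg_diff by simp
  also have "\<dots> = wavg n M (\<lambda>ts. wavg n (N - M) (\<lambda>us. real (plen n (wprod (ts @ us))) - real (plen n (wprod ts))))"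
    unfolding wavg_diff wavg_const[OF n] ..
  finally have eq: "mean_plen n N - mean_plen n M
      = wavg n M (\<lambda>ts. wavg n (N - M) (\<lambda>us. real (plen n (wprod (ts @ us))) - real (plen n (wprod ts))))" .
  have "\<bar>real (plen n (wprod (ts @ us))) - real (plen n (wprod ts))\<bar> \<le> real (N - M)"
    if t: "ts \<in> words n M" "us \<in> words n (N - M)" for ts us
    using plen_wprod_sandwich[of "[]" ts us n] t by (simp add: words_def)
  then have "wavg n M (\<lambda>ts. wavg n (N - M) (\<lambda>us. \<bar>real (plen n (wprod (ts @ us))) - real (plen n (wprod ts))\<bar>)) \<le> real (N - M)"
    by (intro wavg_le_const[OF n]) auto
  moreover have "\<bar>mean_plen n N - mean_plen n M\<bar>
      \<le> wavg n M (\<lambda>ts. wavg n (N - M) (\<lambda>us. \<bar>real (plen n (wprod (ts @ us))) - real (plen n (wprod ts))\<bar>))"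
    unfolding eq by (rule order_trans[OF wavg_abs wavg_mono[OF wavg_abs]])
  ultimately show ?thesis by linarith
qed

text \<open>At the critical parameter \<open>1/2\<close> the limit follows from the values below it, because the
  length changes by at most one per letter.\<close>

lemma mean_plen_lim_critical: "(\<lambda>n. mean_plen n (scaled (1 / 2) n) / real n) \<longlonglongrightarrow> 1 / 2"
proof (rule LIMSEQ_I)
  fix e :: real assume e: "e > 0"
  define s where "s = max 0 (1 / 2 - e / 4)"
  have s: "0 \<le> s" "s < 1 / 2" "1 / 2 - s \<le> e / 4" using e by (simp_all add: s_def max_def)
  have L: "(\<lambda>n. mean_plen n (scaled s n) / real n - 1 / real n) \<longlonglongrightarrow> s - 0"
    by (intro tendsto_diff mean_plen_lim_subcritical s) real_asymp
  have "s - e / 4 < s - 0" using e by simp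
  from order_tendstoD(1)[OF L this]
  have "\<forall>\<^sub>F n in sequentially. s - e / 4 < mean_plen n (scaled s n) / real n - 1 / real n" .
  then have "\<forall>\<^sub>F n in sequentially. \<bar>mean_plen n (scaled (1 / 2) n) / real n - 1 / 2\<bar> < e"
    using eventually_ge_at_top[of "2::nat"]
  proof eventually_elim
    case (elim n)
    let ?M = "scaled s n" and ?N = "scaled (1 / 2) n"
    have MN: "?M \<le> ?N"
      unfolding scaled_def using s by (intro nat_mono floor_mono mult_right_mono) auto
    have N: "real ?N \<le> 1 / 2 * real n" by (rule scaled_bounds(1)) simp
    have M: "s * real n - 1 \<le> real ?M" by (rule scaled_bounds(2)[OF s(1)])
    have up: "mean_plen n ?N / real n \<le> 1 / 2"
      using mean_plen_le[OF elim(2), of ?N] N elim by (simp add: field_simps)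
    have "mean_plen n ?M - mean_plen n ?N \<le> 1 / 2 * real n - (s * real n - 1)"
      using mean_plen_lipschitz[OF elim(2) MN] MN N M by (simp add: of_nat_diff)
    then have "(mean_plen n ?M - mean_plen n ?N) / real n \<le> (1 / 2 * real n - (s * real n - 1)) / real n"
      by (intro divide_right_mono) auto
    also have "\<dots> = 1 / 2 - s + 1 / real n" using elim by (simp add: field_simps)
    finally have "mean_plen n ?M / real n - mean_plen n ?N / real n \<le> 1 / 2 - s + 1 / real n"
      by (simp add: diff_divide_distrib)
    then show ?case using elim(1) up s(3) e by linarith
  qed
  then show "\<exists>no. \<forall>n\<ge>no. norm (mean_plen n (scaled (1 / 2) n) / real n - 1 / 2) < e"
    by (auto simp: eventually_sequentially)
qed

lemma profile_lim:
  assumes "0 \<le> s"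
  shows "(\<lambda>n. mean_plen n (scaled s n) / real n) \<longlonglongrightarrow> profile s"
proof -
  consider "s < 1 / 2" | "s = 1 / 2" | "s > 1 / 2" by linarith
  then show ?thesis
  proof cases
    case 1
    then show ?thesis using mean_plen_lim_subcritical[of s] assms by (simp add: profile_def)
  next
    case 2
    have "profile (1 / 2) = 1 / 2" by (simp add: profile_def)
    then show ?thesis unfolding 2 using mean_plen_lim_critical by (simp only:)
  next
    case s: 3
    then show ?thesis
      using mean_plen_lim_supercritical[OF dual_props(1,2)[OF s] s] dual_props(3)[OF s] s
      by (simp add: profile_def)
  qed
qed

lemma dual_decreasing:
  assumes "1 / 2 < s" "s < t"
  shows "dual t < dual s"
proof (rule ccontr)
  assume "\<not> dual t < dual s"
  then have "dual s \<le> dual t" by simp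
  then have "dual_fun (dual s) \<le> dual_fun (dual t)"
    using dual_fun_increasing[of "dual s" "dual t"] dual_props[of s] dual_props[of t] assms
    by (cases "dual s = dual t") auto
  then show False using dual_fun_decreasing[of s t] assms dual_props(3)[of s] dual_props(3)[of t] by auto
qed

lemma logistic_increasing:
  fixes x y :: real
  assumes "0 < x" "x < y" "y \<le> 1 / 2"
  shows "x * (1 - x) < y * (1 - y)"
proof -
  have "y * (1 - y) - x * (1 - x) = (y - x) * (1 - x - y)" by (simp add: algebra_simps)
  moreover have "(y - x) * (1 - x - y) > 0" using assms by (intro mult_pos_pos) auto
  ultimately show ?thesis by simp
qed

text \<open>As \<open>s\<close> grows its dual decreases, and with it the numerator of
  \<open>1 - profile s = dual s * (1 - dual s) / s\<close>.\<close>

lemma profile_increasing: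
  assumes "1 / 2 < s" "s < t"
  shows "profile s < profile t"
proof -
  have "dual t * (1 - dual t) < dual s * (1 - dual s)"
    using logistic_increasing dual_decreasing[OF assms] dual_props[of t] dual_props[of s] assms by simp
  moreover have "0 < dual t * (1 - dual t)"
    using dual_props[of t] assms by (intro mult_pos_pos) auto
  ultimately have "dual t * (1 - dual t) / t < dual s * (1 - dual s) / s"
    using assms by (intro frac_less2) (auto intro: less_imp_le)
  then show ?thesis using assms by (simp add: profile_def)
qed

lemma profile_bounds:
  assumes "1 / 2 < s"
  shows "1 - 1 / (4 * s) < profile s" "profile s < 1"
proof -
  have "dual s * (1 - dual s) < 1 / 2 * (1 - 1 / 2)"
    using logistic_increasing[of "dual s" "1 / 2"] dual_props(1,2)[OF assms] by simp
  then have "dual s * (1 - dual s) / s < 1 / 4 / s" using assms by (intro divide_strict_right_mono) auto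
  then show "1 - 1 / (4 * s) < profile s" using assms by (simp add: profile_def)
  have "0 < dual s / s * (1 - dual s)" using dual_props[OF assms] assms by (intro mult_pos_pos) auto
  then show "profile s < 1" using assms by (simp add: profile_def)
qed

text \<open>The dual pair is not symmetric about \<open>1/2\<close>: for \<open>(1 + h) / 2\<close> and \<open>(1 - h) / 2\<close> the duality would
  read \<open>ln (1 + h) - ln (1 - h) = 2 * h\<close>, which holds only for \<open>h = 0\<close>.\<close>

lemma artanh_gt:
  fixes h :: real
  assumes "0 < h" "h < 1"
  shows "2 * h < ln (1 + h) - ln (1 - h)"
proof -
  let ?g = "\<lambda>x::real. ln (1 + x) - ln (1 - x) - 2 * x"
  have "?g 0 < ?g h"
  proof (rule DERIV_pos_imp_increasing_open[OF assms(1)])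
    fix x assume x: "0 < x" "x < h"
    have "(?g has_real_derivative 1 / (1 + x) + 1 / (1 - x) - 2) (at x)"
      using x assms by (auto intro!: derivative_eq_intros)
    moreover have "1 / (1 + x) + 1 / (1 - x) - 2 = 2 * x ^ 2 / ((1 + x) * (1 - x))"
    proof -
      have nz: "1 + x \<noteq> 0" "1 - x \<noteq> 0" using x assms by auto
      have "1 / (1 + x) + 1 / (1 - x) - 2
          = (1 * (1 - x) + 1 * (1 + x) - 2 * ((1 + x) * (1 - x))) / ((1 + x) * (1 - x))"
      proof -
        have gen: "p / d - 2 = (p - 2 * d) / d" if "d \<noteq> 0" for p d :: real
          using that by (simp add: diff_divide_distrib)
        show ?thesis unfolding add_frac_eq[OF nz] by (rule gen) (use nz in simp)
      qed
      also have "1 * (1 - x) + 1 * (1 + x) - 2 * ((1 + x) * (1 - x)) = 2 * x ^ 2"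
        by (simp add: power2_eq_square algebra_simps)
      finally show ?thesis .
    qed
    moreover have "2 * x ^ 2 / ((1 + x) * (1 - x)) > 0"
      using x assms by (intro divide_pos_pos mult_pos_pos) auto
    ultimately show "\<exists>d. (?g has_real_derivative d) (at x) \<and> d > 0" by metis
  next
    show "continuous_on {0..h} ?g" using assms by (intro continuous_intros) auto
  qed
  then show ?thesis by simp
qed

text \<open>With \<open>h = 2 * s - 1\<close>, \<open>artanh_gt\<close> says that \<open>dual_fun (1 - s) < dual_fun s\<close>. The dual, at which the
  increasing branch takes the value \<open>dual_fun s\<close>, must therefore exceed \<open>1 - s\<close>.\<close>

lemma dual_add_gt_1:
  assumes "1 / 2 < s" "s < 1"
  shows "1 < s + dual s"
proof (rule ccontr)
  assume "\<not> 1 < s + dual s"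
  then have le: "dual s \<le> 1 - s" by simp
  define h where "h = 2 * s - 1"
  have h: "0 < h" "h < 1" using assms by (auto simp: h_def)
  have "2 * h < ln (1 + h) - ln (1 - h)" by (rule artanh_gt[OF h])
  then have "exp (2 * h) < exp (ln (1 + h) - ln (1 - h))" by simp
  also have "\<dots> = (1 + h) / (1 - h)" using h by (simp add: exp_diff)
  also have "\<dots> = s / (1 - s)" using assms by (simp add: h_def field_simps)
  finally have "exp (2 * h) * (1 - s) < s" using assms by (simp add: field_simps)
  then have "exp (2 * h) * (1 - s) * exp (- 2 * s) < s * exp (- 2 * s)" by simp
  moreover have "exp (2 * h) * exp (- 2 * s) = exp (- 2 * (1 - s))"
    by (simp flip: exp_add add: h_def algebra_simps)
  then have "exp (2 * h) * (1 - s) * exp (- 2 * s) = dual_fun (1 - s)"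
    by (metis mult.assoc mult.commute)
  ultimately have "dual_fun (1 - s) < dual_fun s" by (simp only:)
  moreover have "dual_fun (dual s) \<le> dual_fun (1 - s)"
    using dual_fun_increasing[of "dual s" "1 - s"] le dual_props[OF assms(1)] assms
    by (cases "dual s = 1 - s") auto
  ultimately show False using dual_props(3)[OF assms(1)] by simp
qed

text \<open>For \<open>s < 1\<close>, the difference \<open>s - profile s\<close> equals
  \<open>(s - dual s) * (s + dual s - 1) / s\<close>.\<close>

lemma profile_less:
  assumes "1 / 2 < s"
  shows "profile s < s"
proof (cases "s < 1")
  case False
  then show ?thesis using profile_bounds(2)[OF assms] by simp
next
  case True
  have d: "dual s < s" using dual_props[OF assms] assms by simp
  have "dual s * (1 - dual s) - s * (1 - s) = (s - dual s) * (s + dual s - 1)"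
    by (simp add: algebra_simps)
  moreover have "(s - dual s) * (s + dual s - 1) > 0"
    using d dual_add_gt_1[OF assms True] by (intro mult_pos_pos) auto
  ultimately have "s * (1 - s) < dual s * (1 - dual s)" by simp
  then have "1 - s < dual s / s * (1 - dual s)" using assms by (simp add: field_simps)
  then show ?thesis using assms by (simp add: profile_def)
qed

lemma profile_mono:
  assumes "0 \<le> s" "s \<le> t"
  shows "profile s \<le> profile t"
proof (cases "1 / 2 < s \<or> t \<le> 1 / 2")
  case True
  then show ?thesis using profile_increasing[of s t] assms by (cases "s = t") (auto simp: profile_def)
next
  case False
  then have "1 / 2 < 1 - 1 / (4 * t)" by (simp add: field_simps)
  moreover have "1 - 1 / (4 * t) < profile t" using profile_bounds(1)[of t] False by simp
  moreover have "profile s \<le> 1 / 2" using False by (simp add: profile_def)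
  ultimately show ?thesis by linarith
qed

text \<open>At time \<open>c n\<close> the walk reaches distance \<open>a n\<close>. For \<open>a \<le> 1/2\<close> this is \<open>c = a\<close>, and the
  last inequality is strict because \<open>2 * a\<close> lies beyond the critical parameter \<open>1/2\<close>, where the
  profile stays below the diagonal. For \<open>a > 1/2\<close> it holds because the profile is below \<open>1\<close>.\<close>

lemma hitting_level_exists:
  assumes a: "1 / 4 < a" "a < 1"
  shows "\<exists>c>1 / 4. (\<forall>s. 0 \<le> s \<and> s < c \<longrightarrow> profile s < a) \<and> (\<forall>s>c. a < profile s)
    \<and> profile (2 * c) < 2 * a"
proof (cases "a \<le> 1 / 2")
  case True
  show ?thesis
  proof (intro exI[of _ a] conjI allI impI)
    show "profile s < a" if "0 \<le> s \<and> s < a" for s using that True by (simp add: profile_def)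
    show "a < profile s" if s: "a < s" for s
    proof (cases "s \<le> 1 / 2")
      case False
      have "1 / 2 < 1 - 1 / (4 * s)" using False by (simp add: field_simps)
      moreover have "1 - 1 / (4 * s) < profile s" using profile_bounds(1)[of s] False by simp
      ultimately show ?thesis using True by linarith
    qed (use s in \<open>simp add: profile_def\<close>)
    show "profile (2 * a) < 2 * a" using profile_less[of "2 * a"] a by simp
  qed (use a in auto)
next
  case False
  define S where "S = {s. 1 / 2 \<le> s \<and> profile s < a}"
  define c where "c = Sup S"
  have half: "1 / 2 \<in> S" using False by (simp add: S_def profile_def)
  \<comment> \<open>by \<open>profile_bounds\<close> the profile has reached \<open>a\<close> at this point\<close>
  define b where "b = 1 / (4 * (1 - a))"
  have b: "1 / 2 < b" using a False by (simp add: b_def field_simps)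
  have "a \<le> profile b"
    using profile_bounds(1)[OF b] a by (simp add: b_def field_simps)
  have ub: "s \<le> b" if "s \<in> S" for s
  proof (rule ccontr)
    assume "\<not> s \<le> b"
    then have "profile b < profile s" using profile_increasing[OF b] by simp
    then show False using that \<open>a \<le> profile b\<close> by (simp add: S_def)
  qed
  have bdd: "bdd_above S" using ub by (auto simp: bdd_above_def)
  have c: "1 / 2 \<le> c" unfolding c_def by (rule cSup_upper[OF half bdd])
  show ?thesis
  proof (intro exI[of _ c] conjI allI impI)
    show "1 / 4 < c" using c by simp
    show "profile s < a" if s: "0 \<le> s \<and> s < c" for s
    proof (cases "s \<le> 1 / 2")
      case True
      then show ?thesis using False by (simp add: profile_def)
    next
      case False
      obtain s' where "s' \<in> S" "s < s'"
        using s less_cSup_iff[of S s] bdd half unfolding c_def by blast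
      then show ?thesis using profile_increasing[of s s'] False by (simp add: S_def)
    qed
    show "a < profile s" if s: "c < s" for s
    proof -
      let ?m = "(c + s) / 2"
      have m: "c < ?m" "?m < s" "1 / 2 < ?m" using s c by auto
      have "?m \<notin> S" using m cSup_upper[OF _ bdd, of ?m] by (auto simp: c_def)
      then have "a \<le> profile ?m" using m by (simp add: S_def)
      then show ?thesis using profile_increasing[OF m(3,2)] by simp
    qed
    show "profile (2 * c) < 2 * a" using profile_bounds(2)[of "2 * c"] c False by simp
  qed
qed

text \<open>The mean converges to the profile, and the fluctuations are of order \<open>sqrt n\<close> only.\<close>

lemma plen_L1_lim:
  assumes s: "0 \<le> s"
  shows "(\<lambda>n. wavg n (scaled s n) (\<lambda>ts. \<bar>real (plen n (wprod ts)) / real n - profile s\<bar>)) \<longlonglongrightarrow> 0"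
proof -
  let ?u = "\<lambda>n. 2 * sqrt (s * real n) / real n + \<bar>mean_plen n (scaled s n) / real n - profile s\<bar>"
  have up: "\<forall>\<^sub>F n in sequentially. wavg n (scaled s n) (\<lambda>ts. \<bar>real (plen n (wprod ts)) / real n - profile s\<bar>) \<le> ?u n"
    using eventually_ge_at_top[of "2::nat"]
  proof eventually_elim
    case (elim n)
    let ?m = "mean_plen n (scaled s n)"
    have "wavg n (scaled s n) (\<lambda>ts. \<bar>real (plen n (wprod ts)) / real n - profile s\<bar>)
        \<le> wavg n (scaled s n) (\<lambda>ts. (1 / real n) * \<bar>real (plen n (wprod ts)) - ?m\<bar> + \<bar>?m / real n - profile s\<bar>)"
    proof (rule wavg_mono)
      fix ts
      have "real (plen n (wprod ts)) / real n - profile s = (real (plen n (wprod ts)) - ?m) / real n + (?m / real n - profile s)"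
        by (simp add: diff_divide_distrib)
      then have "\<bar>real (plen n (wprod ts)) / real n - profile s\<bar> \<le> \<bar>(real (plen n (wprod ts)) - ?m) / real n\<bar> + \<bar>?m / real n - profile s\<bar>"
        by (simp only: abs_triangle_ineq)
      then show "\<bar>real (plen n (wprod ts)) / real n - profile s\<bar> \<le> (1 / real n) * \<bar>real (plen n (wprod ts)) - ?m\<bar> + \<bar>?m / real n - profile s\<bar>"
        by simp
    qed
    also have "\<dots> = (1 / real n) * wavg n (scaled s n) (\<lambda>ts. \<bar>real (plen n (wprod ts)) - ?m\<bar>) + \<bar>?m / real n - profile s\<bar>"
      unfolding wavg_add wavg_cmult wavg_const[OF elim] ..
    also have "\<dots> \<le> (1 / real n) * (2 * sqrt (s * real n)) + \<bar>?m / real n - profile s\<bar>"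
    proof -
      have "wavg n (scaled s n) (\<lambda>ts. \<bar>real (plen n (wprod ts)) - ?m\<bar>) \<le> 2 * sqrt (real (scaled s n))"
        by (rule plen_concentration[OF elim])
      also have "\<dots> \<le> 2 * sqrt (s * real n)" using scaled_bounds(1)[OF s] by simp
      finally show ?thesis by (intro add_right_mono mult_left_mono) auto
    qed
    finally show ?case by simp
  qed
  have "(\<lambda>n. 2 * sqrt (s * real n) / real n) \<longlonglongrightarrow> 0"
  proof -
    have "(\<lambda>n. 2 * sqrt s * (sqrt (real n) / real n)) \<longlonglongrightarrow> 2 * sqrt s * 0"
      by (intro tendsto_mult tendsto_const) real_asymp
    then show ?thesis by (simp add: real_sqrt_mult mult.assoc)
  qed
  moreover have "(\<lambda>n. \<bar>mean_plen n (scaled s n) / real n - profile s\<bar>) \<longlonglongrightarrow> \<bar>profile s - profile s\<bar>"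
    by (intro tendsto_rabs tendsto_diff profile_lim s tendsto_const)
  ultimately have u: "?u \<longlonglongrightarrow> 0" using tendsto_add by fastforce
  have low: "\<forall>\<^sub>F n in sequentially. 0 \<le> wavg n (scaled s n) (\<lambda>ts. \<bar>real (plen n (wprod ts)) / real n - profile s\<bar>)"
    by (intro always_eventually allI wavg_nonneg) simp
  show ?thesis by (rule real_tendsto_sandwich[OF low up tendsto_const u])
qed

section \<open>The hitting position\<close>

definition hits :: "nat \<Rightarrow> nat \<Rightarrow> (nat \<Rightarrow> nat) list \<Rightarrow> bool" where
  "hits n m ts \<longleftrightarrow> (\<exists>k\<le>length ts. plen n (wprod (take k ts)) = m)"

definition first_hit :: "nat \<Rightarrow> nat \<Rightarrow> (nat \<Rightarrow> nat) list \<Rightarrow> nat" where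
  "first_hit n m ts = (LEAST k. plen n (wprod (take k ts)) = m)"

text \<open>When the word is too short to reach the level, nothing is said about the stopped
  permutation; such words are treated as exceptional.\<close>

definition stopped :: "nat \<Rightarrow> nat \<Rightarrow> (nat \<Rightarrow> nat) list \<Rightarrow> (nat \<Rightarrow> nat) \<Rightarrow> bool" where
  "stopped n m ts x \<longleftrightarrow> x \<in> perms n \<and> (hits n m ts \<longrightarrow> x = wprod (take (first_hit n m ts) ts))"

lemma first_hit_props:
  assumes "hits n m ts"
  shows "plen n (wprod (take (first_hit n m ts) ts)) = m" "first_hit n m ts \<le> length ts"
    "plen n (wprod (take k ts)) = m \<Longrightarrow> first_hit n m ts \<le> k"
proof -
  obtain k0 where k: "k0 \<le> length ts" "plen n (wprod (take k0 ts)) = m"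
    using assms by (auto simp: hits_def)
  show "plen n (wprod (take (first_hit n m ts) ts)) = m"
    unfolding first_hit_def by (rule LeastI[of _ k0]) (rule k(2))
  have le: "first_hit n m ts \<le> k" if "plen n (wprod (take k ts)) = m" for k
    unfolding first_hit_def by (rule Least_le) (rule that)
  show "first_hit n m ts \<le> length ts" using le[OF k(2)] k(1) by simp
  show "plen n (wprod (take k ts)) = m \<Longrightarrow> first_hit n m ts \<le> k" by (rule le)
qed

text \<open>The length changes by one per letter, so it cannot jump over a level.\<close>

lemma not_hits_plen:
  assumes ts: "set ts \<subseteq> transpositions n" and nh: "\<not> hits n m ts"
  shows "plen n (wprod ts) < m"
proof -
  have "plen n (wprod (take k ts)) < m" if "k \<le> length ts" for k
    using that
  proof (induction k)
    case 0
    have "plen n (wprod (take 0 ts)) \<noteq> m" using nh unfolding hits_def by blast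
    then show ?case by (simp del: id_apply)
  next
    case (Suc k)
    have tk: "set (take k ts) \<subseteq> transpositions n" using ts set_take_subset by fastforce
    have t: "ts ! k \<in> transpositions n" using ts Suc.prems by auto
    have "wprod (take (Suc k) ts) = wprod (take k ts) \<circ> ts ! k"
      using Suc.prems by (simp add: take_Suc_conv_app_nth)
    then have "plen n (wprod (take (Suc k) ts)) \<le> Suc (plen n (wprod (take k ts)))"
      using plen_comp_transposition[OF wprod_permutes[OF tk] t] by auto
    moreover have "plen n (wprod (take k ts)) < m" using Suc by simp
    moreover have "plen n (wprod (take (Suc k) ts)) \<noteq> m" using nh Suc.prems unfolding hits_def by blast
    ultimately show ?case by linarith
  qed
  from this[of "length ts"] show ?thesis by simp
qed

lemma take_extend: "i \<le> j \<Longrightarrow> take j ts = take i ts @ drop i (take j ts)"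
  by (metis append_take_drop_id min.absorb1 take_take)

lemma plen_take_diff:
  assumes X: "set X \<subseteq> transpositions n" and Y: "set Y \<subseteq> transpositions n"
  shows "\<bar>real (plen n (wprod (rev (take i X) @ take i' Y))) - real (plen n (wprod (rev (take j X) @ take j' Y)))\<bar>
    \<le> \<bar>real i - real j\<bar> + \<bar>real i' - real j'\<bar>"
proof -
  let ?f = "\<lambda>i i'. real (plen n (wprod (rev (take i X) @ take i' Y)))"
  have sub: "set (take i X) \<subseteq> transpositions n" "set (take i Y) \<subseteq> transpositions n" for i
    using X Y set_take_subset by fastforce+
  have left: "\<bar>?f j i' - ?f i i'\<bar> \<le> real (j - i)" if ij: "i \<le> j" for i j i'
  proof -
    have "rev (take j X) @ take i' Y = rev (drop i (take j X)) @ (rev (take i X) @ take i' Y) @ []"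
      using take_extend[OF ij, of X] by (metis append.assoc append_Nil2 rev_append)
    moreover have "set (rev (drop i (take j X)) @ (rev (take i X) @ take i' Y) @ []) \<subseteq> transpositions n"
      using sub(1)[of j] sub(1)[of i] sub(2)[of i'] set_drop_subset[of i "take j X"] by auto
    ultimately have "\<bar>?f j i' - ?f i i'\<bar> \<le> real (length (rev (drop i (take j X))) + length ([] :: (nat \<Rightarrow> nat) list))"
      using plen_wprod_sandwich by metis
    also have "\<dots> \<le> real (j - i)" by simp
    finally show ?thesis .
  qed
  have right: "\<bar>?f i j' - ?f i i'\<bar> \<le> real (j' - i')" if ij: "i' \<le> j'" for i i' j'
  proof -
    have "rev (take i X) @ take j' Y = [] @ (rev (take i X) @ take i' Y) @ drop i' (take j' Y)"
      using take_extend[OF ij, of Y] by (metis append.assoc append_Nil)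
    moreover have "set ([] @ (rev (take i X) @ take i' Y) @ drop i' (take j' Y)) \<subseteq> transpositions n"
      using sub(1)[of i] sub(2)[of i'] sub(2)[of j'] set_drop_subset[of i' "take j' Y"] by auto
    ultimately have "\<bar>?f i j' - ?f i i'\<bar> \<le> real (length ([] :: (nat \<Rightarrow> nat) list) + length (drop i' (take j' Y)))"
      using plen_wprod_sandwich by metis
    also have "\<dots> \<le> real (j' - i')" by simp
    finally show ?thesis .
  qed
  have "\<bar>?f i i' - ?f j i'\<bar> \<le> \<bar>real i - real j\<bar>"
    using left[of i j i'] left[of j i i'] by (cases "i \<le> j") (auto simp: of_nat_diff)
  moreover have "\<bar>?f j i' - ?f j j'\<bar> \<le> \<bar>real i' - real j'\<bar>"
    using right[of i' j' j] right[of j' i' j] by (cases "i' \<le> j'") (auto simp: of_nat_diff)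
  ultimately show ?thesis by linarith
qed

lemma wavg_take:
  assumes n: "n \<ge> 2" and MN: "M \<le> N"
  shows "wavg n N (\<lambda>ts. f (take M ts)) = wavg n M f"
proof -
  have "wavg n N (\<lambda>ts. f (take M ts)) = wavg n M (\<lambda>ts. wavg n (N - M) (\<lambda>us. f (take M (ts @ us))))"
    using wavg_append[of n M "N - M" "\<lambda>ts. f (take M ts)"] MN by simp
  also have "\<dots> = wavg n M (\<lambda>ts. wavg n (N - M) (\<lambda>us. f ts))"
    by (intro wavg_cong) (simp add: words_def)
  finally show ?thesis by (simp add: wavg_const[OF n])
qed

text \<open>For two stopped permutations \<open>x\<close> and \<open>y\<close> the product \<open>x^-1 y\<close> is spelled by the reversed word of
  \<open>x\<close> followed by the word of \<open>y\<close>. The uniform distribution on words is invariant under reversal, so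
  at deterministic lengths this is again a uniform word.\<close>

lemma wavg_two_sided:
  assumes n: "n \<ge> 2" and M: "M1 \<le> N" "M2 \<le> N"
  shows "wavg n N (\<lambda>ts. wavg n N (\<lambda>us. f (rev (take M1 ts) @ take M2 us))) = wavg n (M1 + M2) f"
proof -
  have "wavg n N (\<lambda>ts. wavg n N (\<lambda>us. f (rev (take M1 ts) @ take M2 us)))
      = wavg n N (\<lambda>ts. wavg n M2 (\<lambda>us. f (rev (take M1 ts) @ us)))"
  proof (rule wavg_cong)
    fix ts
    show "wavg n N (\<lambda>us. f (rev (take M1 ts) @ take M2 us)) = wavg n M2 (\<lambda>us. f (rev (take M1 ts) @ us))"
      by (rule wavg_take[OF n M(2)])
  qed
  also have "\<dots> = wavg n M1 (\<lambda>ts. wavg n M2 (\<lambda>us. f (rev ts @ us)))"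
    using wavg_take[OF n M(1), of "\<lambda>ts. wavg n M2 (\<lambda>us. f (rev ts @ us))"] .
  also have "\<dots> = wavg n (M1 + M2) f"
    using wavg_rev[of n M1 "\<lambda>ts. wavg n M2 (\<lambda>us. f (ts @ us))"] by (simp add: wavg_append)
  finally show ?thesis .
qed

section \<open>The subcritical case\<close>

definition near_geodesic :: "nat \<Rightarrow> (nat \<Rightarrow> nat) \<Rightarrow> (nat \<Rightarrow> nat) \<Rightarrow> (nat \<Rightarrow> nat) list" where
  "near_geodesic n x y = (ARG_MIN (dist_to_path n id) \<gamma>. geodesic n x y \<gamma>)"

lemma geodesic_exists:
  assumes "x \<in> perms n" "y \<in> perms n"
  shows "\<exists>\<gamma>. geodesic n x y \<gamma> \<and> dist_to_path n id \<gamma> \<le> n"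
proof -
  have "gdist n x x = 0" using assms gdist_eq_plen[of x n x] perms_inv_comp_comp[of x n id] by simp
  then obtain \<gamma> where "geodesic n x y \<gamma>" "dist_to_path n id \<gamma> \<le> gdist n id x"
    using geodesic_through[OF assms assms(1)] by auto
  then show ?thesis using gdist_id[OF assms(1)] plen_le[of n x] by auto
qed

lemma near_geodesic:
  assumes "x \<in> perms n" "y \<in> perms n"
  shows "geodesic n x y (near_geodesic n x y)"
    "geodesic n x y \<gamma> \<Longrightarrow> dist_to_path n id (near_geodesic n x y) \<le> dist_to_path n id \<gamma>"
proof -
  obtain \<gamma>' where g: "geodesic n x y \<gamma>'" using geodesic_exists[OF assms] by blast
  show "geodesic n x y (near_geodesic n x y)"
    unfolding near_geodesic_def by (rule arg_min_natI[where P = "geodesic n x y", OF g])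
  show "geodesic n x y \<gamma> \<Longrightarrow> dist_to_path n id (near_geodesic n x y) \<le> dist_to_path n id \<gamma>"
    unfolding near_geodesic_def by (rule arg_min_nat_le[where P = "geodesic n x y"])
qed

lemma wprod_in_perms: "set ts \<subseteq> transpositions n \<Longrightarrow> wprod ts \<in> perms n"
  using wprod_permutes by (auto simp: perms_def)

text \<open>The first term bounds the distance when both words reach the level. The trivial bound \<open>n\<close> is used
  on the exceptional words.\<close>

lemma near_geodesic_stopped:
  assumes ts: "ts \<in> words n M" and us: "us \<in> words n M"
    and x: "stopped n m ts x" and y: "stopped n m us y"
  shows "real (dist_to_path n id (near_geodesic n x y))
    \<le> real (card (lassos n (rev ts @ us))) + real n * of_bool (\<not> hits n m ts) + real n * of_bool (\<not> hits n m us)"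
proof -
  have xy: "x \<in> perms n" "y \<in> perms n" using x y by (auto simp: stopped_def)
  have sets: "set ts \<subseteq> transpositions n" "set us \<subseteq> transpositions n" using ts us by (auto simp: words_def)
  show ?thesis
  proof (cases "hits n m ts \<and> hits n m us")
    case False
    have "dist_to_path n id (near_geodesic n x y) \<le> n"
      using geodesic_exists[OF xy] near_geodesic(2)[OF xy] le_trans by blast
    then show ?thesis using False by auto
  next
    case True
    define i j where "i = first_hit n m ts" and "j = first_hit n m us"
    have eq: "x = wprod (take i ts)" "y = wprod (take j us)"
      using x y True by (auto simp: stopped_def i_def j_def)
    have sub: "set (take i ts) \<subseteq> transpositions n" "set (take j us) \<subseteq> transpositions n"
      using sets set_take_subset by fastforce+
    have "dist_to_path n id (near_geodesic n x y) \<le> card (untidy_vertices n (rev (take i ts) @ take j us))"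
      using geodesic_near_id[OF sub] near_geodesic(2)[OF xy] le_trans unfolding eq by blast
    also have "\<dots> \<le> card (lassos n (rev (take i ts) @ take j us))"
      using sub by (intro card_untidy_vertices_le) auto
    also have "\<dots> \<le> card (lassos n (rev (drop i ts) @ (rev (take i ts) @ take j us) @ drop j us))"
      by (rule card_lassos_sublist)
    also have "rev (drop i ts) @ (rev (take i ts) @ take j us) @ drop j us = rev ts @ us"
      by (metis append.assoc append_take_drop_id rev_append)
    finally show ?thesis using True by (simp del: id_apply)
  qed
qed

text \<open>A word of length \<open>M > m\<close> whose length has not reached \<open>m\<close> has at least \<open>(M - m) / 2\<close> lassos.\<close>

lemma not_hits_prob_subcritical:
  assumes n: "n \<ge> 2" and \<rho>: "2 * real M / (real n - 1) \<le> \<rho>" "\<rho> < 1" and m: "real m < real M"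
  shows "wavg n M (\<lambda>ts. of_bool (\<not> hits n m ts)) \<le> 2 * lasso_const \<rho> / (real M - real m)"
proof -
  have "wavg n M (\<lambda>ts. of_bool (\<not> hits n m ts))
      \<le> wavg n M (\<lambda>ts. of_bool (real M - real m \<le> 2 * real (card (lassos n ts))))"
  proof (rule wavg_mono)
    fix ts assume "ts \<in> words n M"
    then have ts: "set ts \<subseteq> transpositions n" "length ts = M" by (auto simp: words_def)
    have "real M - real m \<le> 2 * real (card (lassos n ts))" if "\<not> hits n m ts"
      using plen_ge_lassos[OF ts(1)] not_hits_plen[OF ts(1) that] ts(2) by linarith
    then show "of_bool (\<not> hits n m ts) \<le> (of_bool (real M - real m \<le> 2 * real (card (lassos n ts))) :: real)"
      by simp
  qed
  also have "\<dots> \<le> wavg n M (\<lambda>ts. 2 * real (card (lassos n ts))) / (real M - real m)"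
    using m by (intro wavg_markov) auto
  also have "\<dots> \<le> 2 * lasso_const \<rho> / (real M - real m)"
    unfolding wavg_cmult using wavg_lassos_le_const[OF n \<rho>] m by (intro divide_right_mono) auto
  finally show ?thesis .
qed

text \<open>Take words of length \<open>b * n\<close> with \<open>a < b < 1/4\<close>. Two of them together are still subcritical, and
  they fail to reach the level with probability \<open>O(1 / n)\<close>, which compensates the factor \<open>n\<close>.\<close>

lemma subcritical_bound:
  assumes a: "0 < a" "a < 1 / 4"
  shows "\<exists>C. \<forall>\<^sub>F n in sequentially. \<exists>M. wavg n M (\<lambda>ts. wavg n M (\<lambda>us.
      real (card (lassos n (rev ts @ us))) + real n * of_bool (\<not> hits n (scaled a n) ts)
      + real n * of_bool (\<not> hits n (scaled a n) us))) \<le> C"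
proof -
  define b where "b = (a + 1 / 4) / 2"
  define \<rho> where "\<rho> = 2 * b + 1 / 2"
  have b: "a < b" "0 \<le> 2 * b" "2 * b < 1 / 2" using a by (auto simp: b_def)
  have \<rho>: "\<rho> < 1" "0 \<le> \<rho>" using b by (auto simp: \<rho>_def)
  define C where "C = lasso_const \<rho> + 4 * lasso_const \<rho> / (b - a) + 4 * lasso_const \<rho> / (b - a)"
  have "\<forall>\<^sub>F n in sequentially. (b - a) * real n > 2" using b(1) by real_asymp
  with subcritical_eventually[OF b(2,3)]
  have "\<forall>\<^sub>F n in sequentially. \<exists>M. wavg n M (\<lambda>ts. wavg n M (\<lambda>us.
      real (card (lassos n (rev ts @ us))) + real n * of_bool (\<not> hits n (scaled a n) ts)
      + real n * of_bool (\<not> hits n (scaled a n) us))) \<le> C"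
  proof eventually_elim
    case (elim n)
    define M where "M = scaled b n"
    let ?m = "scaled a n"
    have n: "n \<ge> 2" using elim(1) by simp
    have "real (2 * M) \<le> 2 * (b * real n)" using scaled_bounds(1)[of b n] b by (simp add: M_def)
    then have "2 * M \<le> scaled (2 * b) n" unfolding scaled_def by (simp add: le_nat_floor mult.assoc)
    then have "2 * real (2 * M) \<le> 2 * real (scaled (2 * b) n)" by linarith
    then have "2 * real (2 * M) / (real n - 1) \<le> 2 * real (scaled (2 * b) n) / (real n - 1)"
      by (rule divide_right_mono) (use n in simp)
    then have r2: "2 * real (M + M) / (real n - 1) \<le> \<rho>" 
    proof -
      have "2 * real (scaled (2 * b) n) / (real n - 1) \<le> \<rho>" using elim(1) unfolding \<rho>_def by blast
      moreover have "M + M = 2 * M" by simp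
      ultimately show ?thesis using \<open>2 * real (2 * M) / (real n - 1) \<le> _\<close> by (metis order_trans)
    qed
    have "2 * real M / (real n - 1) \<le> 2 * real (M + M) / (real n - 1)"
      by (rule divide_right_mono) (use n in simp_all)
    with r2 have r1: "2 * real M / (real n - 1) \<le> \<rho>" by linarith
    have "real M - real ?m \<ge> (b - a) * real n - 1"
      using scaled_bounds(2)[of b n] scaled_bounds(1)[of a n] a b by (simp add: M_def left_diff_distrib)
    with elim(2) have gap: "real M - real ?m \<ge> (b - a) * real n / 2" "real ?m < real M" by linarith+
    define P where "P = wavg n M (\<lambda>ts. of_bool (\<not> hits n ?m ts))"
    have "P \<le> 2 * lasso_const \<rho> / (real M - real ?m)"
      unfolding P_def by (rule not_hits_prob_subcritical[OF n r1 \<rho>(1) gap(2)])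
    also have "\<dots> \<le> 2 * lasso_const \<rho> / ((b - a) * real n / 2)"
      using gap lasso_const_nonneg[OF \<rho>(2,1)] b n by (intro divide_left_mono) auto
    finally have "real n * P \<le> real n * (2 * lasso_const \<rho> / ((b - a) * real n / 2))"
      by (rule mult_left_mono) simp
    also have "\<dots> = 4 * lasso_const \<rho> / (b - a)" using n b by (simp add: field_simps)
    finally have P: "real n * P \<le> 4 * lasso_const \<rho> / (b - a)" .
    have "wavg n M (\<lambda>ts. wavg n M (\<lambda>us. real (card (lassos n (rev ts @ us)))))
        = wavg n M (\<lambda>ts. wavg n M (\<lambda>us. real (card (lassos n (rev (take M ts) @ take M us)))))"
      by (intro wavg_cong) (simp add: words_def)
    also have "\<dots> = wavg n (M + M) (\<lambda>ts. real (card (lassos n ts)))"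
      by (rule wavg_two_sided[OF n]) auto
    also have "\<dots> \<le> lasso_const \<rho>" by (rule wavg_lassos_le_const[OF n r2 \<rho>(1)])
    finally have L: "wavg n M (\<lambda>ts. wavg n M (\<lambda>us. real (card (lassos n (rev ts @ us))))) \<le> lasso_const \<rho>" .
    have "wavg n M (\<lambda>ts. wavg n M (\<lambda>us. real (card (lassos n (rev ts @ us))) + real n * of_bool (\<not> hits n ?m ts)
        + real n * of_bool (\<not> hits n ?m us)))
      = wavg n M (\<lambda>ts. wavg n M (\<lambda>us. real (card (lassos n (rev ts @ us))))) + real n * P + real n * P"
      unfolding P_def by (simp add: wavg_add wavg_cmult wavg_const[OF n])
    also have "\<dots> \<le> C" using L P unfolding C_def by linarith
    finally show ?case by blast
  qed
  then show ?thesis by blast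
qed

section \<open>The supercritical case\<close>

lemma not_hits_prob:
  assumes s: "0 \<le> s" and a: "0 \<le> a" "a < profile s"
  shows "(\<lambda>n. wavg n (scaled s n) (\<lambda>ts. of_bool (\<not> hits n (scaled a n) ts))) \<longlonglongrightarrow> 0"
proof -
  define g where "g = profile s - a"
  have g: "g > 0" using a by (simp add: g_def)
  let ?D = "\<lambda>n. wavg n (scaled s n) (\<lambda>ts. \<bar>real (plen n (wprod ts)) / real n - profile s\<bar>)"
  have up: "\<forall>\<^sub>F n in sequentially. wavg n (scaled s n) (\<lambda>ts. of_bool (\<not> hits n (scaled a n) ts)) \<le> ?D n / g"
    using eventually_gt_at_top[of "0::nat"]
  proof eventually_elim
    case (elim n)
    have "wavg n (scaled s n) (\<lambda>ts. of_bool (\<not> hits n (scaled a n) ts))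
        \<le> wavg n (scaled s n) (\<lambda>ts. of_bool (g \<le> \<bar>real (plen n (wprod ts)) / real n - profile s\<bar>))"
    proof (rule wavg_mono)
      fix ts assume "ts \<in> words n (scaled s n)"
      then have ts: "set ts \<subseteq> transpositions n" by (simp add: words_def)
      have "g \<le> \<bar>real (plen n (wprod ts)) / real n - profile s\<bar>" if "\<not> hits n (scaled a n) ts"
      proof -
        have "real (plen n (wprod ts)) \<le> a * real n"
          using not_hits_plen[OF ts that] scaled_bounds(1)[OF a(1), of n] by linarith
        then have "real (plen n (wprod ts)) / real n \<le> a" using elim by (simp add: divide_le_eq)
        then show ?thesis unfolding g_def by linarith
      qed
      then show "of_bool (\<not> hits n (scaled a n) ts) \<le> (of_bool (g \<le> \<bar>real (plen n (wprod ts)) / real n - profile s\<bar>) :: real)"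
        by simp
    qed
    also have "\<dots> \<le> ?D n / g" using g by (intro wavg_markov) auto
    finally show ?case .
  qed
  have low: "\<forall>\<^sub>F n in sequentially. 0 \<le> wavg n (scaled s n) (\<lambda>ts. of_bool (\<not> hits n (scaled a n) ts))"
    by (intro always_eventually allI wavg_nonneg) simp
  have "(\<lambda>n. ?D n / g) \<longlonglongrightarrow> 0 / g" using g by (intro tendsto_divide plen_L1_lim s tendsto_const) auto
  then show ?thesis using real_tendsto_sandwich[OF low up tendsto_const] by simp
qed

text \<open>To bound the maximum of the length over all positions up to \<open>s n\<close>, compare with finitely many
  positions \<open>j * \<eta> * n\<close>: between two of them the length changes by at most \<open>\<eta> n\<close>.\<close>

lemma early_hits_prob:
  assumes s: "0 \<le> s" and a: "profile s < a" "0 \<le> a"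
  shows "(\<lambda>n. wavg n (scaled s n) (\<lambda>ts. of_bool (hits n (scaled a n) ts))) \<longlonglongrightarrow> 0"
proof -
  define g where "g = a - profile s"
  define \<eta> where "\<eta> = g / 4"
  define I where "I = {j. j \<le> nat \<lceil>s / \<eta>\<rceil> \<and> real j * \<eta> \<le> s}"
  have g: "g > 0" and \<eta>: "\<eta> > 0" using a by (auto simp: g_def \<eta>_def)
  have finI: "finite I" by (simp add: I_def)
  let ?s = "\<lambda>j. real j * \<eta>"
  let ?D = "\<lambda>j n. wavg n (scaled (?s j) n) (\<lambda>ts. \<bar>real (plen n (wprod ts)) / real n - profile (?s j)\<bar>)"
  have "\<forall>\<^sub>F n in sequentially. 2 / real n < \<eta>" using \<eta> by real_asymp
  then have up: "\<forall>\<^sub>F n in sequentially. wavg n (scaled s n) (\<lambda>ts. of_bool (hits n (scaled a n) ts)) \<le> (\<Sum>j\<in>I. ?D j n / (g / 2))"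
    using eventually_ge_at_top[of "2::nat"]
  proof eventually_elim
    case (elim n)
    have n: "n \<ge> 2" "real n > 0" using elim(2) by auto
    let ?P = "\<lambda>j ts. g / 2 \<le> \<bar>real (plen n (wprod ts)) / real n - profile (?s j)\<bar>"
    have le: "scaled (?s j) n \<le> scaled s n" if "j \<in> I" for j
      unfolding scaled_def using that n by (intro nat_mono floor_mono mult_right_mono) (auto simp: I_def)
    have "wavg n (scaled s n) (\<lambda>ts. of_bool (hits n (scaled a n) ts))
        \<le> wavg n (scaled s n) (\<lambda>ts. \<Sum>j\<in>I. of_bool (?P j (take (scaled (?s j) n) ts)))"
    proof (rule wavg_mono)
      fix ts assume t: "ts \<in> words n (scaled s n)"
      then have ts: "set ts \<subseteq> transpositions n" "length ts = scaled s n" by (auto simp: words_def)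
      show "of_bool (hits n (scaled a n) ts) \<le> (\<Sum>j\<in>I. of_bool (?P j (take (scaled (?s j) n) ts)) :: real)"
      proof (cases "hits n (scaled a n) ts")
        case False
        then show ?thesis by (simp add: sum_nonneg)
      next
        case True
        then obtain k where k: "k \<le> scaled s n" "plen n (wprod (take k ts)) = scaled a n"
          using ts(2) by (auto simp: hits_def)
        define j where "j = nat \<lfloor>real k / (\<eta> * real n)\<rfloor>"
        have q0: "0 \<le> real k / (\<eta> * real n)" using \<eta> n by simp
        then have "real j = of_int \<lfloor>real k / (\<eta> * real n)\<rfloor>" by (simp add: j_def)
        then have jb: "real j \<le> real k / (\<eta> * real n)" "real k / (\<eta> * real n) < real j + 1" by linarith+
        have j1: "?s j * real n \<le> real k" using jb(1) \<eta> n by (simp add: field_simps)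
        have j2: "real k \<le> ?s j * real n + \<eta> * real n" using jb(2) \<eta> n by (simp add: field_simps)
        have "real k \<le> s * real n" using k(1) scaled_bounds(1)[OF s, of n] by linarith
        then have js: "?s j \<le> s" using j1 n by (meson mult_le_cancel_right not_le order_trans)
        then have "real j \<le> s / \<eta>" using \<eta> by (simp add: field_simps)
        then have "j \<le> nat \<lceil>s / \<eta>\<rceil>" by linarith
        then have jI: "j \<in> I" using js by (simp add: I_def)
        let ?N = "scaled (?s j) n"
        have s0: "0 \<le> ?s j" using \<eta> by simp
        have N: "real ?N \<le> real k" "?s j * real n - 1 \<le> real ?N"
          using scaled_bounds[OF s0, of n] j1 by linarith+
        have "\<bar>real (plen n (wprod (rev (take 0 ts) @ take k ts))) - real (plen n (wprod (rev (take 0 ts) @ take ?N ts)))\<bar>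
            \<le> \<bar>real 0 - real 0\<bar> + \<bar>real k - real ?N\<bar>"
          by (rule plen_take_diff[OF ts(1) ts(1)])
        then have "real (plen n (wprod (take k ts))) - real (plen n (wprod (take ?N ts))) \<le> real k - real ?N"
          using N(1) by simp
        then have "a * real n - 1 - (\<eta> * real n + 1) \<le> real (plen n (wprod (take ?N ts)))"
          using k(2) scaled_bounds(2)[OF a(2), of n] j2 N(2) by linarith
        then have "(a * real n - 1 - (\<eta> * real n + 1)) / real n \<le> real (plen n (wprod (take ?N ts))) / real n"
          using n by (intro divide_right_mono) auto
        moreover have "(a * real n - 1 - (\<eta> * real n + 1)) / real n = a - \<eta> - 2 / real n"
          using n by (simp add: field_simps)
        moreover have "profile (?s j) \<le> profile s" by (rule profile_mono[OF s0 js])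
        moreover have "g = 4 * \<eta>" "a = profile s + g" by (auto simp: g_def \<eta>_def)
        ultimately have "?P j (take ?N ts)" using elim(1) by linarith
        then have "(1::real) = of_bool (?P j (take ?N ts))" by simp
        also have "\<dots> \<le> (\<Sum>j\<in>I. of_bool (?P j (take (scaled (?s j) n) ts)) :: real)"
          by (rule member_le_sum[OF jI]) (auto simp: finI)
        finally show ?thesis using True by simp
      qed
    qed
    also have "\<dots> = (\<Sum>j\<in>I. wavg n (scaled s n) (\<lambda>ts. of_bool (?P j (take (scaled (?s j) n) ts))))"
      by (rule wavg_sum)
    also have "\<dots> = (\<Sum>j\<in>I. wavg n (scaled (?s j) n) (\<lambda>ts. of_bool (?P j ts)))"
      using wavg_take[OF n(1) le] by (intro sum.cong) auto
    also have "\<dots> \<le> (\<Sum>j\<in>I. ?D j n / (g / 2))"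
      using g by (intro sum_mono wavg_markov) auto
    finally show ?case .
  qed
  have low: "\<forall>\<^sub>F n in sequentially. 0 \<le> wavg n (scaled s n) (\<lambda>ts. of_bool (hits n (scaled a n) ts))"
    by (intro always_eventually allI wavg_nonneg) simp
  have "(\<lambda>n. \<Sum>j\<in>I. ?D j n / (g / 2)) \<longlonglongrightarrow> (\<Sum>j\<in>I. 0 / (g / 2))"
    using g \<eta> by (intro tendsto_sum tendsto_divide plen_L1_lim tendsto_const) auto
  then show ?thesis using real_tendsto_sandwich[OF low up tendsto_const] by simp
qed

section \<open>From the continuous time walk to words\<close>

lemma jump_chain_eq_wprod: "jump_chain \<tau> k = wprod (map \<tau> [0..<k])"
  by (induction k) (simp_all del: comp_apply id_apply)

lemma steps_eq: "n \<ge> 2 \<Longrightarrow> steps n = transpositions n"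
  by (simp add: steps_def)

abbreviation times_measure :: "(nat \<Rightarrow> real) measure" where
  "times_measure \<equiv> \<Pi>\<^sub>M i\<in>UNIV. density lborel (exponential_density 1)"

abbreviation letters_measure :: "nat \<Rightarrow> (nat \<Rightarrow> nat \<Rightarrow> nat) measure" where
  "letters_measure n \<equiv> \<Pi>\<^sub>M i\<in>UNIV. uniform_count_measure (steps n)"

lemma prob_space_times: "prob_space times_measure"
  by (intro prob_space_PiM prob_space_exponential_density) simp

lemma prob_space_unif:
  assumes "n \<ge> 2"
  shows "prob_space (uniform_count_measure (steps n))"
  using finite_transpositions card_transpositions_pos[OF assms] assms
  by (intro prob_space_uniform_count_measure) (auto simp: steps_eq)

lemma prob_space_letters: "n \<ge> 2 \<Longrightarrow> prob_space (letters_measure n)"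
  by (intro prob_space_PiM prob_space_unif)

lemma prob_space_walk: "n \<ge> 2 \<Longrightarrow> prob_space (walk_space n)"
  unfolding walk_space_def by (intro prob_space_pair prob_space_times prob_space_letters)

lemma finite_perms: "finite (perms n)"
  unfolding perms_def by (rule finite_permutations) simp

definition prefix :: "nat \<Rightarrow> (nat \<Rightarrow> nat \<Rightarrow> nat) \<Rightarrow> (nat \<Rightarrow> nat) list" where
  "prefix M \<tau> = map \<tau> [0..<M]"

lemma space_letters: "space (letters_measure n) = {\<tau>. \<forall>i. \<tau> i \<in> steps n}"
  by (auto simp: space_PiM space_uniform_count_measure PiE_def Pi_def)

lemma prefix_in_words:
  assumes "n \<ge> 2" "\<tau> \<in> space (letters_measure n)"
  shows "prefix M \<tau> \<in> words n M"
proof -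
  have "\<forall>i. \<tau> i \<in> steps n" using assms(2) unfolding space_letters by blast
  then show ?thesis using assms(1) by (auto simp: prefix_def words_def steps_eq)
qed

lemma prefix_vimage:
  assumes "length ts = M"
  shows "prefix M -` {ts} \<inter> space (letters_measure n)
    = {\<tau> \<in> space (letters_measure n). \<forall>i\<in>{..<M}. \<tau> i \<in> {ts ! i}}"
proof -
  have "prefix M \<tau> = ts \<longleftrightarrow> (\<forall>i<M. \<tau> i = ts ! i)" for \<tau>
    using assms by (simp add: prefix_def list_eq_iff_nth_eq)
  then show ?thesis by auto
qed

lemma emeasure_prefix:
  assumes n: "n \<ge> 2" and ts: "ts \<in> words n M"
  shows "prefix M -` {ts} \<inter> space (letters_measure n) \<in> sets (letters_measure n)"
    "emeasure (letters_measure n) (prefix M -` {ts} \<inter> space (letters_measure n))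
      = ennreal (1 / real (card (words n M)))"
proof -
  interpret U: prob_space "uniform_count_measure (steps n)" by (rule prob_space_unif[OF n])
  interpret P: product_prob_space "\<lambda>_::nat. uniform_count_measure (steps n)" UNIV by unfold_locales
  have len: "length ts = M" and sub: "set ts \<subseteq> transpositions n" using ts by (auto simp: words_def)
  have single: "{ts ! i} \<in> sets (uniform_count_measure (steps n))" if "i \<in> {..<M}" for i
    using that len sub n nth_mem[of i ts] by (auto simp: sets_uniform_count_measure steps_eq)
  show "prefix M -` {ts} \<inter> space (letters_measure n) \<in> sets (letters_measure n)"
    unfolding prefix_vimage[OF len]
  proof (rule sets.sets_Collect_finite_All)
    fix i assume "i \<in> {..<M}"
    then show "{\<tau> \<in> space (letters_measure n). \<tau> i \<in> {ts ! i}} \<in> sets (letters_measure n)"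
      using single[of i] sets.Int_space_eq2[OF single[of i]]
      by (intro sets_Collect_single') (auto simp: space_uniform_count_measure sets_uniform_count_measure)
  qed auto
  have "emeasure (letters_measure n) (prefix M -` {ts} \<inter> space (letters_measure n))
      = (\<Prod>i\<in>{..<M}. emeasure (uniform_count_measure (steps n)) {ts ! i})"
    unfolding prefix_vimage[OF len] using single by (intro P.emeasure_PiM_Collect) auto
  also have "\<dots> = (\<Prod>i\<in>{..<M}. ennreal (1 / real (card (transpositions n))))"
  proof (rule prod.cong[OF refl])
    fix i assume "i \<in> {..<M}"
    then have "{ts ! i} \<subseteq> transpositions n" using len sub nth_mem[of i ts] by auto
    then show "emeasure (uniform_count_measure (steps n)) {ts ! i} = ennreal (1 / real (card (transpositions n)))"
      using emeasure_uniform_count_measure[OF finite_transpositions, of "{ts ! i}" n] n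
      by (simp add: steps_eq divide_ennreal ennreal_of_nat_eq_real_of_nat)
  qed
  also have "\<dots> = ennreal (1 / real (card (words n M)))"
    by (simp add: card_words ennreal_power power_divide)
  finally show "emeasure (letters_measure n) (prefix M -` {ts} \<inter> space (letters_measure n))
      = ennreal (1 / real (card (words n M)))" .
qed

lemma prefix_measurable:
  assumes n: "n \<ge> 2"
  shows "prefix M \<in> letters_measure n \<rightarrow>\<^sub>M count_space (words n M)"
  using emeasure_prefix(1)[OF n] prefix_in_words[OF n] finite_words
  by (subst measurable_count_space_eq2) auto

lemma distr_prefix:
  assumes n: "n \<ge> 2"
  shows "distr (walk_space n) (count_space (words n M)) (\<lambda>\<omega>. prefix M (snd \<omega>))
    = uniform_count_measure (words n M)"
proof (rule measure_eqI_finite)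
  let ?A = "times_measure" and ?B = "letters_measure n"
  interpret A: prob_space ?A by (rule prob_space_times)
  interpret B: prob_space ?B by (rule prob_space_letters[OF n])
  have meas: "(\<lambda>\<omega>. prefix M (snd \<omega>)) \<in> walk_space n \<rightarrow>\<^sub>M count_space (words n M)"
    unfolding walk_space_def by (rule measurable_compose[OF measurable_snd prefix_measurable[OF n]])
  show "sets (distr (walk_space n) (count_space (words n M)) (\<lambda>\<omega>. prefix M (snd \<omega>))) = Pow (words n M)"
    by simp
  show "sets (uniform_count_measure (words n M)) = Pow (words n M)"
    by (simp add: sets_uniform_count_measure)
  show "finite (words n M)" by (rule finite_words)
  fix ts assume ts: "ts \<in> words n M"
  have "emeasure (distr (walk_space n) (count_space (words n M)) (\<lambda>\<omega>. prefix M (snd \<omega>))) {ts}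
      = emeasure (walk_space n) ((\<lambda>\<omega>. prefix M (snd \<omega>)) -` {ts} \<inter> space (walk_space n))"
    using ts by (intro emeasure_distr[OF meas]) auto
  also have "(\<lambda>\<omega>. prefix M (snd \<omega>)) -` {ts} \<inter> space (walk_space n)
      = space ?A \<times> (prefix M -` {ts} \<inter> space ?B)"
    by (auto simp: walk_space_def space_pair_measure)
  also have "emeasure (walk_space n) \<dots> = emeasure ?A (space ?A) * emeasure ?B (prefix M -` {ts} \<inter> space ?B)"
    unfolding walk_space_def by (intro B.emeasure_pair_measure_Times emeasure_prefix[OF n ts]) auto
  also have "\<dots> = ennreal (1 / real (card (words n M)))"
    using emeasure_prefix(2)[OF n ts] A.emeasure_space_1 by simp
  also have "\<dots> = emeasure (uniform_count_measure (words n M)) {ts}"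
    using emeasure_uniform_count_measure[OF finite_words, of "{ts}" n M] ts card_words_pos[OF n]
    by (simp add: divide_ennreal ennreal_of_nat_eq_real_of_nat)
  finally show "emeasure (distr (walk_space n) (count_space (words n M)) (\<lambda>\<omega>. prefix M (snd \<omega>))) {ts}
      = emeasure (uniform_count_measure (words n M)) {ts}" .
qed

lemma integral_prefix:
  fixes g :: "(nat \<Rightarrow> nat) list \<Rightarrow> real"
  assumes n: "n \<ge> 2"
  shows "(\<integral>\<omega>. g (prefix M (snd \<omega>)) \<partial>walk_space n) = wavg n M g"
proof -
  have meas: "(\<lambda>\<omega>. prefix M (snd \<omega>)) \<in> walk_space n \<rightarrow>\<^sub>M count_space (words n M)"
    unfolding walk_space_def by (rule measurable_compose[OF measurable_snd prefix_measurable[OF n]])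
  have "(\<integral>\<omega>. g (prefix M (snd \<omega>)) \<partial>walk_space n)
      = (\<integral>ts. g ts \<partial>distr (walk_space n) (count_space (words n M)) (\<lambda>\<omega>. prefix M (snd \<omega>)))"
    by (rule integral_distr[symmetric, OF meas]) simp
  also have "\<dots> = wavg n M g"
    unfolding distr_prefix[OF n] wavg_def by (rule integral_uniform_count_measure[OF finite_words])
  finally show ?thesis .
qed

lemma times_component: "(\<lambda>\<xi>. \<xi> i) \<in> borel_measurable times_measure"
proof -
  have "(\<lambda>\<xi>. \<xi> i) \<in> times_measure \<rightarrow>\<^sub>M density lborel (exponential_density 1)"
    by (rule measurable_component_singleton) simp
  then show ?thesis by (subst measurable_cong_sets[OF refl, of _ "density lborel (exponential_density 1)"]) auto
qed

lemma num_jumps_measurable: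
  assumes "f \<in> borel_measurable (walk_space n)"
  shows "(\<lambda>\<omega>. num_jumps (fst \<omega>) (f \<omega>)) \<in> walk_space n \<rightarrow>\<^sub>M count_space UNIV"
proof -
  have c[measurable]: "(\<lambda>\<omega>. fst \<omega> i) \<in> borel_measurable (walk_space n)" for i
    unfolding walk_space_def by (rule measurable_compose[OF measurable_fst times_component])
  note assms[measurable]
  show ?thesis unfolding num_jumps_def by measurable
qed

lemma jump_chain_measurable:
  assumes n: "n \<ge> 2" and K: "K \<in> walk_space n \<rightarrow>\<^sub>M count_space UNIV"
  shows "(\<lambda>\<omega>. jump_chain (snd \<omega>) (K \<omega>)) \<in> walk_space n \<rightarrow>\<^sub>M count_space (perms n)"
proof (rule measurable_compose_countable[OF _ K])
  fix k :: nat
  have "(\<lambda>\<omega>. prefix k (snd \<omega>)) \<in> walk_space n \<rightarrow>\<^sub>M count_space (words n k)"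
    unfolding walk_space_def by (rule measurable_compose[OF measurable_snd prefix_measurable[OF n]])
  moreover have "wprod \<in> count_space (words n k) \<rightarrow>\<^sub>M count_space (perms n)"
    by (auto simp: words_def intro: wprod_in_perms)
  ultimately have "(\<lambda>\<omega>. wprod (prefix k (snd \<omega>))) \<in> walk_space n \<rightarrow>\<^sub>M count_space (perms n)"
    by (rule measurable_compose)
  then show "(\<lambda>\<omega>. jump_chain (snd \<omega>) k) \<in> walk_space n \<rightarrow>\<^sub>M count_space (perms n)"
    by (simp add: jump_chain_eq_wprod prefix_def)
qed

text \<open>The number of jumps is a right continuous step function of time, also for those holding
  times whose partial sums are not increasing. Rational times therefore suffice to detect the
  hitting time.\<close>

lemma num_jumps_right_constant: "\<exists>e>0. \<forall>t'. t \<le> t' \<and> t' < t + e \<longrightarrow> num_jumps \<xi> t' = num_jumps \<xi> t"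
proof -
  let ?S = "\<lambda>k. \<Sum>i\<le>k. \<xi> i"
  show ?thesis
  proof (cases "\<exists>k. t < ?S k")
    case True
    define k where "k = num_jumps \<xi> t"
    have k: "t < ?S k" unfolding k_def num_jumps_def by (rule LeastI_ex[OF True])
    have min: "?S j \<le> t" if "j < k" for j
      using that not_less_Least[of j "\<lambda>k. t < ?S k"] unfolding k_def num_jumps_def by auto
    show ?thesis
    proof (intro exI[of _ "?S k - t"] conjI allI impI)
      show "0 < ?S k - t" using k by simp
      fix t' assume t': "t \<le> t' \<and> t' < t + (?S k - t)"
      have "num_jumps \<xi> t' = k"
        unfolding num_jumps_def
      proof (rule Least_equality)
        show "t' < ?S k" using t' by simp
        show "k \<le> j" if "t' < ?S j" for j using min[of j] that t' by (cases "j < k") auto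
      qed
      then show "num_jumps \<xi> t' = num_jumps \<xi> t" by (simp add: k_def)
    qed
  next
    case False
    have "num_jumps \<xi> t' = num_jumps \<xi> t" if t': "t \<le> t'" for t'
    proof -
      have "(\<lambda>k. t' < ?S k) = (\<lambda>k. t < ?S k)"
      proof
        fix k
        have "\<not> t < ?S k" using False by blast
        moreover from this have "\<not> t' < ?S k" using t' by linarith
        ultimately show "(t' < ?S k) = (t < ?S k)" by (simp only:)
      qed
      then show ?thesis unfolding num_jumps_def by (rule arg_cong)
    qed
    then have "\<forall>t'. t \<le> t' \<and> t' < t + 1 \<longrightarrow> num_jumps \<xi> t' = num_jumps \<xi> t" by blast
    then show ?thesis using zero_less_one by blast
  qed
qed

text \<open>The values on the null set where the hitting time is ill-behaved matter for measurability as well,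
  since the product \<open>\<sigma>\<close>-algebra is not complete. If the level is never reached, the hitting time is
  the fixed value \<open>Inf {}\<close>.\<close>

lemma hitting_time_measurable:
  assumes n: "n \<ge> 2"
  shows "hitting_time n a \<in> borel_measurable (walk_space n)"
  unfolding borel_measurable_iff_less
proof
  fix c :: real
  let ?W = "walk_space n"
  let ?m = "nat \<lfloor>a * real n\<rfloor>"
  define H where "H = (\<lambda>\<omega>. {t. 0 < t \<and> gdist n id (walk \<omega> t) = ?m})"
  have T: "hitting_time n a \<omega> = Inf (H \<omega>)" for \<omega> by (simp add: hitting_time_def H_def)
  have rat: "\<exists>q\<in>\<rat>. q \<in> H \<omega> \<and> q < b" if tH: "t \<in> H \<omega>" and tb: "t < b" for \<omega> t b
  proof -
    obtain e where e: "e > 0" "\<And>t'. t \<le> t' \<Longrightarrow> t' < t + e \<Longrightarrow> num_jumps (fst \<omega>) t' = num_jumps (fst \<omega>) t"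
      using num_jumps_right_constant[of t "fst \<omega>"] by blast
    obtain q where q: "q \<in> \<rat>" "t < q" "q < min (t + e) b"
      using Rats_dense_in_real[of t "min (t + e) b"] e(1) tb by auto
    have "walk \<omega> q = walk \<omega> t" using e(2)[of q] q by (simp add: walk_def)
    then have "q \<in> H \<omega>" using tH q(2) by (simp add: H_def)
    then show ?thesis using q by auto
  qed
  have ne: "H \<omega> \<noteq> {} \<longleftrightarrow> (\<exists>q\<in>\<rat>. q \<in> H \<omega>)" for \<omega>
    using rat[of _ \<omega>] by (metis all_not_in_conv gt_ex)
  have bdd: "bdd_below (H \<omega>)" for \<omega> by (rule bdd_belowI[of _ 0]) (simp add: H_def)
  have lt: "H \<omega> \<noteq> {} \<Longrightarrow> Inf (H \<omega>) < c \<longleftrightarrow> (\<exists>q\<in>\<rat>. q \<in> H \<omega> \<and> q < c)" for \<omega>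
    using cInf_less_iff[OF _ bdd] rat by blast
  have eq: "{\<omega> \<in> space ?W. hitting_time n a \<omega> < c}
      = {\<omega> \<in> space ?W. (\<exists>q\<in>\<rat>. q \<in> H \<omega> \<and> q < c) \<or> (\<not> (\<exists>q\<in>\<rat>. q \<in> H \<omega>) \<and> Inf ({} :: real set) < c)}"
    unfolding T using lt ne by (smt (verit) Collect_cong)
  have Hq: "{\<omega> \<in> space ?W. q \<in> H \<omega>} \<in> sets ?W" for q
  proof -
    have w: "(\<lambda>\<omega>. walk \<omega> q) \<in> ?W \<rightarrow>\<^sub>M count_space (perms n)"
      unfolding walk_def by (intro jump_chain_measurable[OF n] num_jumps_measurable) simp
    have "{\<omega> \<in> space ?W. q \<in> H \<omega>} = (if 0 < q then (\<lambda>\<omega>. walk \<omega> q) -` {x \<in> perms n. gdist n id x = ?m} \<inter> space ?W else {})"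
      using measurable_space[OF w] by (auto simp: H_def)
    also have "\<dots> \<in> sets ?W" using measurable_sets[OF w, of "{x \<in> perms n. gdist n id x = ?m}"] by auto
    finally show ?thesis .
  qed
  have Ex: "{\<omega> \<in> space ?W. \<exists>q\<in>\<rat>. q \<in> H \<omega> \<and> P q} \<in> sets ?W" for P
  proof -
    have "{\<omega> \<in> space ?W. \<exists>q\<in>\<rat>. q \<in> H \<omega> \<and> P q} = (\<Union>q\<in>{q\<in>\<rat>. P q}. {\<omega> \<in> space ?W. q \<in> H \<omega>})" by auto
    also have "\<dots> \<in> sets ?W"
      using countable_rat Hq by (intro sets.countable_UN'') (auto intro: countable_subset)
    finally show ?thesis .
  qed
  have "{\<omega> \<in> space ?W. (\<exists>q\<in>\<rat>. q \<in> H \<omega> \<and> q < c) \<or> (\<not> (\<exists>q\<in>\<rat>. q \<in> H \<omega>) \<and> Inf ({} :: real set) < c)}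
      = {\<omega> \<in> space ?W. \<exists>q\<in>\<rat>. q \<in> H \<omega> \<and> q < c}
        \<union> (if Inf ({} :: real set) < c then space ?W - {\<omega> \<in> space ?W. \<exists>q\<in>\<rat>. q \<in> H \<omega> \<and> True} else {})"
    by auto
  also have "\<dots> \<in> sets ?W" using Ex[of "\<lambda>q. q < c"] Ex[of "\<lambda>_. True"] by auto
  finally show "{\<omega> \<in> space ?W. hitting_time n a \<omega> < c} \<in> sets ?W" unfolding eq .
qed

definition hit_perm :: "nat \<Rightarrow> real \<Rightarrow> (nat \<Rightarrow> real) \<times> (nat \<Rightarrow> nat \<Rightarrow> nat) \<Rightarrow> nat \<Rightarrow> nat" where
  "hit_perm n a \<omega> = walk \<omega> (hitting_time n a \<omega>)"

lemma hit_perm_measurable: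
  assumes n: "n \<ge> 2"
  shows "hit_perm n a \<in> walk_space n \<rightarrow>\<^sub>M count_space (perms n)"
  using jump_chain_measurable[OF n num_jumps_measurable[OF hitting_time_measurable[OF n]], of a]
  unfolding hit_perm_def[abs_def] walk_def .

lemma hitting_distribution_eq: "hitting_distribution n a = distr (walk_space n) (count_space (perms n)) (hit_perm n a)"
  by (simp add: hitting_distribution_def hit_perm_def[abs_def])

text \<open>When all holding times are positive the walk sits at its first permutation on the level
  at the hitting time, because the jump times increase strictly.\<close>

lemma hit_perm_stopped:
  assumes n: "n \<ge> 2" and \<omega>: "\<omega> \<in> space (walk_space n)" and pos: "\<And>i. fst \<omega> i > 0"
  shows "stopped n (scaled a n) (prefix M (snd \<omega>)) (hit_perm n a \<omega>)"
  unfolding stopped_def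
proof (intro conjI impI)
  let ?\<xi> = "fst \<omega>" and ?\<tau> = "snd \<omega>"
  let ?S = "\<lambda>k. \<Sum>i\<le>k. ?\<xi> i"
  let ?m = "scaled a n"
  have tau: "?\<tau> \<in> space (letters_measure n)" using \<omega> by (auto simp: walk_space_def space_pair_measure)
  show "hit_perm n a \<omega> \<in> perms n"
    using measurable_space[OF hit_perm_measurable[OF n] \<omega>] by simp
  assume h: "hits n ?m (prefix M ?\<tau>)"
  define \<kappa> where "\<kappa> = first_hit n ?m (prefix M ?\<tau>)"
  note fh = first_hit_props[OF h]
  have kM: "\<kappa> \<le> M" using fh(2) by (simp add: \<kappa>_def prefix_def)
  have take: "take k (prefix M ?\<tau>) = prefix k ?\<tau>" if "k \<le> M" for k
    using that by (simp add: prefix_def take_map)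
  have gd: "gdist n id (jump_chain ?\<tau> k) = plen n (wprod (prefix k ?\<tau>))" for k
  proof -
    have "wprod (prefix k ?\<tau>) \<in> perms n"
      using prefix_in_words[OF n tau, of k] by (intro wprod_in_perms) (simp add: words_def)
    then show ?thesis using gdist_id by (simp add: jump_chain_eq_wprod prefix_def)
  qed
  have hit: "gdist n id (jump_chain ?\<tau> \<kappa>) = ?m"
    using fh(1) take[OF kM] gd by (simp add: \<kappa>_def)
  have nohit: "gdist n id (jump_chain ?\<tau> k) \<noteq> ?m" if "k < \<kappa>" for k
    using fh(3)[of k] that kM take[of k] gd unfolding \<kappa>_def by auto
  have mono: "?S j < ?S k" if "j < k" for j k
    using that
  proof (induction k)
    case (Suc k)
    then have "?S j \<le> ?S k" by (cases "j = k") auto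
    then show ?case using pos[of "Suc k"] by simp
  qed simp
  \<comment> \<open>the walk is at its permutation with index \<open>\<kappa>\<close> from this time on, until the next jump\<close>
  define L where "L = (if \<kappa> = 0 then 0 else ?S (\<kappa> - 1))"
  have S0: "0 < ?S k" for k using pos by (intro sum_pos) auto
  have L: "0 \<le> L" "L < ?S \<kappa>"
    using S0[of \<kappa>] S0[of "\<kappa> - 1"] mono[of "\<kappa> - 1" \<kappa>] by (auto simp: L_def)
  have nj: "num_jumps ?\<xi> t = \<kappa>" if t: "L \<le> t" "t < ?S \<kappa>" for t
    unfolding num_jumps_def
  proof (rule Least_equality)
    show "\<kappa> \<le> j" if "t < ?S j" for j
    proof (rule ccontr)
      assume "\<not> \<kappa> \<le> j"
      then have "j < \<kappa>" by simp
      have "?S j \<le> ?S (\<kappa> - 1)"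
      proof (cases "j = \<kappa> - 1")
        case False
        then have "j < \<kappa> - 1" using \<open>j < \<kappa>\<close> by linarith
        then show ?thesis using mono[of j "\<kappa> - 1"] by linarith
      qed simp
      then have "?S j \<le> L" using \<open>j < \<kappa>\<close> by (simp add: L_def)
      then show False using that t by simp
    qed
  qed (rule t(2))
  define H where "H = {t. 0 < t \<and> gdist n id (walk \<omega> t) = ?m}"
  have in_H: "t \<in> H" if "L < t" "t < ?S \<kappa>" for t
    using that L nj[of t] hit by (simp add: H_def walk_def)
  have H_ge: "L \<le> t" if "t \<in> H" for t
  proof (rule ccontr)
    assume "\<not> L \<le> t"
    then have "t < L" by simp
    moreover have "0 < t" using that by (simp add: H_def)
    moreover have "L = 0" if "\<kappa> = 0" using that by (simp add: L_def)
    ultimately have "\<kappa> \<noteq> 0" by linarith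
    then have "t < ?S (\<kappa> - 1)" using \<open>t < L\<close> by (simp add: L_def)
    then have "num_jumps ?\<xi> t \<le> \<kappa> - 1" unfolding num_jumps_def by (rule Least_le)
    then have "num_jumps ?\<xi> t < \<kappa>" using \<open>\<kappa> \<noteq> 0\<close> by simp
    then show False using nohit that by (auto simp: H_def walk_def)
  qed
  have "Inf H = L"
  proof (rule antisym)
    have "H \<noteq> {}" using in_H[of "(L + ?S \<kappa>) / 2"] L by auto
    then show "L \<le> Inf H" using H_ge by (rule cInf_greatest)
    have bdd: "bdd_below H" using H_ge by (rule bdd_belowI)
    show "Inf H \<le> L"
    proof (rule dense_ge_bounded[OF L(2)])
      fix t assume "L < t" "t < ?S \<kappa>"
      then show "Inf H \<le> t" using in_H bdd by (intro cInf_lower) auto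
    qed
  qed
  then have "hitting_time n a \<omega> = L" by (simp add: hitting_time_def H_def scaled_def)
  then have "hit_perm n a \<omega> = jump_chain ?\<tau> \<kappa>"
    using nj[of L] L by (simp add: hit_perm_def walk_def)
  then show "hit_perm n a \<omega> = wprod (take (first_hit n ?m (prefix M ?\<tau>)) (prefix M ?\<tau>))"
    using take[OF kM] by (simp add: jump_chain_eq_wprod prefix_def \<kappa>_def)
qed

lemma AE_times_pos:
  assumes n: "n \<ge> 2"
  shows "AE \<omega> in walk_space n. \<forall>i. fst \<omega> i > 0"
proof -
  have "AE x in density lborel (exponential_density 1). 0 < (x::real)"
  proof (subst AE_density)
    show "AE x in lborel. 0 < ennreal (exponential_density 1 x) \<longrightarrow> 0 < (x::real)"
      using AE_lborel_singleton[of "0::real"]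
      by eventually_elim (auto simp: exponential_density_def split: if_splits)
  qed simp
  then have "AE \<xi> in times_measure. 0 < \<xi> i" for i
    by (intro AE_PiM_component) (auto intro: prob_space_exponential_density)
  then have "AE \<xi> in times_measure. \<forall>i. 0 < \<xi> i" by (simp add: AE_all_countable)
  then have "AE \<xi> in distr (walk_space n) times_measure fst. \<forall>i. 0 < \<xi> i"
    unfolding walk_space_def using prob_space.distr_pair_fst[OF prob_space_letters[OF n]] by metis
  then show ?thesis
    by (intro AE_distrD[where M' = times_measure and f = fst]) (auto simp: walk_space_def)
qed

lemma AE_stopped:
  assumes n: "n \<ge> 2"
  shows "AE \<omega> in walk_space n. stopped n (scaled a n) (prefix M (snd \<omega>)) (hit_perm n a \<omega>)
    \<and> prefix M (snd \<omega>) \<in> words n M"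
  using AE_times_pos[OF n] AE_space
proof eventually_elim
  case (elim \<omega>)
  have "snd \<omega> \<in> space (letters_measure n)" using elim(2) by (auto simp: walk_space_def space_pair_measure)
  then show ?case using hit_perm_stopped[OF n elim(2)] elim(1) prefix_in_words[OF n] by blast
qed

lemma prob_space_hitting: "n \<ge> 2 \<Longrightarrow> prob_space (hitting_distribution n a)"
  unfolding hitting_distribution_eq by (intro prob_space.prob_space_distr prob_space_walk hit_perm_measurable)

lemma prob_space_pair_law: "n \<ge> 2 \<Longrightarrow> prob_space (pair_law n a)"
  unfolding pair_law_def by (intro prob_space_pair prob_space_hitting)

lemma sets_hitting: "sets (hitting_distribution n a) = sets (count_space (perms n))"
  by (simp add: hitting_distribution_def)

lemma sets_pair_law: "sets (pair_law n a) = Pow (perms n \<times> perms n)"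
proof -
  have "sets (pair_law n a) = sets (count_space (perms n) \<Otimes>\<^sub>M count_space (perms n))"
    unfolding pair_law_def by (intro sets_pair_measure_cong sets_hitting)
  also have "count_space (perms n) \<Otimes>\<^sub>M count_space (perms n) = count_space (perms n \<times> perms n)"
    using finite_perms[of n] by (intro pair_measure_countable countable_finite)
  finally show ?thesis by simp
qed

lemma space_pair_law: "space (pair_law n a) = perms n \<times> perms n"
  using sets_eq_imp_space_eq[of "pair_law n a" "count_space (perms n \<times> perms n)"] sets_pair_law[of n a]
  by simp

lemma pair_law_measurable: "f \<in> pair_law n a \<rightarrow>\<^sub>M borel"
  unfolding measurable_def using sets_pair_law[of n a] space_pair_law[of n a] by auto

lemma integrable_of_finite_range:
  fixes f :: "'a \<Rightarrow> real"
  assumes "finite_measure M" "f \<in> borel_measurable M" "finite (f ` space M)"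
  shows "integrable M f"
proof (rule finite_measure.integrable_const_bound[OF assms(1), where B = "Max (insert 0 ((\<lambda>x. \<bar>x\<bar>) ` f ` space M))"])
  show "AE x in M. norm (f x) \<le> Max (insert 0 ((\<lambda>x. \<bar>x\<bar>) ` f ` space M))"
    using assms(3) by (intro AE_I2) auto
qed (rule assms(2))

lemma pair_law_integrable:
  fixes f :: "(nat \<Rightarrow> nat) \<times> (nat \<Rightarrow> nat) \<Rightarrow> real"
  assumes "n \<ge> 2"
  shows "integrable (pair_law n a) f"
proof -
  interpret prob_space "pair_law n a" by (rule prob_space_pair_law[OF assms])
  show ?thesis
    by (rule integrable_of_finite_range[OF finite_measure_axioms pair_law_measurable]) (simp add: space_pair_law finite_perms)
qed

text \<open>Every estimate of the main theorem is transferred to averages over pairs of independent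
  words by this comparison.\<close>

lemma pair_law_integral_le:
  fixes F :: "(nat \<Rightarrow> nat) \<Rightarrow> (nat \<Rightarrow> nat) \<Rightarrow> real"
  assumes n: "n \<ge> 2"
    and FG: "\<And>ts us x y. ts \<in> words n M \<Longrightarrow> us \<in> words n M \<Longrightarrow> stopped n (scaled a n) ts x
      \<Longrightarrow> stopped n (scaled a n) us y \<Longrightarrow> F x y \<le> G ts us"
  shows "(\<integral>(x, y). F x y \<partial>pair_law n a) \<le> wavg n M (\<lambda>ts. wavg n M (\<lambda>us. G ts us))"
proof -
  let ?W = "walk_space n" and ?h = "hit_perm n a"
  let ?P = "count_space (perms n)"
  let ?pre = "\<lambda>\<omega>. prefix M (snd \<omega>)"
  interpret W: prob_space ?W by (rule prob_space_walk[OF n])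
  interpret WW: pair_prob_space ?W ?W ..
  have WP: "finite_measure (?W \<Otimes>\<^sub>M ?W)"
    by (intro prob_space.finite_measure prob_space_pair prob_space_walk n)
  have h: "?h \<in> ?W \<rightarrow>\<^sub>M ?P" by (rule hit_perm_measurable[OF n])
  have pre: "?pre \<in> ?W \<rightarrow>\<^sub>M count_space (words n M)"
    unfolding walk_space_def by (rule measurable_compose[OF measurable_snd prefix_measurable[OF n]])
  have hh: "(\<lambda>(x, y). (?h x, ?h y)) \<in> ?W \<Otimes>\<^sub>M ?W \<rightarrow>\<^sub>M ?P \<Otimes>\<^sub>M ?P"
    using h by (auto simp: case_prod_unfold intro!: measurable_Pair measurable_compose[OF measurable_fst] measurable_compose[OF measurable_snd])
  have PP: "?P \<Otimes>\<^sub>M ?P = count_space (perms n \<times> perms n)"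
    using finite_perms[of n] by (intro pair_measure_countable countable_finite)
  have law: "pair_law n a = distr (?W \<Otimes>\<^sub>M ?W) (?P \<Otimes>\<^sub>M ?P) (\<lambda>(x, y). (?h x, ?h y))"
    unfolding pair_law_def hitting_distribution_eq
    by (rule pair_measure_distr[OF h h])
      (intro prob_space_imp_sigma_finite prob_space.prob_space_distr prob_space_walk n h)
  have Fm: "(\<lambda>(x, y). F x y) \<in> borel_measurable (?P \<Otimes>\<^sub>M ?P)" unfolding PP by simp
  have GG: "(\<lambda>\<omega>. (?pre (fst \<omega>), ?pre (snd \<omega>))) \<in> ?W \<Otimes>\<^sub>M ?W \<rightarrow>\<^sub>M count_space (words n M \<times> words n M)"
    unfolding pair_measure_countable[OF countable_finite[OF finite_words] countable_finite[OF finite_words], symmetric]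
    using pre by (auto intro!: measurable_Pair measurable_compose[OF measurable_fst] measurable_compose[OF measurable_snd])
  have int1: "integrable (?W \<Otimes>\<^sub>M ?W) (\<lambda>\<omega>. F (?h (fst \<omega>)) (?h (snd \<omega>)))"
  proof (rule integrable_of_finite_range[OF WP])
    show "(\<lambda>\<omega>. F (?h (fst \<omega>)) (?h (snd \<omega>))) \<in> borel_measurable (?W \<Otimes>\<^sub>M ?W)"
      using measurable_compose[OF hh Fm] by (simp add: case_prod_unfold)
    have "(\<lambda>\<omega>. F (?h (fst \<omega>)) (?h (snd \<omega>))) ` space (?W \<Otimes>\<^sub>M ?W) \<subseteq> (\<lambda>(x, y). F x y) ` (perms n \<times> perms n)"
      using measurable_space[OF h] by (force simp: space_pair_measure)
    then show "finite ((\<lambda>\<omega>. F (?h (fst \<omega>)) (?h (snd \<omega>))) ` space (?W \<Otimes>\<^sub>M ?W))"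
      by (rule finite_subset) (intro finite_imageI finite_cartesian_product finite_perms)
  qed
  have int2: "integrable (?W \<Otimes>\<^sub>M ?W) (\<lambda>\<omega>. G (?pre (fst \<omega>)) (?pre (snd \<omega>)))"
  proof (rule integrable_of_finite_range[OF WP])
    show "(\<lambda>\<omega>. G (?pre (fst \<omega>)) (?pre (snd \<omega>))) \<in> borel_measurable (?W \<Otimes>\<^sub>M ?W)"
      using measurable_compose[OF GG, of "\<lambda>(x, y). G x y" borel] by (simp add: case_prod_unfold)
    have "(\<lambda>\<omega>. G (?pre (fst \<omega>)) (?pre (snd \<omega>))) ` space (?W \<Otimes>\<^sub>M ?W) \<subseteq> (\<lambda>(x, y). G x y) ` (words n M \<times> words n M)"
      using measurable_space[OF pre] by (force simp: space_pair_measure)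
    then show "finite ((\<lambda>\<omega>. G (?pre (fst \<omega>)) (?pre (snd \<omega>))) ` space (?W \<Otimes>\<^sub>M ?W))"
      by (rule finite_subset) (intro finite_imageI finite_cartesian_product finite_words)
  qed
  define good where "good = (\<lambda>\<omega>. stopped n (scaled a n) (?pre \<omega>) (?h \<omega>) \<and> ?pre \<omega> \<in> words n M)"
  have g: "AE \<omega> in ?W. good \<omega>" unfolding good_def by (rule AE_stopped[OF n])
  have "AE \<omega> in ?W \<Otimes>\<^sub>M ?W. good (fst \<omega>)"
  proof (rule AE_distrD[where M' = ?W and f = fst])
    show "AE \<omega> in distr (?W \<Otimes>\<^sub>M ?W) ?W fst. good \<omega>" unfolding W.distr_pair_fst by (rule g)
  qed simp
  moreover have "AE \<omega> in ?W \<Otimes>\<^sub>M ?W. good (snd \<omega>)"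
  proof (rule AE_distrD[where M' = ?W and f = snd])
    have "distr (?W \<Otimes>\<^sub>M ?W) ?W snd = ?W"
    proof (rule measure_eqI)
      fix A assume "A \<in> sets (distr (?W \<Otimes>\<^sub>M ?W) ?W snd)"
      then have A: "A \<in> sets ?W" by simp
      have "snd -` A \<inter> space (?W \<Otimes>\<^sub>M ?W) = space ?W \<times> A"
        using sets.sets_into_space[OF A] by (auto simp: space_pair_measure)
      then show "emeasure (distr (?W \<Otimes>\<^sub>M ?W) ?W snd) A = emeasure ?W A"
        using A W.emeasure_pair_measure_Times[of "space ?W" ?W A] W.emeasure_space_1
        by (simp add: emeasure_distr)
    qed simp
    with g show "AE \<omega> in distr (?W \<Otimes>\<^sub>M ?W) ?W snd. good \<omega>" by (simp only:)
  qed simp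
  ultimately have ae: "AE \<omega> in ?W \<Otimes>\<^sub>M ?W. F (?h (fst \<omega>)) (?h (snd \<omega>)) \<le> G (?pre (fst \<omega>)) (?pre (snd \<omega>))"
    by eventually_elim (auto simp: good_def intro: FG)
  have "(\<integral>(x, y). F x y \<partial>pair_law n a) = (\<integral>\<omega>. F (?h (fst \<omega>)) (?h (snd \<omega>)) \<partial>(?W \<Otimes>\<^sub>M ?W))"
    unfolding law by (subst integral_distr[OF hh Fm]) (simp add: case_prod_unfold)
  also have "\<dots> \<le> (\<integral>\<omega>. G (?pre (fst \<omega>)) (?pre (snd \<omega>)) \<partial>(?W \<Otimes>\<^sub>M ?W))"
    by (rule integral_mono_AE[OF int1 int2 ae])
  also have "\<dots> = (\<integral>\<omega>. (\<integral>\<omega>'. G (?pre \<omega>) (?pre \<omega>') \<partial>?W) \<partial>?W)"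
    using WW.integral_fst'[OF int2] by simp
  also have "\<dots> = (\<integral>\<omega>. wavg n M (\<lambda>us. G (?pre \<omega>) us) \<partial>?W)"
    using integral_prefix[OF n] by simp
  also have "\<dots> = wavg n M (\<lambda>ts. wavg n M (\<lambda>us. G ts us))"
    by (rule integral_prefix[OF n])
  finally show ?thesis .
qed

section \<open>The two regimes\<close>

lemma gromov_product_plen:
  assumes "x \<in> perms n" "y \<in> perms n"
  shows "gromov_product n id x y = (real (plen n x) + real (plen n y) - real (plen n (inv x \<circ> y))) / 2"
  unfolding gromov_product_def
  using gdist_sym[OF assms(1) id_perms] gdist_sym[OF assms(2) id_perms] gdist_id[OF assms(1)] gdist_id[OF assms(2)]
    gdist_eq_plen[OF assms] by (simp only:)

lemma gromov_product_abs_le: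
  assumes "x \<in> perms n" "y \<in> perms n"
  shows "\<bar>gromov_product n id x y\<bar> \<le> real n"
proof -
  have "real (plen n x) \<le> real n" "real (plen n y) \<le> real n" "real (plen n (inv x \<circ> y)) \<le> real n"
    "0 \<le> real (plen n x)" "0 \<le> real (plen n y)" "0 \<le> real (plen n (inv x \<circ> y))"
    using plen_le by (simp_all only: of_nat_le_iff of_nat_0_le_iff)
  moreover have "\<bar>(p + q - d) / 2\<bar> \<le> r"
    if "p \<le> r" "q \<le> r" "d \<le> r" "0 \<le> p" "0 \<le> q" "0 \<le> d" for p q d r :: real
    using that by (auto simp: abs_le_iff)
  ultimately show ?thesis unfolding gromov_product_plen[OF assms] by blast
qed

text \<open>Both hitting positions are close to the deterministic position, so \<open>x^-1 y\<close> may be replaced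
  by a uniform word of deterministic length.\<close>

lemma supercritical_pointwise:
  assumes n: "n \<ge> 2" and ts: "ts \<in> words n M" and us: "us \<in> words n M"
    and x: "stopped n m ts x" and y: "stopped n m us y"
    and L: "L \<le> M1" "M1 \<le> M" "L \<le> M2" "M2 \<le> M"
  shows "\<bar>gromov_product n id x y / real n - (a - v / 2)\<bar>
    \<le> (\<bar>real m / real n - a\<bar> + real (M - L) / real n)
      + 1 / 2 * \<bar>real (plen n (wprod (rev (take M1 ts) @ take M2 us))) / real n - v\<bar>
      + (1 + \<bar>a - v / 2\<bar>) * (of_bool (\<not> hits n m ts) + of_bool (hits n m (take L ts)))
      + (1 + \<bar>a - v / 2\<bar>) * (of_bool (\<not> hits n m us) + of_bool (hits n m (take L us)))"
    (is "?l \<le> ?A + 1 / 2 * ?D + ?B * ?p + ?B * ?q")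
proof -
  have xy: "x \<in> perms n" "y \<in> perms n" using x y by (auto simp: stopped_def)
  have sets: "set ts \<subseteq> transpositions n" "set us \<subseteq> transpositions n" "length ts = M" "length us = M"
    using ts us by (auto simp: words_def)
  have pos: "0 \<le> ?A" "0 \<le> ?D" "0 \<le> ?B * ?p" "0 \<le> ?B * ?q" by auto
  show ?thesis
  proof (cases "hits n m ts \<and> \<not> hits n m (take L ts) \<and> hits n m us \<and> \<not> hits n m (take L us)")
    case False
    then have pq: "1 \<le> ?p \<or> 1 \<le> ?q" by auto
    have "\<bar>gromov_product n id x y / real n\<bar> \<le> 1"
      using gromov_product_abs_le[OF xy] n by (simp add: abs_divide)
    then have "?l \<le> ?B" by linarith
    moreover have "?B \<le> ?B * ?p \<or> ?B \<le> ?B * ?q" using pq by auto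
    moreover have "l \<le> A + 1 / 2 * D + p + q"
      if "l \<le> b" "b \<le> p \<or> b \<le> q" "0 \<le> A" "0 \<le> D" "0 \<le> p" "0 \<le> q" for l A D p q b :: real
      using that by auto
    ultimately show ?thesis using pos by blast
  next
    case True
    define i j where "i = first_hit n m ts" and "j = first_hit n m us"
    have eq: "x = wprod (take i ts)" "y = wprod (take j us)"
      using x y True by (auto simp: stopped_def i_def j_def)
    have pm: "plen n x = m" "plen n y = m"
      using first_hit_props(1) True unfolding eq i_def j_def by blast+
    have up: "i \<le> M" "j \<le> M"
      using first_hit_props(2)[of n m ts] first_hit_props(2)[of n m us] True sets
      unfolding i_def j_def by simp_all
    have lo: "L \<le> first_hit n m ws" if "hits n m ws" "\<not> hits n m (take L ws)" "length ws = M" for ws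
    proof (rule ccontr)
      assume "\<not> L \<le> first_hit n m ws"
      then have "first_hit n m ws \<le> length (take L ws)" "take (first_hit n m ws) (take L ws) = take (first_hit n m ws) ws"
        using that(3) L by (auto simp: min_def)
      then show False using that(2) first_hit_props(1)[OF that(1)] unfolding hits_def by metis
    qed
    have lo: "L \<le> i" "L \<le> j" using lo True sets unfolding i_def j_def by blast+
    have sub: "set (take i ts) \<subseteq> transpositions n" using sets set_take_subset by fastforce
    have inv: "inv x \<circ> y = wprod (rev (take i ts) @ take j us)"
      unfolding eq using wprod_rev_inv[OF sub] by (simp add: wprod_append)
    let ?d = "real (plen n (inv x \<circ> y))" and ?e = "real (plen n (wprod (rev (take M1 ts) @ take M2 us)))"
    have "\<bar>?d - ?e\<bar> \<le> \<bar>real i - real M1\<bar> + \<bar>real j - real M2\<bar>"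
      unfolding inv by (rule plen_take_diff[OF sets(1,2)])
    also have "\<dots> \<le> 2 * real (M - L)" using L lo up by (auto simp: of_nat_diff abs_if)
    finally have "\<bar>?d - ?e\<bar> / real n \<le> 2 * real (M - L) / real n" by (rule divide_right_mono) simp
    then have de: "\<bar>?d / real n - ?e / real n\<bar> \<le> 2 * (real (M - L) / real n)"
      by (simp add: diff_divide_distrib[symmetric] abs_divide)
    have "gromov_product n id x y = real m - ?d / 2" unfolding gromov_product_plen[OF xy] pm by simp
    then have "gromov_product n id x y / real n - (a - v / 2) = (real m / real n - a) - (?d / real n - v) / 2"
      by (simp add: diff_divide_distrib)
    moreover have "\<bar>p - (d - r) / 2\<bar> \<le> (\<bar>p\<bar> + h) + 1 / 2 * \<bar>e - r\<bar> + P + Q"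
      if "\<bar>d - e\<bar> \<le> 2 * h" "0 \<le> P" "0 \<le> Q" for p d r h e P Q :: real
    proof -
      have "p \<le> \<bar>p\<bar>" "- p \<le> \<bar>p\<bar>" "e - r \<le> \<bar>e - r\<bar>" "- (e - r) \<le> \<bar>e - r\<bar>" "d - e \<le> 2 * h" "- (d - e) \<le> 2 * h"
        using that(1) by (simp_all only: abs_ge_self abs_ge_minus_self abs_le_iff)
      then have "p - (d - r) / 2 \<le> (\<bar>p\<bar> + h) + 1 / 2 * \<bar>e - r\<bar> + P + Q
          \<and> - (p - (d - r) / 2) \<le> (\<bar>p\<bar> + h) + 1 / 2 * \<bar>e - r\<bar> + P + Q"
        using that(2,3) by (auto simp: field_simps)
      then show ?thesis by (simp only: abs_le_iff)
    qed
    ultimately show ?thesis using de pos(3,4) by (simp only:)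
  qed
qed

text \<open>With \<open>c\<close> from \<open>hitting_level_exists\<close>, the hitting positions lie between \<open>(c - \<epsilon>) n\<close> and
  \<open>(c + \<epsilon>) n\<close> with probability tending to one. Then \<open>|x - y|\<close> differs by \<open>O(\<epsilon> n)\<close> from the length of
  a uniform word with \<open>scaled (2 * c) n\<close> letters, which is \<open>profile (2 * c) * n\<close> to first order.\<close>

lemma supercritical_L1:
  assumes a: "1 / 4 < a" "a < 1"
  shows "\<exists>\<delta>>0. (\<lambda>n. \<integral>(x, y). \<bar>gromov_product n id x y / real n - \<delta>\<bar> \<partial>pair_law n a) \<longlonglongrightarrow> 0"
proof -
  obtain c where c: "c > 1 / 4" "\<And>s. 0 \<le> s \<Longrightarrow> s < c \<Longrightarrow> profile s < a" "\<And>s. c < s \<Longrightarrow> a < profile s"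
    "profile (2 * c) < 2 * a"
    using hitting_level_exists[OF a] by blast
  define v where "v = profile (2 * c)"
  define \<delta> where "\<delta> = a - v / 2"
  have \<delta>: "\<delta> > 0" using c(4) by (simp add: \<delta>_def v_def)
  let ?E = "\<lambda>n. \<integral>(x, y). \<bar>gromov_product n id x y / real n - \<delta>\<bar> \<partial>pair_law n a"
  have nonneg: "0 \<le> ?E n" for n by (rule Bochner_Integration.integral_nonneg) (simp add: case_prod_unfold)
  have small: "\<forall>\<^sub>F n in sequentially. ?E n < 3 * \<epsilon>" if \<epsilon>: "0 < \<epsilon>" "\<epsilon> < c" for \<epsilon>
  proof -
    define s t where "s = c - \<epsilon>" and "t = c + \<epsilon>"
    have st: "0 \<le> s" "s < c" "c < t" "0 \<le> t" using \<epsilon> by (auto simp: s_def t_def)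
    define B where "B = 1 + \<bar>a - v / 2\<bar>"
    define P where "P = (\<lambda>n. wavg n (scaled t n) (\<lambda>ts. of_bool (\<not> hits n (scaled a n) ts)))"
    define Q where "Q = (\<lambda>n. wavg n (scaled s n) (\<lambda>ts. of_bool (hits n (scaled a n) ts)))"
    define D where "D = (\<lambda>n. wavg n (scaled (2 * c) n) (\<lambda>ts. \<bar>real (plen n (wprod ts)) / real n - v\<bar>))"
    have P: "P \<longlonglongrightarrow> 0" unfolding P_def using a st c(3) by (intro not_hits_prob) auto
    have Q: "Q \<longlonglongrightarrow> 0" unfolding Q_def using a st c(2) by (intro early_hits_prob) auto
    have D: "D \<longlonglongrightarrow> 0" unfolding D_def v_def using c(1) by (intro plen_L1_lim) simp
    define U where "U = (\<lambda>n. (2 * \<epsilon> + 2 / real n) + 1 / 2 * D n + B * (P n + Q n) + B * (P n + Q n))"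
    have "U \<longlonglongrightarrow> (2 * \<epsilon> + 0) + 1 / 2 * 0 + B * (0 + 0) + B * (0 + 0)"
      unfolding U_def by (intro tendsto_add tendsto_mult tendsto_const P Q D) real_asymp
    then have "U \<longlonglongrightarrow> 2 * \<epsilon>" by simp
    moreover have "2 * \<epsilon> < 3 * \<epsilon>" using \<epsilon> by simp
    ultimately have "\<forall>\<^sub>F n in sequentially. U n < 3 * \<epsilon>" by (rule order_tendstoD(2))
    moreover have "\<forall>\<^sub>F n in sequentially. \<epsilon> * real n > 3" using \<epsilon> by real_asymp
    ultimately show ?thesis using eventually_ge_at_top[of "2::nat"]
    proof eventually_elim
      case (elim n)
      have n: "n \<ge> 2" "real n > 0" using elim by auto
      define M L N where "M = scaled t n" and "L = scaled s n" and "N = scaled (2 * c) n"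
      \<comment> \<open>the two lengths add up to exactly \<open>N\<close>, and each is within one of \<open>c * n\<close>\<close>
      define M1 where "M1 = N div 2"
      define M2 where "M2 = N - M1"
      let ?m = "scaled a n"
      have MN: "M1 + M2 = N" "real M1 \<le> real N / 2" "real N / 2 - 1 \<le> real M1" "real M2 \<le> real N / 2 + 1" "real N / 2 \<le> real M2"
        unfolding M2_def M1_def by linarith+
      have Nb: "real N / 2 \<le> c * real n" "c * real n - 1 \<le> real N / 2"
        using scaled_bounds[of "2 * c" n] c(1) unfolding N_def by linarith+
      have Mb: "c * real n + \<epsilon> * real n - 1 \<le> real M" "real M \<le> c * real n + \<epsilon> * real n"
        using scaled_bounds[OF st(4), of n] unfolding M_def t_def by (auto simp: algebra_simps)
      have Lb: "real L \<le> c * real n - \<epsilon> * real n" "c * real n - \<epsilon> * real n - 1 \<le> real L"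
        using scaled_bounds[OF st(1), of n] unfolding L_def s_def by (auto simp: algebra_simps)
      have "real L \<le> real M1" "real M1 \<le> real M" "real L \<le> real M2" "real M2 \<le> real M"
        using MN Nb Mb Lb elim(2) by linarith+
      then have ord: "L \<le> M1" "M1 \<le> M" "L \<le> M2" "M2 \<le> M" by simp_all
      have LM: "L \<le> M" using ord by linarith
      define A where "A = \<bar>real ?m / real n - a\<bar> + real (M - L) / real n"
      have A: "A \<le> 2 * \<epsilon> + 2 / real n"
      proof -
        have m: "a * real n - 1 \<le> real ?m" "real ?m \<le> a * real n" using scaled_bounds[of a n] a by auto
        have "real ?m / real n - a = (real ?m - a * real n) / real n" using n by (simp add: field_simps)
        then have "\<bar>real ?m / real n - a\<bar> = \<bar>real ?m - a * real n\<bar> / real n" by (simp add: abs_divide)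
        also have "\<dots> \<le> 1 / real n" using m n by (intro divide_right_mono) auto
        finally have 1: "\<bar>real ?m / real n - a\<bar> \<le> 1 / real n" .
        have "real (M - L) \<le> 2 * \<epsilon> * real n + 1" using Mb Lb LM by (simp add: of_nat_diff)
        then have "real (M - L) / real n \<le> (2 * \<epsilon> * real n + 1) / real n" by (rule divide_right_mono) simp
        also have "\<dots> = 2 * \<epsilon> + 1 / real n" using n by (simp add: field_simps)
        finally show ?thesis using 1 unfolding A_def by simp
      qed
      let ?d = "\<lambda>ts. \<bar>real (plen n (wprod ts)) / real n - v\<bar>"
      let ?b = "\<lambda>ts. B * (of_bool (\<not> hits n ?m ts) + of_bool (hits n ?m (take L ts)))"
      have "?E n \<le> wavg n M (\<lambda>ts. wavg n M (\<lambda>us. A + 1 / 2 * ?d (rev (take M1 ts) @ take M2 us) + ?b ts + ?b us))"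
        unfolding A_def B_def \<delta>_def
        by (intro pair_law_integral_le[OF n(1)] supercritical_pointwise[OF n(1) _ _ _ _ ord])
      also have "\<dots> = A + 1 / 2 * wavg n M (\<lambda>ts. wavg n M (\<lambda>us. ?d (rev (take M1 ts) @ take M2 us)))
          + wavg n M ?b + wavg n M ?b"
        unfolding wavg_add wavg_cmult wavg_const[OF n(1)] ..
      also have "wavg n M (\<lambda>ts. wavg n M (\<lambda>us. ?d (rev (take M1 ts) @ take M2 us))) = D n"
        unfolding D_def using wavg_two_sided[OF n(1) ord(2,4), of ?d] MN(1) by (simp add: N_def)
      also have "wavg n M ?b = B * (P n + Q n)"
        unfolding wavg_add wavg_cmult P_def Q_def
        using wavg_take[OF n(1) LM, of "\<lambda>ts. of_bool (hits n ?m ts)"] by (simp add: M_def L_def)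
      finally have "?E n \<le> U n" using A unfolding U_def by linarith
      then show ?case using elim(1) by linarith
    qed
  qed
  have "?E \<longlonglongrightarrow> 0"
  proof (rule LIMSEQ_I)
    fix e :: real assume e: "0 < e"
    define \<epsilon> where "\<epsilon> = min (e / 3) (c / 2)"
    have "0 < \<epsilon>" "\<epsilon> < c" "3 * \<epsilon> \<le> e" using e c(1) by (auto simp: \<epsilon>_def)
    with small[of \<epsilon>] have "\<forall>\<^sub>F n in sequentially. norm (?E n - 0) < e"
      using nonneg by (auto elim!: eventually_mono)
    then show "\<exists>no. \<forall>n\<ge>no. norm (?E n - 0) < e" by (simp add: eventually_sequentially)
  qed
  then show ?thesis using \<delta> by blast
qed

text \<open>Finitely many small \<open>n\<close> do not affect boundedness; this covers the degenerate cases \<open>n < 2\<close>.\<close>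

lemma bounded_of_eventually:
  fixes f :: "nat \<Rightarrow> real"
  assumes "\<forall>\<^sub>F n in sequentially. f n \<le> C"
  shows "\<exists>C'. \<forall>n. f n \<le> C'"
proof -
  obtain n0 where n0: "\<And>n. n \<ge> n0 \<Longrightarrow> f n \<le> C" using assms by (auto simp: eventually_sequentially)
  have "f n \<le> max C (Max (insert 0 (f ` {..<n0})))" for n
  proof (cases "n < n0")
    case True
    then have "f n \<le> Max (insert 0 (f ` {..<n0}))" by (intro Max_ge) auto
    then show ?thesis by simp
  qed (use n0[of n] in simp)
  then show ?thesis by blast
qed

lemma subcritical_dist:
  assumes a: "0 < a" "a < 1 / 4"
  shows "\<exists>C. \<forall>n. (\<integral>(x, y). real (dist_to_path n id (near_geodesic n x y)) \<partial>pair_law n a) \<le> C"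
proof -
  obtain C where C: "\<forall>\<^sub>F n in sequentially. \<exists>M. wavg n M (\<lambda>ts. wavg n M (\<lambda>us.
      real (card (lassos n (rev ts @ us))) + real n * of_bool (\<not> hits n (scaled a n) ts)
      + real n * of_bool (\<not> hits n (scaled a n) us))) \<le> C"
    using subcritical_bound[OF a] by blast
  have "\<forall>\<^sub>F n in sequentially. (\<integral>(x, y). real (dist_to_path n id (near_geodesic n x y)) \<partial>pair_law n a) \<le> C"
    using C eventually_ge_at_top[of "2::nat"]
  proof eventually_elim
    case (elim n)
    then obtain M where M: "wavg n M (\<lambda>ts. wavg n M (\<lambda>us.
      real (card (lassos n (rev ts @ us))) + real n * of_bool (\<not> hits n (scaled a n) ts)
      + real n * of_bool (\<not> hits n (scaled a n) us))) \<le> C" by blast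
    show ?case
      by (rule order_trans[OF pair_law_integral_le[OF elim(2)] M]) (rule near_geodesic_stopped)
  qed
  then show ?thesis by (rule bounded_of_eventually)
qed

lemma expected_gromov_le_dist:
  assumes n: "n \<ge> 2"
  shows "expected_gromov n a \<le> (\<integral>(x, y). real (dist_to_path n id (near_geodesic n x y)) \<partial>pair_law n a)"
  unfolding expected_gromov_def
proof (rule integral_mono[OF pair_law_integrable[OF n] pair_law_integrable[OF n]])
  fix z assume "z \<in> space (pair_law n a)"
  then show "(case z of (x, y) \<Rightarrow> gromov_product n id x y) \<le> (case z of (x, y) \<Rightarrow> real (dist_to_path n id (near_geodesic n x y)))"
    using gromov_product_le_dist_to_path near_geodesic(1) by (auto simp: space_pair_law)
qed

theorem theorem1:
  fixes a :: real
  assumes "0 < a" and "a < 1"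
  shows
    "(a < 1/4 \<longrightarrow>
        (\<exists>\<delta>. \<forall>n\<ge>1. expected_gromov n a \<le> \<delta>) \<and>
        (\<exists>\<delta>' \<E> \<gamma>.
           (\<forall>n\<ge>1. \<E> n \<in> sets (pair_law n a)) \<and>
           (\<lambda>n. measure (pair_law n a) (\<E> n)) \<longlonglongrightarrow> 1 \<and>
           (\<forall>n\<ge>1. \<forall>x y. (x, y) \<in> \<E> n \<longrightarrow> geodesic n x y (\<gamma> n x y)) \<and>
           (\<forall>n\<ge>1. cond_expect (pair_law n a) (\<E> n)
                     (\<lambda>(x, y). real (dist_to_path n id (\<gamma> n x y))) \<le> \<delta>'))) \<and>
     (a > 1/4 \<longrightarrow>
        (\<exists>\<delta>>0. (\<lambda>n. expected_gromov n a) \<sim>[at_top] (\<lambda>n. \<delta> * real n)) \<and>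
        (\<exists>\<delta>'>0. (\<lambda>n. measure (pair_law n a)
             {(x, y) \<in> space (pair_law n a).
                \<forall>\<gamma>. geodesic n x y \<gamma> \<longrightarrow> real (dist_to_path n id \<gamma>) \<ge> \<delta>' * real n})
           \<longlonglongrightarrow> 1))"
proof (intro conjI impI)
  assume sub: "a < 1/4"
  obtain C where C: "\<And>n. (\<integral>(x, y). real (dist_to_path n id (near_geodesic n x y)) \<partial>pair_law n a) \<le> C"
    using subcritical_dist[of a] assms(1) sub by auto
  have ev2: "\<forall>\<^sub>F n in sequentially. n \<ge> (2::nat)" by (rule eventually_ge_at_top)
  have "\<forall>\<^sub>F n in sequentially. expected_gromov n a \<le> C"
    using ev2
  proof eventually_elim
    case (elim n)
    show ?case by (rule order_trans[OF expected_gromov_le_dist[OF elim] C])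
  qed
  from bounded_of_eventually[OF this]
  show "\<exists>\<delta>. \<forall>n\<ge>1. expected_gromov n a \<le> \<delta>" by blast
  have ce: "cond_expect (pair_law n a) (perms n \<times> perms n) f = integral\<^sup>L (pair_law n a) f" if n: "n \<ge> 2" for n f
  proof -
    interpret prob_space "pair_law n a" by (rule prob_space_pair_law[OF n])
    show ?thesis
      using set_integral_space[OF pair_law_integrable[OF n, of a f]] prob_space
      by (simp add: cond_expect_def space_pair_law)
  qed
  have "\<forall>\<^sub>F n in sequentially. cond_expect (pair_law n a) (perms n \<times> perms n)
      (\<lambda>(x, y). real (dist_to_path n id (near_geodesic n x y))) \<le> C"
    using ev2
  proof eventually_elim
    case (elim n)
    show ?case unfolding ce[OF elim] by (rule C)
  qed
  from bounded_of_eventually[OF this] obtain C' where C': "\<And>n. cond_expect (pair_law n a) (perms n \<times> perms n)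
      (\<lambda>(x, y). real (dist_to_path n id (near_geodesic n x y))) \<le> C'"
    by blast
  show "\<exists>\<delta>' \<E> \<gamma>.
           (\<forall>n\<ge>1. \<E> n \<in> sets (pair_law n a)) \<and>
           (\<lambda>n. measure (pair_law n a) (\<E> n)) \<longlonglongrightarrow> 1 \<and>
           (\<forall>n\<ge>1. \<forall>x y. (x, y) \<in> \<E> n \<longrightarrow> geodesic n x y (\<gamma> n x y)) \<and>
           (\<forall>n\<ge>1. cond_expect (pair_law n a) (\<E> n)
                     (\<lambda>(x, y). real (dist_to_path n id (\<gamma> n x y))) \<le> \<delta>')"
  \<comment> \<open>the bound holds in mean over all pairs, so that the event may be the whole space\<close>
  proof (intro exI[of _ C'] exI[of _ "\<lambda>n. perms n \<times> perms n"] exI[of _ near_geodesic] conjI allI impI)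
    show "perms n \<times> perms n \<in> sets (pair_law n a)" for n by (simp add: sets_pair_law)
    have "\<forall>\<^sub>F n in sequentially. 1 = measure (pair_law n a) (perms n \<times> perms n)"
      using ev2
    proof eventually_elim
      case (elim n)
      show ?case using prob_space.prob_space[OF prob_space_pair_law[OF elim]] by (simp add: space_pair_law)
    qed
    then show "(\<lambda>n. measure (pair_law n a) (perms n \<times> perms n)) \<longlonglongrightarrow> 1"
      by (rule Lim_transform_eventually[OF tendsto_const])
  qed (use near_geodesic(1) C' in auto)
next
  assume sup: "1/4 < a"
  obtain \<delta> where \<delta>: "\<delta> > 0"
    and lim: "(\<lambda>n. \<integral>(x, y). \<bar>gromov_product n id x y / real n - \<delta>\<bar> \<partial>pair_law n a) \<longlonglongrightarrow> 0"
    using supercritical_L1[of a] sup assms(2) by auto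
  let ?E = "\<lambda>n. \<integral>(x, y). \<bar>gromov_product n id x y / real n - \<delta>\<bar> \<partial>pair_law n a"
  have ev2: "\<forall>\<^sub>F n in sequentially. n \<ge> (2::nat)" by (rule eventually_ge_at_top)
  have mean: "\<forall>\<^sub>F n in sequentially. norm (expected_gromov n a / real n - \<delta>) \<le> ?E n"
    using ev2
  proof eventually_elim
    case (elim n)
    interpret prob_space "pair_law n a" by (rule prob_space_pair_law[OF elim])
    let ?f = "\<lambda>(x, y). gromov_product n id x y / real n"
    have "expected_gromov n a / real n - \<delta> = (\<integral>z. ?f z \<partial>pair_law n a) - (\<integral>z. \<delta> \<partial>pair_law n a)"
      by (simp add: expected_gromov_def case_prod_unfold prob_space)
    also have "\<dots> = (\<integral>z. ?f z - \<delta> \<partial>pair_law n a)"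
      by (rule Bochner_Integration.integral_diff[symmetric]; rule pair_law_integrable[OF elim])
    finally have "norm (expected_gromov n a / real n - \<delta>) \<le> (\<integral>z. \<bar>?f z - \<delta>\<bar> \<partial>pair_law n a)"
      by (simp only: real_norm_def integral_abs_bound)
    then show ?case by (simp add: case_prod_unfold)
  qed
  have "(\<lambda>n. expected_gromov n a / real n - \<delta>) \<longlonglongrightarrow> 0"
    by (rule Lim_null_comparison[OF mean lim])
  then have "(\<lambda>n. expected_gromov n a / real n) \<longlonglongrightarrow> \<delta>" by (simp add: LIM_zero_iff)
  then have "(\<lambda>n. expected_gromov n a / real n / \<delta>) \<longlonglongrightarrow> \<delta> / \<delta>"
    using \<delta> by (intro tendsto_divide tendsto_const) auto
  then have "(\<lambda>n. expected_gromov n a / (\<delta> * real n)) \<longlonglongrightarrow> 1"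
    using \<delta> by (simp add: mult.commute)
  then have "(\<lambda>n. expected_gromov n a) \<sim>[at_top] (\<lambda>n. \<delta> * real n)" by (rule asymp_equivI')
  then show "\<exists>\<delta>>0. (\<lambda>n. expected_gromov n a) \<sim>[at_top] (\<lambda>n. \<delta> * real n)" using \<delta> by blast
  define \<E> where "\<E> = (\<lambda>n. {(x, y) \<in> space (pair_law n a).
                \<forall>\<gamma>. geodesic n x y \<gamma> \<longrightarrow> real (dist_to_path n id \<gamma>) \<ge> \<delta> / 2 * real n})"
  have low: "\<forall>\<^sub>F n in sequentially. 1 - 2 / \<delta> * ?E n \<le> measure (pair_law n a) (\<E> n)"
    using ev2
  proof eventually_elim
    case (elim n)
    interpret prob_space "pair_law n a" by (rule prob_space_pair_law[OF elim])
    let ?f = "\<lambda>(x, y). gromov_product n id x y / real n"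
    have meas: "\<E> n \<in> sets (pair_law n a)" by (auto simp: \<E>_def sets_pair_law space_pair_law)
    have "1 - 2 / \<delta> * ?E n = (\<integral>z. 1 - 2 / \<delta> * \<bar>?f z - \<delta>\<bar> \<partial>pair_law n a)"
      using pair_law_integrable[OF elim, of a "\<lambda>z. \<bar>?f z - \<delta>\<bar>"]
      by (simp add: case_prod_unfold prob_space)
    also have "\<dots> \<le> (\<integral>z. indicator (\<E> n) z \<partial>pair_law n a)"
    proof (rule integral_mono[OF pair_law_integrable[OF elim] pair_law_integrable[OF elim]])
      fix z assume z: "z \<in> space (pair_law n a)"
      obtain x y where xy: "z = (x, y)" "x \<in> perms n" "y \<in> perms n" using z by (auto simp: space_pair_law)
      show "1 - 2 / \<delta> * \<bar>?f z - \<delta>\<bar> \<le> indicator (\<E> n) z"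
      proof (cases "\<delta> / 2 \<le> gromov_product n id x y / real n")
        case True
        then have "\<delta> / 2 * real n \<le> gromov_product n id x y" using elim by (simp add: field_simps)
        then have "z \<in> \<E> n"
          using gromov_product_le_dist_to_path[OF xy(2,3)] z unfolding xy(1) \<E>_def by fastforce
        then show ?thesis using \<delta> by simp
      next
        case False
        then have "\<delta> / 2 \<le> \<bar>gromov_product n id x y / real n - \<delta>\<bar>" by linarith
        then have "\<delta> / 2 \<le> \<bar>?f z - \<delta>\<bar>" unfolding xy(1) by simp
        then have "1 \<le> 2 / \<delta> * \<bar>?f z - \<delta>\<bar>" using \<delta> by (simp add: field_simps)
        then show ?thesis using indicator_pos_le[of "\<E> n" z] by (simp only: diff_le_eq) (smt (verit) indicator_pos_le)
      qed
    qed
    also have "\<dots> = measure (pair_law n a) (\<E> n)" using meas by simp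
    finally show ?case .
  qed
  have up: "\<forall>\<^sub>F n in sequentially. measure (pair_law n a) (\<E> n) \<le> 1"
    using ev2
  proof eventually_elim
    case (elim n)
    interpret prob_space "pair_law n a" by (rule prob_space_pair_law[OF elim])
    show ?case by simp
  qed
  have "(\<lambda>n. 1 - 2 / \<delta> * ?E n) \<longlonglongrightarrow> 1 - 2 / \<delta> * 0"
    by (intro tendsto_diff tendsto_mult tendsto_const lim)
  then have "(\<lambda>n. 1 - 2 / \<delta> * ?E n) \<longlonglongrightarrow> 1" by simp
  from real_tendsto_sandwich[OF low up this tendsto_const]
  have "(\<lambda>n. measure (pair_law n a) (\<E> n)) \<longlonglongrightarrow> 1" .
  then show "\<exists>\<delta>'>0. (\<lambda>n. measure (pair_law n a)
             {(x, y) \<in> space (pair_law n a).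
                \<forall>\<gamma>. geodesic n x y \<gamma> \<longrightarrow> real (dist_to_path n id \<gamma>) \<ge> \<delta>' * real n})
           \<longlonglongrightarrow> 1"
    unfolding \<E>_def using \<delta> by (intro exI[of _ "\<delta> / 2"]) simp
qed

end
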